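(* Let $m\ge2$ be an integer and let $G$ be an arbitrary Cayley graph (with respect to a finite symmetric generating set not containing the identity) of the lamplighter group $\mathbb{Z}_m\wr\mathbb{Z}$. Consider independent site or independent bond percolation on $G$ with parameter $p<p_c$, where $p_c$ is the corresponding critical parameter. Then there are positive constants $b_1,b_2$ such that $$N^D(E)\le N^A(E)\le e^{-b_1e^{b_2E^{-1/2}}}\quad\text{for all }E>0\text{ small enough}.$$
   Context: $\mathbb{Z}_m\wr\mathbb{Z}$ is the set of pairs $(\varphi,x)$ with $\varphi:\mathbb{Z}\to\mathbb{Z}_m$ finitely supported and $x\in\mathbb{Z}$, with product $(\varphi_1,x_1)(\varphi_2,x_2)=(\varphi_1+\varphi_2(\cdot-x_1),x_1+x_2)$. Let $k=|S|$ for the generating set $S$, $\iota$ the identity. Site percolation: vertices open independently with probability $p$, $G(\omega)$ the induced subgraph on open vertices; bond percolation: edges open independently with probability $p$, $G(\omega)$ consisting of open edges and their endpoints. $p_c$: for $p<p_c$ almost surely no infinite cluster, for $p>p_c$ almost surely an infinite cluster. For a subgraph $G'=(V',E')$ with degrees $d_{G'}(x)$: $(D(G')\varphi)(x)=d_{G'}(x)\varphi(x)$, $(A(G')\varphi)(x)=\sum_{y\in V',y\sim_{G'}x}\varphi(y)$, $\Delta^A(G')=k\,\mathrm{Id}-A(G')$, $\Delta^D(G')=2k\,\mathrm{Id}-D(G')-A(G')$. $\Delta^{\#}_\omega=\Delta^{\#}(G(\omega))$ on $\ell^2(V(\omega))$, and $N^{\#}(E)=\mathbb{E}\{\langle\chi_{(-\infty,E]}(\Delta^{\#}_\omega)\delta_\iota,\delta_\iota\rangle\}$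 with the inner product taken as $0$ if $\iota\notin V(\omega)$. *)

theory Defs
  imports "HOL-Probability.Probability"
begin

type_synonym ll = "(int \<Rightarrow> int) \<times> int"

definition ll_carrier :: "int \<Rightarrow> ll set" where
  "ll_carrier m = {(\<phi>, x). (\<forall>i. 0 \<le> \<phi> i \<and> \<phi> i < m) \<and> finite {i. \<phi> i \<noteq> 0}}"

definition ll_mult :: "int \<Rightarrow> ll \<Rightarrow> ll \<Rightarrow> ll" where
  "ll_mult m a b = ((\<lambda>i. (fst a i + fst b (i - snd a)) mod m), snd a + snd b)"

definition ll_one :: ll where
  "ll_one = ((\<lambda>_. 0), 0)"

definition ll_inv :: "int \<Rightarrow> ll \<Rightarrow> ll" where
  "ll_inv m a = ((\<lambda>i. (- fst a (i + snd a)) mod m), - snd a)"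

text \<open>Subsemigroup-with-identity generated by S (S symmetric, so this is the generated subgroup).\<close>
inductive_set ll_gen :: "int \<Rightarrow> ll set \<Rightarrow> ll set" for m S where
  one: "ll_one \<in> ll_gen m S"
| step: "g \<in> ll_gen m S \<Longrightarrow> s \<in> S \<Longrightarrow> ll_mult m g s \<in> ll_gen m S"

definition cayley_gen_set :: "int \<Rightarrow> ll set \<Rightarrow> bool" where
  "cayley_gen_set m S \<longleftrightarrow> finite S \<and> S \<subseteq> ll_carrier m \<and> ll_one \<notin> S
     \<and> (\<forall>s\<in>S. ll_inv m s \<in> S) \<and> ll_carrier m \<subseteq> ll_gen m S"

definition cay_adj :: "int \<Rightarrow> ll set \<Rightarrow> ll \<Rightarrow> ll \<Rightarrow> bool" where
  "cay_adj m S x y \<longleftrightarrow> x \<in> ll_carrier m \<and> y \<in> ll_carrier m \<and> (\<exists>s\<in>S. y = ll_mult m x s)"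

definition cay_edges :: "int \<Rightarrow> ll set \<Rightarrow> ll set set" where
  "cay_edges m S = {{x, y} | x y. cay_adj m S x y}"

datatype perc_model = Site | Bond

text \<open>Configurations are indexed by sets of vertices: for site percolation the index
  set is the set of singletons {x} (vertex x is open iff omega {x}); for bond percolation the
  index set is the set of edges {x,y}.\<close>
definition perc_index :: "perc_model \<Rightarrow> int \<Rightarrow> ll set \<Rightarrow> ll set set" where
  "perc_index model m S = (case model of
      Site \<Rightarrow> (\<lambda>x. {x}) ` ll_carrier m
    | Bond \<Rightarrow> cay_edges m S)"

definition perc_space :: "perc_model \<Rightarrow> int \<Rightarrow> ll set \<Rightarrow> real \<Rightarrow> (ll set \<Rightarrow> bool) measure" where
  "perc_space model m S p = PiM (perc_index model m S) (\<lambda>_. measure_pmf (bernoulli_pmf p))"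

definition perc_V :: "perc_model \<Rightarrow> int \<Rightarrow> ll set \<Rightarrow> (ll set \<Rightarrow> bool) \<Rightarrow> ll set" where
  "perc_V model m S \<omega> = (case model of
      Site \<Rightarrow> {x \<in> ll_carrier m. \<omega> {x}}
    | Bond \<Rightarrow> {x \<in> ll_carrier m. \<exists>y. cay_adj m S x y \<and> \<omega> {x, y}})"

definition perc_adj :: "perc_model \<Rightarrow> int \<Rightarrow> ll set \<Rightarrow> (ll set \<Rightarrow> bool) \<Rightarrow> ll \<Rightarrow> ll \<Rightarrow> bool" where
  "perc_adj model m S \<omega> x y = (case model of
      Site \<Rightarrow> cay_adj m S x y \<and> \<omega> {x} \<and> \<omega> {y}
    | Bond \<Rightarrow> cay_adj m S x y \<and> \<omega> {x, y})"

definition has_inf_cluster :: "'v set \<Rightarrow> ('v \<Rightarrow> 'v \<Rightarrow> bool) \<Rightarrow> bool" where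
  "has_inf_cluster W a \<longleftrightarrow> (\<exists>x\<in>W. infinite {y. a\<^sup>*\<^sup>* x y})"

definition p_crit :: "perc_model \<Rightarrow> int \<Rightarrow> ll set \<Rightarrow> real" where
  "p_crit model m S = Sup {p \<in> {0..1}.
      measure (perc_space model m S p)
        {\<omega> \<in> space (perc_space model m S p).
           has_inf_cluster (perc_V model m S \<omega>) (perc_adj model m S \<omega>)} = 0}"

definition deg :: "'v set \<Rightarrow> ('v \<Rightarrow> 'v \<Rightarrow> bool) \<Rightarrow> 'v \<Rightarrow> real" where
  "deg W a x = real (card {y \<in> W. a x y})"

definition lap_A :: "nat \<Rightarrow> 'v set \<Rightarrow> ('v \<Rightarrow> 'v \<Rightarrow> bool) \<Rightarrow> 'v \<Rightarrow> 'v \<Rightarrow> real" where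
  "lap_A k W a x y = (if x = y then real k else 0) - (if a x y then 1 else 0)"

definition lap_D :: "nat \<Rightarrow> 'v set \<Rightarrow> ('v \<Rightarrow> 'v \<Rightarrow> bool) \<Rightarrow> 'v \<Rightarrow> 'v \<Rightarrow> real" where
  "lap_D k W a x y = (if x = y then 2 * real k - deg W a x else 0) - (if a x y then 1 else 0)"

text \<open>Matrix entries of H^n on l^2(W), where H x z vanishes unless z = x or z adjacent to x.\<close>
fun mpow :: "('v \<Rightarrow> 'v \<Rightarrow> real) \<Rightarrow> 'v set \<Rightarrow> ('v \<Rightarrow> 'v \<Rightarrow> bool) \<Rightarrow> nat \<Rightarrow> 'v \<Rightarrow> 'v \<Rightarrow> real" where
  "mpow H W a 0 x y = (if x = y then 1 else 0)"
| "mpow H W a (Suc n) x y = (\<Sum>z \<in> {z \<in> W. z = x \<or> a x z}. H x z * mpow H W a n z y)"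

text \<open>The spectral measure of H at delta_o: the (unique) compactly supported finite Borel
  measure on the reals whose moments are the diagonal entries of H^n at o.  Then
  <chi_(-inf,E](H) delta_o, delta_o> = mu((-inf,E]); it is 0 if o is not in W.\<close>
definition spec_cdf :: "('v \<Rightarrow> 'v \<Rightarrow> real) \<Rightarrow> 'v set \<Rightarrow> ('v \<Rightarrow> 'v \<Rightarrow> bool) \<Rightarrow> 'v \<Rightarrow> real \<Rightarrow> real" where
  "spec_cdf H W a r E = (if r \<in> W then
      measure (THE \<mu>. sets \<mu> = sets borel \<and> finite_measure \<mu>
                  \<and> (\<exists>C. emeasure \<mu> (UNIV - {-C..C}) = 0)
                  \<and> (\<forall>n. (\<integral>t. t ^ n \<partial>\<mu>) = mpow H W a n r r)) {..E}
    else 0)"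

datatype lap_kind = LapA | LapD

definition ids_integrand :: "lap_kind \<Rightarrow> perc_model \<Rightarrow> int \<Rightarrow> ll set \<Rightarrow> real \<Rightarrow> (ll set \<Rightarrow> bool) \<Rightarrow> real" where
  "ids_integrand lk model m S E \<omega> =
     (let W = perc_V model m S \<omega>; a = perc_adj model m S \<omega>;
          H = (case lk of LapA \<Rightarrow> lap_A (card S) W a | LapD \<Rightarrow> lap_D (card S) W a)
      in spec_cdf H W a ll_one E)"

definition IDS :: "lap_kind \<Rightarrow> perc_model \<Rightarrow> int \<Rightarrow> ll set \<Rightarrow> real \<Rightarrow> real \<Rightarrow> real" where
  "IDS lk model m S p E = (\<integral>\<omega>. ids_integrand lk model m S E \<omega> \<partial>(perc_space model m S p))"

end

theory Submission
  imports Defs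
begin

text \<open>
  If \<open>E\<close> lies below all eigenvalues of the Laplacian of the (almost surely finite) cluster of the
  identity, that cluster does not contribute to \<open>N\<^sup>A(E)\<close>.  The lamplighter group contains a free
  semigroup on two letters, so displacing a function along \<open>2 ^ r\<close> words of length \<open>r\<close> shows that
  a set of \<open>n\<close> vertices has lowest eigenvalue at least of order \<open>(ln n) powr -2\<close>; hence only
  clusters of size \<open>exp (b * E powr (-1/2))\<close> contribute, and below \<open>p\<^sub>c\<close> the cluster size has
  an exponential tail.  For the latter, both models are regarded as site percolation on the index
  set and Vanneuville's stochastic comparison is used.  The inequality between \<open>N\<^sup>D\<close> and
  \<open>N\<^sup>A\<close> holds for traces over finite clusters, to which mass transport reduces it.  On the
  null set with infinite clusters measurability is still required: there the spectral measure is
  obtained as a weak limit of those of finite balls, and it is determined measurably by its moments.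
\<close>

section \<open>Spectral theory of finite symmetric matrices\<close>

text \<open>The bound is doubly exponential because two exponentials compose: the tail is
  exponential in the cluster size, and the size needed to reach energy \<open>E\<close> is
  exponential in \<open>E powr (-1/2)\<close>, since a word of length \<open>r\<close> displaces a
  function at most of order \<open>r\<close> times as far as a generator does, while there are
  \<open>2 ^ r\<close> words. \<open>spec_cdf\<close> selects its measure by prescribed moments.
  Every spectral fact therefore passes through moments: existence through finite matrices,
  uniqueness through polynomial approximation, translation invariance through matrix entries.
  \<open>p_crit\<close> is a supremum over parameters without infinite clusters, a purely
  qualitative condition. It becomes quantitative by descending from such a parameter
  \<open>P\<close> above \<open>p\<close>: the gap between the two pays for the loss in a Laplace
  transform of the cluster size at \<open>P\<close>. Exploration deletes vertices and moves the
  starting point, so this transform has to be close to 1 uniformly over finite windows and starting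
  indices.\<close>

lemma underdetermined_system:
  fixes M :: "'i \<Rightarrow> 'j \<Rightarrow> real"
  assumes "finite I" "finite J" "card I < card J"
  shows "\<exists>c. (\<exists>j\<in>J. c j \<noteq> 0) \<and> (\<forall>i\<in>I. (\<Sum>j\<in>J. M i j * c j) = 0)"
  using assms
proof (induction I arbitrary: M J rule: finite_induct)
  case empty
  then have "J \<noteq> {}" by auto
  then show ?case by (intro exI[of _ "\<lambda>_. 1"]) auto
next
  case (insert i0 I)
  show ?case
  proof (cases "\<forall>j\<in>J. M i0 j = 0")
    case True
    have "card I < card J" using insert by auto
    from insert.IH[OF \<open>finite J\<close> this, of M] obtain c where
      "\<exists>j\<in>J. c j \<noteq> 0" "\<forall>i\<in>I. (\<Sum>j\<in>J. M i j * c j) = 0" by auto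
    then show ?thesis using True by (intro exI[of _ c]) auto
  next
    case False
    then obtain j0 where j0: "j0 \<in> J" "M i0 j0 \<noteq> 0" by auto
    define J' where "J' = J - {j0}"
    have J': "finite J'" "card I < card J'" "j0 \<notin> J'" "J = insert j0 J'"
      using insert j0 by (auto simp: J'_def)
    \<comment> \<open>Gaussian elimination with pivot \<open>M i0 j0\<close>: the unknown
      \<open>j0\<close> disappears from the other equations and is recovered from equation
      \<open>i0\<close> afterwards.\<close>
    define M' where "M' i j = M i j - M i j0 * M i0 j / M i0 j0" for i j
    from insert.IH[OF J'(1,2), of M'] obtain c where
      c: "\<exists>j\<in>J'. c j \<noteq> 0" "\<forall>i\<in>I. (\<Sum>j\<in>J'. M' i j * c j) = 0" by auto
    define s where "s = (\<Sum>j\<in>J'. M i0 j * c j)"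
    define d where "d j = (if j = j0 then - s / M i0 j0 else c j)" for j
    have d: "(\<Sum>j\<in>J. M i j * d j) = (\<Sum>j\<in>J'. M i j * c j) - M i j0 * s / M i0 j0" for i
    proof -
      have "(\<Sum>j\<in>J'. M i j * d j) = (\<Sum>j\<in>J'. M i j * c j)"
        by (rule sum.cong) (use J' in \<open>auto simp: d_def\<close>)
      then show ?thesis using J' by (simp add: d_def)
    qed
    have "(\<Sum>j\<in>J. M i j * d j) = 0" if "i \<in> insert i0 I" for i
    proof (cases "i = i0")
      case True
      then show ?thesis using j0 unfolding d by (simp add: s_def)
    next
      case False
      then have "i \<in> I" using that by auto
      have "(\<Sum>j\<in>J'. M' i j * c j) = (\<Sum>j\<in>J'. M i j * c j) - M i j0 * s / M i0 j0"
        by (simp add: M'_def s_def left_diff_distrib sum_subtractf sum_distrib_left sum_divide_distrib mult.assoc)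
      then show ?thesis using c \<open>i \<in> I\<close> unfolding d by auto
    qed
    moreover have "\<exists>j\<in>J. d j \<noteq> 0" using c(1) J' by (auto simp: d_def)
    ultimately show ?thesis by blast
  qed
qed

section \<open>Quadratic forms and orthonormal eigenbases on a finite set; only values on
  \<open>F\<close> count\<close>

definition dot :: "'v set \<Rightarrow> ('v \<Rightarrow> real) \<Rightarrow> ('v \<Rightarrow> real) \<Rightarrow> real" where
  "dot F f g = (\<Sum>x\<in>F. f x * g x)"

definition matvec :: "('v \<Rightarrow> 'v \<Rightarrow> real) \<Rightarrow> 'v set \<Rightarrow> ('v \<Rightarrow> real) \<Rightarrow> 'v \<Rightarrow> real" where
  "matvec H F f x = (\<Sum>y\<in>F. H x y * f y)"

lemma dot_commute: "dot F f g = dot F g f"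
  by (simp add: dot_def mult.commute)

lemma dot_add_scale_right: "dot F f (\<lambda>x. g x + t * h x) = dot F f g + t * dot F f h"
  by (simp add: dot_def algebra_simps sum.distrib sum_distrib_left)

lemma dot_add_scale_left: "dot F (\<lambda>x. g x + t * h x) f = dot F g f + t * dot F h f"
  by (simp add: dot_def algebra_simps sum.distrib sum_distrib_left)

lemma dot_scale_right: "dot F f (\<lambda>x. t * h x) = t * dot F f h"
  by (simp add: dot_def algebra_simps sum_distrib_left)

lemma dot_scale_left: "dot F (\<lambda>x. t * h x) f = t * dot F h f"
  by (simp add: dot_def algebra_simps sum_distrib_left)

lemma dot_sum_right: "dot F f (\<lambda>x. \<Sum>i\<in>I. c i * h i x) = (\<Sum>i\<in>I. c i * dot F f (h i))"
  unfolding dot_def sum_distrib_left by (subst sum.swap) (simp add: algebra_simps)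

lemma dot_self_nonneg: "0 \<le> dot F f f"
  by (simp add: dot_def sum_nonneg)

lemma dot_self_eq_0: "finite F \<Longrightarrow> dot F f f = 0 \<longleftrightarrow> (\<forall>x\<in>F. f x = 0)"
  by (simp add: dot_def sum_nonneg_eq_0_iff)

lemma dot_cong: "(\<And>x. x \<in> F \<Longrightarrow> f x = f' x) \<Longrightarrow> (\<And>x. x \<in> F \<Longrightarrow> g x = g' x) \<Longrightarrow> dot F f g = dot F f' g'"
  by (simp add: dot_def)

lemma matvec_add_scale: "matvec H F (\<lambda>x. g x + t * h x) = (\<lambda>x. matvec H F g x + t * matvec H F h x)"
  by (rule ext) (simp add: matvec_def algebra_simps sum.distrib sum_distrib_left)

lemma matvec_scale: "matvec H F (\<lambda>x. t * h x) = (\<lambda>x. t * matvec H F h x)"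
  by (rule ext) (simp add: matvec_def algebra_simps sum_distrib_left)

lemma dot_matvec_symmetric:
  assumes "\<And>x y. x \<in> F \<Longrightarrow> y \<in> F \<Longrightarrow> H x y = H y x"
  shows "dot F f (matvec H F g) = dot F (matvec H F f) g"
proof -
  have "dot F f (matvec H F g) = (\<Sum>x\<in>F. \<Sum>y\<in>F. f x * (H x y * g y))"
    by (simp add: dot_def matvec_def sum_distrib_left)
  also have "\<dots> = (\<Sum>y\<in>F. \<Sum>x\<in>F. f x * (H x y * g y))" by (rule sum.swap)
  also have "\<dots> = (\<Sum>y\<in>F. \<Sum>x\<in>F. H y x * f x * g y)"
    by (intro sum.cong refl) (simp add: assms)
  finally show ?thesis by (simp add: dot_def matvec_def sum_distrib_right)
qed

text \<open>Minimise the quadratic form over unit vectors orthogonal to the given eigenvectors. By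
  symmetry the residual of the minimiser is again orthogonal to them, hence an admissible direction
  of variation, and minimality forces it to vanish.\<close>

lemma symmetric_eigenvector_orthogonal:
  fixes H :: "'v \<Rightarrow> 'v \<Rightarrow> real" and e :: "nat \<Rightarrow> 'v \<Rightarrow> real"
  assumes F: "finite F" and sym: "\<And>x y. x \<in> F \<Longrightarrow> y \<in> F \<Longrightarrow> H x y = H y x"
    and eig: "\<And>i x. i < n \<Longrightarrow> x \<in> F \<Longrightarrow> matvec H F (e i) x = l i * e i x"
    and orth: "\<And>i. i < n \<Longrightarrow> dot F (e i) \<phi> = 0" and nz: "x0 \<in> F" "\<phi> x0 \<noteq> 0"
  shows "\<exists>\<psi> \<mu>. dot F \<psi> \<psi> = 1 \<and> (\<forall>i<n. dot F (e i) \<psi> = 0) \<and> (\<forall>x\<in>F. matvec H F \<psi> x = \<mu> * \<psi> x)"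
proof -
  \<comment> \<open>A cube with the coordinates outside \<open>F\<close> pinned to 0 is compact in
    the product topology by Tychonoff; the constraint set is a closed subset of it.\<close>
  define B where "B = PiE UNIV (\<lambda>x. if x \<in> F then {-1..1::real} else {0})"
  define S where "S = {f. (\<forall>x. x \<notin> F \<longrightarrow> f x = 0) \<and> dot F f f = 1 \<and> (\<forall>i<n. dot F (e i) f = 0)}"
  have cB: "compact B" unfolding B_def compactin_euclidean_iff[symmetric] euclidean_product_topology[symmetric]
    by (subst compactin_PiE) auto
  have cont: "continuous_on A (\<lambda>f. f x)" for A :: "('v \<Rightarrow> real) set" and x
    by (rule continuous_on_product_then_coordinatewise[OF continuous_on_id])
  have clS: "closed S"
  proof -
    have "S = (\<Inter>x\<in>-F. {f. f x = 0}) \<inter> {f. dot F f f = 1} \<inter> (\<Inter>i\<in>{..<n}. {f. dot F (e i) f = 0})"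
      unfolding S_def by auto
    also have "closed \<dots>"
      unfolding dot_def
      by (intro closed_Int closed_INT ballI closed_Collect_eq continuous_intros cont)
    finally show ?thesis .
  qed
  have SB: "S \<subseteq> B"
  proof
    fix f assume f: "f \<in> S"
    have "f x \<in> {-1..1}" if "x \<in> F" for x
    proof -
      have "(f x)\<^sup>2 \<le> dot F f f" unfolding dot_def power2_eq_square
        using member_le_sum[OF that _ F, of "\<lambda>x. f x * f x"] by simp
      then have "(f x)\<^sup>2 \<le> 1" using f by (simp add: S_def)
      then show ?thesis by (simp add: abs_square_le_1 abs_le_iff)
    qed
    then show "f \<in> B" using f by (auto simp: B_def S_def)
  qed
  have cS: "compact S" using compact_Int_closed[OF cB clS] SB by (simp add: Int_absorb1)
  have norm_pos: "0 < dot F g g" if "x \<in> F" "g x \<noteq> 0" for g and x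
    using dot_self_eq_0[OF F, of g] dot_self_nonneg[of F g] that by force
  have normalize: "(\<lambda>x. if x \<in> F then g x / sqrt (dot F g g) else 0) \<in> S"
    if "x \<in> F" "g x \<noteq> 0" "\<And>i. i < n \<Longrightarrow> dot F (e i) g = 0" for g x
  proof -
    define s where "s = inverse (sqrt (dot F g g))"
    have s: "s * (s * dot F g g) = 1"
      using norm_pos[of _ g, OF that(1,2)] by (simp add: s_def field_simps)
    have "dot F f (\<lambda>x. if x \<in> F then g x / sqrt (dot F g g) else 0) = s * dot F f g" for f
      unfolding dot_scale_right[symmetric] by (rule dot_cong) (auto simp: s_def field_simps)
    moreover have "dot F (\<lambda>x. if x \<in> F then g x / sqrt (dot F g g) else 0) g = s * dot F g g"
      unfolding dot_scale_left[symmetric] by (rule dot_cong) (auto simp: s_def field_simps)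
    ultimately show ?thesis using s that(3) by (simp add: S_def)
  qed
  have "S \<noteq> {}" using normalize[OF nz orth] by auto
  define Q where "Q f = dot F f (matvec H F f)" for f
  have "continuous_on S Q" unfolding Q_def dot_def matvec_def by (intro continuous_intros cont)
  from continuous_attains_inf[OF cS \<open>S \<noteq> {}\<close> this] obtain \<psi> where
    \<psi>: "\<psi> \<in> S" and min: "\<And>f. f \<in> S \<Longrightarrow> Q \<psi> \<le> Q f" by blast
  define \<mu> where "\<mu> = Q \<psi>"
  have lower: "\<mu> * dot F g g \<le> Q g" if "\<And>i. i < n \<Longrightarrow> dot F (e i) g = 0" for g
  proof (cases "\<forall>x\<in>F. g x = 0")
    case True
    then show ?thesis by (simp add: Q_def dot_def)
  next
    case False
    then obtain x where x: "x \<in> F" "g x \<noteq> 0" by auto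
    define s where "s = inverse (sqrt (dot F g g))"
    have s: "s * s * dot F g g = 1" "s \<noteq> 0"
      using norm_pos[of _ g, OF x] by (simp_all add: s_def field_simps)
    let ?g = "\<lambda>x. if x \<in> F then g x / sqrt (dot F g g) else 0"
    have "Q ?g = Q (\<lambda>x. s * g x)"
      unfolding Q_def by (intro dot_cong) (auto simp: s_def field_simps matvec_def intro!: sum.cong)
    also have "\<dots> = s * s * Q g" by (simp add: Q_def matvec_scale dot_scale_left dot_scale_right)
    finally have le: "\<mu> \<le> s * s * Q g" using min[OF normalize[OF x that]] by (simp add: \<mu>_def)
    have "\<mu> * dot F g g \<le> s * s * Q g * dot F g g"
      by (rule mult_right_mono[OF le dot_self_nonneg])
    also have "\<dots> = (s * s * dot F g g) * Q g" by (simp only: mult_ac)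
    finally show ?thesis using s(1) by simp
  qed
  \<comment> \<open>The residual of the eigenvalue equation at the minimiser; the rest shows that
    its norm \<open>a\<close> is 0.\<close>
  define \<eta> where "\<eta> x = matvec H F \<psi> x + (- \<mu>) * \<psi> x" for x
  have \<psi>S: "dot F \<psi> \<psi> = 1" "\<And>i. i < n \<Longrightarrow> dot F (e i) \<psi> = 0" using \<psi> by (auto simp: S_def)
  have \<eta>o: "dot F (e i) \<eta> = 0" if "i < n" for i
  proof -
    have "dot F (e i) (matvec H F \<psi>) = dot F (matvec H F (e i)) \<psi>" by (rule dot_matvec_symmetric[OF sym])
    also have "\<dots> = dot F (\<lambda>x. l i * e i x) \<psi>" by (rule dot_cong) (use eig that in auto)
    also have "\<dots> = 0" using \<psi>S(2)[OF that] by (simp add: dot_scale_left)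
    finally show ?thesis unfolding \<eta>_def dot_add_scale_right using \<psi>S(2)[OF that] by simp
  qed
  define a where "a = dot F \<eta> \<eta>"
  define b where "b = Q \<eta> - \<mu> * dot F \<eta> \<eta>"
  \<comment> \<open>Second-order expansion of \<open>lower\<close> along \<psi> + t \<eta>: the
    constant terms cancel and the slope is twice the squared norm of the residual.\<close>
  have ineq: "0 \<le> 2 * t * a + t * t * b" for t
  proof -
    have "\<mu> * dot F (\<lambda>x. \<psi> x + t * \<eta> x) (\<lambda>x. \<psi> x + t * \<eta> x) \<le> Q (\<lambda>x. \<psi> x + t * \<eta> x)"
      by (rule lower) (simp add: dot_add_scale_right \<eta>o \<psi>S)
    moreover have "Q (\<lambda>x. \<psi> x + t * \<eta> x) = \<mu> + 2 * t * dot F \<eta> (matvec H F \<psi>) + t * t * Q \<eta>"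
      using dot_matvec_symmetric[where H = H and F = F and f = \<psi> and g = \<eta>, OF sym]
      by (simp add: Q_def \<mu>_def matvec_add_scale dot_add_scale_left dot_add_scale_right
          dot_commute[of F \<psi> \<eta>] dot_commute[of F \<psi> "matvec H F \<eta>"] dot_commute[of F "matvec H F \<psi>"] algebra_simps)
    moreover have "dot F (\<lambda>x. \<psi> x + t * \<eta> x) (\<lambda>x. \<psi> x + t * \<eta> x) = 1 + 2 * t * dot F \<eta> \<psi> + t * t * dot F \<eta> \<eta>"
      using \<psi>S(1) by (simp add: dot_add_scale_left dot_add_scale_right dot_commute[of F \<psi> \<eta>] algebra_simps)
    moreover have "a = dot F \<eta> (matvec H F \<psi>) - \<mu> * dot F \<eta> \<psi>"
    proof -
      have "a = dot F \<eta> (\<lambda>x. matvec H F \<psi> x + (- \<mu>) * \<psi> x)"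
        unfolding a_def by (rule dot_cong) (simp_all add: \<eta>_def)
      then show ?thesis unfolding dot_add_scale_right by simp
    qed
    ultimately have "\<mu> * (1 + 2 * t * dot F \<eta> \<psi> + t * t * dot F \<eta> \<eta>)
        \<le> \<mu> + 2 * t * (a + \<mu> * dot F \<eta> \<psi>) + t * t * Q \<eta>"
      by simp
    then show ?thesis unfolding b_def by (simp add: algebra_simps)
  qed
  have "a = 0"
  proof (rule ccontr)
    assume "a \<noteq> 0"
    then have a: "0 < a" using dot_self_nonneg[of F \<eta>] by (simp add: a_def)
    \<comment> \<open>A negative step so short that \<open>t * b\<close> stays above
      \<open>- a\<close>; the first-order term then dominates and violates
      \<open>ineq\<close>.\<close>
    define t where "t = - a / (\<bar>b\<bar> + 1)"
    have "t < 0" using a by (simp add: t_def divide_neg_pos)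
    have tb: "- a \<le> t * b"
    proof -
      have "- (t * b) \<le> \<bar>t\<bar> * \<bar>b\<bar>" by (metis abs_ge_minus_self abs_mult)
      also have "\<dots> = a * (\<bar>b\<bar> / (\<bar>b\<bar> + 1))" using a by (simp add: t_def abs_mult)
      also have "\<dots> \<le> a * 1" using a by (intro mult_left_mono) (auto simp: field_simps)
      finally show ?thesis by simp
    qed
    have "t * (2 * a + t * b) < 0" using \<open>t < 0\<close> tb a by (intro mult_neg_pos) auto
    then show False using ineq[of t] by (simp add: algebra_simps)
  qed
  then have "\<forall>x\<in>F. \<eta> x = 0" using dot_self_eq_0[OF F] by (simp add: a_def)
  then show ?thesis using \<psi>S by (intro exI[of _ \<psi>] exI[of _ \<mu>]) (auto simp: \<eta>_def)
qed

text \<open>Completeness is stated as a resolution of the identity instead of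
  \<open>n = card F\<close>: this is the form in which expansions and matrix powers use it.\<close>

definition eigenbasis :: "('v \<Rightarrow> 'v \<Rightarrow> real) \<Rightarrow> 'v set \<Rightarrow> nat \<Rightarrow> (nat \<Rightarrow> 'v \<Rightarrow> real) \<Rightarrow> (nat \<Rightarrow> real) \<Rightarrow> bool" where
  "eigenbasis H F n e l \<longleftrightarrow>
     (\<forall>i<n. \<forall>j<n. dot F (e i) (e j) = (if i = j then 1 else 0)) \<and>
     (\<forall>i<n. \<forall>x\<in>F. matvec H F (e i) x = l i * e i x) \<and>
     (\<forall>x\<in>F. \<forall>y\<in>F. (\<Sum>i<n. e i x * e i y) = (if x = y then 1 else 0))"

text \<open>Take an orthonormal family of eigenvectors of maximal length, which is at most
  \<open>card F\<close>. A nonzero vector orthogonal to all of them would yield one more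
  eigenvector, so there is none, and this is completeness.\<close>

lemma eigenbasis_exists:
  fixes H :: "'v \<Rightarrow> 'v \<Rightarrow> real"
  assumes F: "finite F" and sym: "\<And>x y. x \<in> F \<Longrightarrow> y \<in> F \<Longrightarrow> H x y = H y x"
  obtains n e l where "eigenbasis H F n e l"
proof -
  define P where "P n \<longleftrightarrow> (\<exists>e l. (\<forall>i<n. \<forall>j<n. dot F (e i) (e j) = (if i = j then 1 else 0)) \<and>
     (\<forall>i<n. \<forall>x\<in>F. matvec H F (e i) x = l i * e i x))" for n :: nat
  have bound: "n \<le> card F" if "P n" for n
  proof (rule ccontr)
    assume "\<not> n \<le> card F"
    from that obtain e where e: "\<forall>i<n. \<forall>j<n. dot F (e i) (e j) = (if i = j then 1 else 0)"
      unfolding P_def by blast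
    from \<open>\<not> n \<le> card F\<close> have "card F < card {..<n}" by simp
    from underdetermined_system[OF F finite_lessThan this, of "\<lambda>x i. e i x"]
    obtain c where c: "\<exists>j\<in>{..<n}. c j \<noteq> 0" "\<forall>x\<in>F. (\<Sum>i<n. e i x * c i) = 0"
      by blast
    have "c j = 0" if "j < n" for j
    proof -
      have "0 = dot F (e j) (\<lambda>x. \<Sum>i<n. c i * e i x)"
        using c(2) by (simp add: dot_def mult.commute)
      also have "\<dots> = (\<Sum>i<n. c i * (if j = i then 1 else 0))"
        unfolding dot_sum_right using e that by (intro sum.cong) auto
      also have "\<dots> = (\<Sum>i<n. if j = i then c i else 0)" by (intro sum.cong) auto
      also have "\<dots> = c j" using that by simp
      finally show ?thesis by simp
    qed
    then show False using c by auto
  qed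
  have "P 0" by (simp add: P_def)
  have "P (Greatest P)" by (rule GreatestI_nat[where P = P, OF \<open>P 0\<close>]) (use bound in auto)
  moreover have "k \<le> Greatest P" if "P k" for k by (rule Greatest_le_nat[where P = P, OF that]) (use bound in auto)
  ultimately obtain n where n: "P n" and max: "\<And>k. P k \<Longrightarrow> k \<le> n" by blast
  from n obtain e l where e: "\<And>i j. i < n \<Longrightarrow> j < n \<Longrightarrow> dot F (e i) (e j) = (if i = j then 1 else 0)"
    and l: "\<And>i x. i < n \<Longrightarrow> x \<in> F \<Longrightarrow> matvec H F (e i) x = l i * e i x"
    unfolding P_def by blast
  have zero: "\<forall>x\<in>F. \<phi> x = 0" if "\<And>i. i < n \<Longrightarrow> dot F (e i) \<phi> = 0" for \<phi>
  proof (rule ccontr)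
    assume "\<not> (\<forall>x\<in>F. \<phi> x = 0)"
    then obtain x0 where "x0 \<in> F" "\<phi> x0 \<noteq> 0" by auto
    from symmetric_eigenvector_orthogonal[where H = H and F = F and e = e and l = l and n = n, OF F sym l that this]
    obtain \<psi> \<mu> where \<psi>: "dot F \<psi> \<psi> = 1" "\<forall>i<n. dot F (e i) \<psi> = 0" "\<forall>x\<in>F. matvec H F \<psi> x = \<mu> * \<psi> x"
      by blast
    have \<psi>': "\<forall>i<n. dot F \<psi> (e i) = 0" using \<psi>(2) by (metis dot_commute)
    have "P (Suc n)" unfolding P_def
      using e l \<psi> \<psi>'
      by (intro exI[of _ "\<lambda>i. if i < n then e i else \<psi>"] exI[of _ "\<lambda>i. if i < n then l i else \<mu>"])
        (auto simp: less_Suc_eq)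
    then show False using max by fastforce
  qed
  have "(\<Sum>i<n. e i x * e i y) = (if x = y then 1 else 0)" if "x \<in> F" "y \<in> F" for x y
  proof -
    \<comment> \<open>The point mass at \<open>y\<close> minus its projection onto the family; its
      vanishing is the resolution of the identity.\<close>
    define \<phi> where "\<phi> z = (if z = y then 1 else 0) + (-1) * (\<Sum>i<n. e i y * e i z)" for z
    have "dot F (e j) \<phi> = 0" if "j < n" for j
    proof -
      have "dot F (e j) (\<lambda>z. if z = y then 1 else 0) = (\<Sum>x\<in>F. if x = y then e j x else 0)"
        unfolding dot_def by (intro sum.cong) auto
      also have "\<dots> = e j y" using F \<open>y \<in> F\<close> by simp
      finally have 1: "dot F (e j) (\<lambda>z. if z = y then 1 else 0) = e j y" .
      have "dot F (e j) (\<lambda>z. \<Sum>i<n. e i y * e i z) = (\<Sum>i<n. if j = i then e i y else 0)"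
        unfolding dot_sum_right using e that by (intro sum.cong) auto
      also have "\<dots> = e j y" using that by simp
      finally show ?thesis unfolding \<phi>_def dot_add_scale_right 1 by simp
    qed
    from zero[OF this] have "\<phi> x = 0" using that by auto
    then show ?thesis by (simp add: \<phi>_def mult.commute split: if_splits)
  qed
  then have "eigenbasis H F n e l" unfolding eigenbasis_def using e l by auto
  then show ?thesis by (rule that)
qed

lemma eigenbasis_expand:
  assumes "eigenbasis H F n e l" "finite F" "x \<in> F"
  shows "f x = (\<Sum>i<n. dot F (e i) f * e i x)"
proof -
  have "(\<Sum>i<n. dot F (e i) f * e i x) = (\<Sum>y\<in>F. f y * (\<Sum>i<n. e i y * e i x))"
    unfolding dot_def sum_distrib_right sum_distrib_left
    by (subst sum.swap) (simp add: algebra_simps)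
  also have "\<dots> = (\<Sum>y\<in>F. if y = x then f y else 0)"
    using assms by (intro sum.cong) (auto simp: eigenbasis_def)
  finally show ?thesis using assms by simp
qed

lemma eigenbasis_energy:
  assumes "eigenbasis H F n e l" "i < n"
  shows "dot F (e i) (matvec H F (e i)) = l i"
proof -
  have "dot F (e i) (matvec H F (e i)) = dot F (e i) (\<lambda>x. l i * e i x)"
    by (rule dot_cong) (use assms in \<open>auto simp: eigenbasis_def\<close>)
  then show ?thesis using assms by (simp add: dot_scale_right eigenbasis_def)
qed

lemma energy_of_combination:
  assumes "eigenbasis H F n e l" "finite F" "J \<subseteq> {..<n}"
    and f: "\<And>x. x \<in> F \<Longrightarrow> f x = (\<Sum>j\<in>J. c j * e j x)"
  shows "dot F f f = (\<Sum>j\<in>J. (c j)\<^sup>2)" "dot F f (matvec H F f) = (\<Sum>j\<in>J. l j * (c j)\<^sup>2)"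
proof -
  have J: "finite J" using assms(3) finite_subset by blast
  have e: "dot F (e i) (\<lambda>x. \<Sum>j\<in>J. d j * e j x) = d i" if "i \<in> J" for i d
  proof -
    have "dot F (e i) (\<lambda>x. \<Sum>j\<in>J. d j * e j x) = (\<Sum>j\<in>J. if i = j then d j else 0)"
      unfolding dot_sum_right using assms that by (intro sum.cong) (auto simp: eigenbasis_def subset_eq)
    then show ?thesis using J that by simp
  qed
  have main: "dot F f (\<lambda>x. \<Sum>j\<in>J. d j * e j x) = (\<Sum>j\<in>J. c j * d j)" for d
  proof -
    have "dot F f (\<lambda>x. \<Sum>j\<in>J. d j * e j x) = dot F (\<lambda>x. \<Sum>j\<in>J. d j * e j x) (\<lambda>x. \<Sum>j\<in>J. c j * e j x)"
      by (subst dot_commute, rule dot_cong) (use f in auto)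
    also have "\<dots> = (\<Sum>j\<in>J. c j * d j)"
      unfolding dot_sum_right by (intro sum.cong refl) (simp add: e dot_commute)
    finally show ?thesis .
  qed
  have "dot F f f = dot F f (\<lambda>x. \<Sum>j\<in>J. c j * e j x)" by (rule dot_cong) (use f in auto)
  then show "dot F f f = (\<Sum>j\<in>J. (c j)\<^sup>2)" by (simp add: main power2_eq_square)
  have "dot F f (matvec H F f) = dot F f (\<lambda>x. \<Sum>j\<in>J. (l j * c j) * e j x)"
  proof (rule dot_cong)
    fix x assume x: "x \<in> F"
    have "matvec H F f x = (\<Sum>y\<in>F. H x y * (\<Sum>j\<in>J. c j * e j y))"
      unfolding matvec_def by (intro sum.cong) (use f in auto)
    also have "\<dots> = (\<Sum>j\<in>J. c j * matvec H F (e j) x)"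
      unfolding matvec_def sum_distrib_left by (subst sum.swap) (simp add: algebra_simps)
    also have "\<dots> = (\<Sum>j\<in>J. (l j * c j) * e j x)"
      using assms x by (intro sum.cong) (auto simp: eigenbasis_def subset_eq)
    finally show "matvec H F f x = \<dots>" .
  qed simp
  then show "dot F f (matvec H F f) = (\<Sum>j\<in>J. l j * (c j)\<^sup>2)"
    unfolding main by (simp add: power2_eq_square algebra_simps)
qed

text \<open>Courant-Fischer by dimension count: if \<open>B\<close> had more eigenvalues up to
  \<open>E\<close>, some nonzero combination of its low eigenvectors would be orthogonal to all low
  eigenvectors of \<open>A\<close>. Its \<open>B\<close>-energy is at most \<open>E\<close> times
  its squared norm, but its \<open>A\<close>-energy is strictly larger.\<close>

lemma eigenvalue_count_antimono:
  assumes F: "finite F" and A: "eigenbasis A F n e l" and B: "eigenbasis B F k g r"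
    and le: "\<And>f. dot F f (matvec A F f) \<le> dot F f (matvec B F f)"
  shows "card {j. j < k \<and> r j \<le> E} \<le> card {i. i < n \<and> l i \<le> E}"
proof (rule ccontr)
  define I where "I = {i. i < n \<and> l i \<le> E}"
  define J where "J = {j. j < k \<and> r j \<le> E}"
  assume "\<not> ?thesis"
  then have "card I < card J" by (simp add: I_def J_def)
  moreover have IJ: "finite I" "finite J" "I \<subseteq> {..<n}" "J \<subseteq> {..<k}" by (auto simp: I_def J_def)
  ultimately obtain c where c: "\<exists>j\<in>J. c j \<noteq> 0" "\<forall>i\<in>I. (\<Sum>j\<in>J. dot F (e i) (g j) * c j) = 0"
    using underdetermined_system[of I J "\<lambda>i j. dot F (e i) (g j)"] by blast
  define f where "f x = (\<Sum>j\<in>J. c j * g j x)" for x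
  note fB = energy_of_combination[OF B F IJ(4), of f c, OF f_def]
  have fpos: "0 < dot F f f"
  proof -
    obtain j where "j \<in> J" "c j \<noteq> 0" using c by auto
    then have "0 < (\<Sum>j\<in>J. (c j)\<^sup>2)" using IJ(2) by (intro sum_pos2[of _ j]) auto
    then show ?thesis by (simp add: fB)
  qed
  have up: "dot F f (matvec B F f) \<le> E * dot F f f"
    unfolding fB sum_distrib_left by (intro sum_mono mult_right_mono) (auto simp: J_def)
  define d where "d i = dot F (e i) f" for i
  have d0: "d i = 0" if "i \<in> I" for i
    using c(2) that unfolding d_def f_def dot_sum_right by (simp add: mult.commute)
  \<comment> \<open>By orthogonality \<open>f\<close> expands only in eigenvectors of
    \<open>A\<close> with eigenvalue above \<open>E\<close>.\<close>
  define K where "K = {..<n} - I"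
  have K: "K \<subseteq> {..<n}" "finite K" by (auto simp: K_def)
  have fe: "f x = (\<Sum>i\<in>K. d i * e i x)" if "x \<in> F" for x
  proof -
    have "f x = (\<Sum>i<n. d i * e i x)" using eigenbasis_expand[OF A F that, of f] by (simp add: d_def)
    also have "\<dots> = (\<Sum>i\<in>K. d i * e i x)"
      by (rule sum.mono_neutral_right) (use d0 in \<open>auto simp: K_def\<close>)
    finally show ?thesis .
  qed
  have fA: "dot F f f = (\<Sum>j\<in>K. (d j)\<^sup>2)" "dot F f (matvec A F f) = (\<Sum>j\<in>K. l j * (d j)\<^sup>2)"
    using energy_of_combination[OF A F K(1) fe] by auto
  obtain i where i: "i \<in> K" "d i \<noteq> 0"
  proof -
    have "\<exists>i\<in>K. d i \<noteq> 0"
    proof (rule ccontr)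
      assume "\<not> ?thesis"
      then have "dot F f f = 0" unfolding fA(1) by (intro sum.neutral) auto
      then show False using fpos by simp
    qed
    then show ?thesis using that by auto
  qed
  have "E * dot F f f < dot F f (matvec A F f)"
    unfolding fA sum_distrib_left
  proof (rule sum_strict_mono_ex1[OF K(2)])
    show "\<forall>x\<in>K. E * (d x)\<^sup>2 \<le> l x * (d x)\<^sup>2" by (auto simp: K_def I_def intro!: mult_right_mono)
    show "\<exists>a\<in>K. E * (d a)\<^sup>2 < l a * (d a)\<^sup>2"
      using i by (intro bexI[of _ i]) (auto simp: K_def I_def)
  qed
  then show False using le[of f] up by linarith
qed

section \<open>Measures determined by their moments\<close>

definition supported_measure :: "real \<Rightarrow> real measure \<Rightarrow> bool" where
  "supported_measure C \<mu> \<longleftrightarrow> sets \<mu> = sets borel \<and> finite_measure \<mu> \<and> emeasure \<mu> (UNIV - {-C..C}) = 0"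

lemma supported_measure_AE:
  assumes "supported_measure C \<mu>"
  shows "AE t in \<mu>. t \<in> {-C..C}"
proof (rule AE_I)
  have "space \<mu> = UNIV" using sets_eq_imp_space_eq[of \<mu> borel] assms by (simp add: supported_measure_def)
  then show "{t \<in> space \<mu>. t \<notin> {-C..C}} \<subseteq> UNIV - {-C..C}" by auto
qed (use assms in \<open>auto simp: supported_measure_def\<close>)

lemma supported_measure_mono:
  assumes "supported_measure C \<mu>" "C \<le> D"
  shows "supported_measure D \<mu>"
proof -
  have "emeasure \<mu> (UNIV - {-D..D}) \<le> emeasure \<mu> (UNIV - {-C..C})"
    using assms by (intro emeasure_mono) (auto simp: supported_measure_def)
  then show ?thesis using assms by (auto simp: supported_measure_def)
qed

lemma supported_measure_integrable:
  fixes f :: "real \<Rightarrow> real"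
  assumes "supported_measure C \<mu>" "f \<in> borel_measurable borel" "\<And>t. t \<in> {-C..C} \<Longrightarrow> \<bar>f t\<bar> \<le> B"
  shows "integrable \<mu> f"
proof -
  interpret finite_measure \<mu> using assms(1) by (simp add: supported_measure_def)
  have m: "f \<in> borel_measurable \<mu>"
    using assms(1,2) by (simp add: supported_measure_def cong: measurable_cong_sets)
  show ?thesis
  proof (rule integrable_const_bound[OF _ m, of B])
    show "AE t in \<mu>. norm (f t) \<le> B"
      using supported_measure_AE[OF assms(1)] by (rule eventually_mono) (simp add: assms(3))
  qed
qed

lemma supported_measure_integrable_power:
  assumes "supported_measure C \<mu>"
  shows "integrable \<mu> (\<lambda>t. t ^ n)"
proof (rule supported_measure_integrable[OF assms])
  show "\<bar>t ^ n\<bar> \<le> C ^ n" if "t \<in> {-C..C}" for t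
    unfolding power_abs using that by (intro power_mono) auto
qed simp

text \<open>The coefficients are chosen before the measure. Hence the same limit of moment
  combinations works for all measures on [-C, C] at once; this gives uniqueness and, later,
  measurability of the distribution function in the configuration.\<close>

lemma cdf_from_moments:
  "\<exists>(a :: nat \<Rightarrow> nat \<Rightarrow> real) (d :: nat \<Rightarrow> nat). \<forall>\<mu>. supported_measure C \<mu> \<longrightarrow>
      (\<lambda>j. \<Sum>i\<le>d j. a j i * (\<integral>t. t ^ i \<partial>\<mu>)) \<longlonglongrightarrow> measure \<mu> {..E}"
proof -
  \<comment> \<open>A continuous ramp equal to 1 up to \<open>E\<close> and 0 from
    \<open>E + 1 / Suc j\<close> on. Placed to the right of \<open>E\<close>, it converges to the
    indicator of the closed half-line.\<close>
  define f where "f j t = max 0 (min 1 (1 - real (Suc j) * (t - E)))" for j t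
  have "\<exists>a d. \<forall>t\<in>{-C..C}. \<bar>f j t - (\<Sum>i\<le>d. a i * t ^ i)\<bar> < 1 / Suc j" for j
  proof -
    obtain g where g: "real_polynomial_function g" "\<And>t. t \<in> {-C..C} \<Longrightarrow> \<bar>f j t - g t\<bar> < 1 / Suc j"
      by (rule Stone_Weierstrass_real_polynomial_function[of "{-C..C}" "f j" "1 / Suc j"])
        (auto simp: f_def intro!: continuous_intros)
    from g(1) obtain b n where "g = (\<lambda>x. \<Sum>i\<le>n. b i * x ^ i)"
      unfolding real_polynomial_function_iff_sum by blast
    with g(2) show ?thesis by blast
  qed
  then obtain a d where ad: "\<And>j t. t \<in> {-C..C} \<Longrightarrow> \<bar>f j t - (\<Sum>i\<le>d j. a j i * t ^ i)\<bar> < 1 / Suc j"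
    by metis
  have "(\<lambda>j. \<Sum>i\<le>d j. a j i * (\<integral>t. t ^ i \<partial>\<mu>)) \<longlonglongrightarrow> measure \<mu> {..E}" if \<mu>: "supported_measure C \<mu>" for \<mu>
  proof -
    interpret finite_measure \<mu> using \<mu> by (simp add: supported_measure_def)
    have s: "sets \<mu> = sets borel" "space \<mu> = UNIV"
      using \<mu> sets_eq_imp_space_eq[of \<mu> borel] by (simp_all add: supported_measure_def)
    have [measurable_cong]: "sets \<mu> = sets borel" by (rule s)
    have f_lim: "(\<lambda>j. f j t) \<longlonglongrightarrow> indicator {..E} t" for t
    proof (cases "t \<le> E")
      case True
      then have "f j t = 1" for j
        using mult_nonneg_nonpos[of "real (Suc j)" "t - E"] by (auto simp: f_def min_def max_def)
      then show ?thesis using True by simp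
    next
      case False
      obtain N where N: "1 / (t - E) < real N" using reals_Archimedean2 by blast
      have "f j t = 0" if "j \<ge> N" for j
      proof -
        have "1 < real N * (t - E)" using N False by (simp add: field_simps)
        also have "\<dots> \<le> real (Suc j) * (t - E)" using False that by (intro mult_right_mono) auto
        finally show ?thesis by (auto simp: f_def)
      qed
      then have "\<forall>\<^sub>F j in sequentially. f j t = 0" by (auto simp: eventually_sequentially)
      then show ?thesis using False by (simp add: tendsto_eventually)
    qed
    have "(\<lambda>j. \<integral>t. (\<Sum>i\<le>d j. a j i * t ^ i) \<partial>\<mu>) \<longlonglongrightarrow> (\<integral>t. indicator {..E} t \<partial>\<mu>)"
    proof (rule integral_dominated_convergence[where w = "\<lambda>_. 2"])
      show "AE t in \<mu>. (\<lambda>j. \<Sum>i\<le>d j. a j i * t ^ i) \<longlonglongrightarrow> indicator {..E} t"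
        using supported_measure_AE[OF \<mu>]
      proof eventually_elim
        fix t assume t: "t \<in> {-C..C}"
        have "(\<lambda>j. f j t - (\<Sum>i\<le>d j. a j i * t ^ i)) \<longlonglongrightarrow> 0"
          by (rule tendsto_rabs_zero_cancel, rule tendsto_sandwich[OF _ _ tendsto_const LIMSEQ_Suc[OF lim_1_over_n]])
            (use ad[OF t] in \<open>auto intro!: always_eventually less_imp_le\<close>)
        from tendsto_diff[OF f_lim[of t] this]
        show "(\<lambda>j. \<Sum>i\<le>d j. a j i * t ^ i) \<longlonglongrightarrow> indicator {..E} t" by simp
      qed
      show "AE t in \<mu>. norm (\<Sum>i\<le>d j. a j i * t ^ i) \<le> 2" for j
        using supported_measure_AE[OF \<mu>]
      proof eventually_elim
        fix t assume t: "t \<in> {-C..C}"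
        have "\<bar>f j t - (\<Sum>i\<le>d j. a j i * t ^ i)\<bar> < 1"
          using ad[OF t, of j] by (rule less_le_trans) simp
        moreover have "\<bar>f j t\<bar> \<le> 1" by (simp add: f_def)
        ultimately show "norm (\<Sum>i\<le>d j. a j i * t ^ i) \<le> 2" by simp
      qed
    qed auto
    moreover have "(\<integral>t. (\<Sum>i\<le>d j. a j i * t ^ i) \<partial>\<mu>) = (\<Sum>i\<le>d j. a j i * (\<integral>t. t ^ i \<partial>\<mu>))" for j
      using supported_measure_integrable_power[OF \<mu>] by (simp add: Bochner_Integration.integral_sum)
    ultimately show ?thesis using s by simp
  qed
  then show ?thesis by blast
qed

text \<open>On a common bounded interval the moments determine the distribution function, so the
  moment problem is determinate. The radii may differ because the definition of
  \<open>spec_cdf\<close> leaves the radius unspecified.\<close>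

lemma supported_measure_unique:
  assumes "supported_measure C \<mu>" "supported_measure D \<nu>"
    and moments: "\<And>n. (\<integral>t. t ^ n \<partial>\<mu>) = (\<integral>t. t ^ n \<partial>\<nu>)"
  shows "\<mu> = \<nu>"
proof (rule cdf_unique')
  define B where "B = max C D"
  have B: "supported_measure B \<mu>" "supported_measure B \<nu>"
    using assms by (auto simp: B_def intro: supported_measure_mono)
  show "cdf \<mu> = cdf \<nu>"
  proof
    fix E
    obtain a d where ad: "\<And>\<mu>. supported_measure B \<mu> \<Longrightarrow>
        (\<lambda>j. \<Sum>i\<le>(d j::nat). a j i * (\<integral>t. t ^ i \<partial>\<mu>)) \<longlonglongrightarrow> measure \<mu> {..E}"
      using cdf_from_moments[of B E] by blast
    from LIMSEQ_unique[OF ad[OF B(1)] ad[OF B(2), folded moments]] show "cdf \<mu> E = cdf \<nu> E"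
      by (simp add: cdf_def)
  qed
  show "finite_borel_measure \<mu>" "finite_borel_measure \<nu>"
    using assms(1,2)
    by (auto simp: supported_measure_def finite_borel_measure_def finite_borel_measure_axioms_def)
qed

text \<open>The common support makes the sequence tight, and a weak limit along a subsequence has
  the limiting moments.\<close>

lemma moment_measure_limit:
  fixes \<mu> :: "nat \<Rightarrow> real measure"
  assumes C: "0 \<le> C" and \<mu>: "\<And>j. supported_measure C (\<mu> j)" "\<And>j. prob_space (\<mu> j)"
    and m: "\<And>n. (\<lambda>j. \<integral>t. t ^ n \<partial>\<mu> j) \<longlonglongrightarrow> m n"
  shows "\<exists>\<nu>. supported_measure C \<nu> \<and> (\<forall>n. (\<integral>t. t ^ n \<partial>\<nu>) = m n)"
proof -
  have s: "sets (\<mu> j) = sets borel" for j using \<mu>(1) by (simp add: supported_measure_def)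
  have rd: "real_distribution (\<mu> j)" for j
    using \<mu>(2) s by (simp add: real_distribution_def real_distribution_axioms_def)
  have "tight \<mu>"
    unfolding tight_def
  proof (intro conjI allI impI rd)
    fix e :: real assume "0 < e"
    \<comment> \<open>Tightness asks for half-open intervals; lowering the left end by 1 keeps the
      possible atom at \<open>-C\<close> and makes the interval nonempty.\<close>
    have "measure (\<mu> j) {-C-1<..C} = 1" for j
    proof -
      interpret prob_space "\<mu> j" by (rule \<mu>)
      have "AE t in \<mu> j. t \<in> {-C-1<..C}"
        using supported_measure_AE[OF \<mu>(1)] by eventually_elim auto
      then show ?thesis by (intro prob_eq_1[THEN iffD2]) (auto simp: s)
    qed
    then show "\<exists>a b. a < b \<and> (\<forall>j. 1 - e < measure (\<mu> j) {a<..b})"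
      using C \<open>0 < e\<close> by (intro exI[of _ "-C-1"] exI[of _ C]) auto
  qed
  from tight_imp_convergent_subsubsequence[OF this strict_mono_id]
  obtain r \<nu> where r: "strict_mono r" and \<nu>: "real_distribution \<nu>" "weak_conv_m (\<mu> \<circ> r) \<nu>" by auto
  interpret \<nu>: real_distribution \<nu> by (rule \<nu>)
  have lim: "(\<lambda>j. \<integral>t. f t \<partial>\<mu> (r j)) \<longlonglongrightarrow> (\<integral>t. f t \<partial>\<nu>)"
    if "\<And>t. isCont f t" "\<And>t. \<bar>f t\<bar> \<le> B" for f :: "real \<Rightarrow> real" and B
    using weak_conv_imp_integral_bdd_continuous_conv[of "\<mu> \<circ> r" \<nu> f B] rd \<nu> that by simp
  \<comment> \<open>Weak convergence tests bounded continuous functions only. Clamping to [-C, C]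
    makes the powers bounded without changing them on the support.\<close>
  define c where "c t = max (-C) (min C t)" for t
  have c: "\<bar>c t\<bar> \<le> C" "t \<in> {-C..C} \<Longrightarrow> c t = t" for t using C by (auto simp: c_def)
  have cc: "isCont c t" for t unfolding c_def by (intro continuous_intros)
  have cm: "c \<in> borel_measurable borel"
    using cc by (intro borel_measurable_continuous_onI) (simp add: continuous_at_imp_continuous_on)
  \<comment> \<open>A bounded continuous function that vanishes exactly on [-C, C]; testing with it
    confines the limit to that interval.\<close>
  define h where "h t = min 1 \<bar>t - c t\<bar>" for t
  have hc: "isCont h t" for t unfolding h_def by (intro continuous_intros cc)
  have hm: "h \<in> borel_measurable borel"
    using hc by (intro borel_measurable_continuous_onI) (simp add: continuous_at_imp_continuous_on)
  have "(\<integral>t. h t \<partial>\<mu> j) = 0" for j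
  proof -
    have "(\<integral>t. h t \<partial>\<mu> j) = (\<integral>t. 0 \<partial>\<mu> j)"
    proof (rule integral_cong_AE)
      show "AE t in \<mu> j. h t = 0"
        using supported_measure_AE[OF \<mu>(1)] by (rule eventually_mono) (simp add: h_def c)
    qed (use hm s in \<open>simp_all cong: measurable_cong_sets\<close>)
    then show ?thesis by simp
  qed
  then have h0: "(\<integral>t. h t \<partial>\<nu>) = 0"
    using lim[of h 1, OF hc] by (simp add: h_def LIMSEQ_const_iff)
  have "AE t in \<nu>. h t = 0"
  proof (rule integral_nonneg_eq_0_iff_AE[THEN iffD1, OF _ _ h0])
    have "0 \<le> h t" "\<bar>h t\<bar> \<le> 1" for t by (simp_all add: h_def)
    then show "integrable \<nu> h" "AE t in \<nu>. 0 \<le> h t"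
      using hm by (auto intro!: \<nu>.integrable_const_bound[of _ 1])
  qed
  then have AE\<nu>: "AE t in \<nu>. t \<in> {-C..C}"
  proof eventually_elim
    fix t assume "h t = 0"
    then have "t = c t" by (simp add: h_def min_def split: if_splits)
    then show "t \<in> {-C..C}" using c(1)[of t] by (auto simp: abs_le_iff)
  qed
  have sup: "supported_measure C \<nu>"
    unfolding supported_measure_def
  proof (intro conjI)
    show "emeasure \<nu> (UNIV - {-C..C}) = 0"
      using AE\<nu> by (subst (asm) AE_iff_measurable[of "UNIV - {-C..C}"]) auto
  qed (auto simp: \<nu>.finite_measure_axioms)
  moreover have "(\<integral>t. t ^ n \<partial>\<nu>) = m n" for n
  proof -
    have eq: "(\<integral>t. c t ^ n \<partial>M) = (\<integral>t. t ^ n \<partial>M)" if "supported_measure C M" for M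
    proof (rule integral_cong_AE)
      show "AE t in M. c t ^ n = t ^ n"
        using supported_measure_AE[OF that] by (rule eventually_mono) (simp add: c)
      have "sets M = sets borel" using that by (simp add: supported_measure_def)
      then show "(\<lambda>t. c t ^ n) \<in> borel_measurable M" "(\<lambda>t. t ^ n) \<in> borel_measurable M"
        using cm by (simp_all cong: measurable_cong_sets)
    qed
    have "(\<lambda>j. \<integral>t. c t ^ n \<partial>\<mu> (r j)) \<longlonglongrightarrow> (\<integral>t. c t ^ n \<partial>\<nu>)"
    proof (rule lim[of "\<lambda>t. c t ^ n" "C ^ n"])
      show "isCont (\<lambda>t. c t ^ n) t" for t by (intro continuous_intros cc)
      show "\<bar>c t ^ n\<bar> \<le> C ^ n" for t unfolding power_abs by (intro power_mono c) auto
    qed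
    then have "(\<lambda>j. \<integral>t. t ^ n \<partial>\<mu> (r j)) \<longlonglongrightarrow> (\<integral>t. t ^ n \<partial>\<nu>)" by (simp add: eq \<mu> sup)
    moreover have "(\<lambda>j. \<integral>t. t ^ n \<partial>\<mu> (r j)) \<longlonglongrightarrow> m n"
      using LIMSEQ_subseq_LIMSEQ[OF m r] by (simp add: o_def)
    ultimately show ?thesis by (rule LIMSEQ_unique)
  qed
  ultimately show ?thesis by blast
qed

section \<open>Exponential decay in finite volume\<close>

text \<open>The expectation of \<open>f\<close> at the random subset of \<open>U\<close> that
  contains each element independently with probability \<open>p\<close>. With this finite sum,
  conditioning on one element becomes the algebraic recursion
  \<open>bern_sum_insert\<close>.\<close>

definition bern_sum :: "real \<Rightarrow> 'a set \<Rightarrow> ('a set \<Rightarrow> real) \<Rightarrow> real" where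
  "bern_sum p U f = (\<Sum>X\<in>Pow U. p ^ card X * (1 - p) ^ card (U - X) * f X)"

lemma bern_sum_empty [simp]: "bern_sum p {} f = f {}"
  by (simp add: bern_sum_def)

lemma bern_sum_insert:
  assumes "finite U" "y \<notin> U"
  shows "bern_sum p (insert y U) f = p * bern_sum p U (\<lambda>X. f (insert y X)) + (1 - p) * bern_sum p U f"
proof -
  have *: "finite X" "y \<notin> X" if "X \<in> Pow U" for X
    using that assms finite_subset by auto
  have "Pow U \<inter> insert y ` Pow U = {}" using assms by auto
  then have "bern_sum p (insert y U) f = bern_sum p U (\<lambda>X. (1 - p) * f X)
      + (\<Sum>X\<in>insert y ` Pow U. p ^ card X * (1 - p) ^ card (insert y U - X) * f X)"
    unfolding bern_sum_def Pow_insert using assms *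
    by (subst sum.union_disjoint) (auto intro!: sum.cong simp: insert_Diff_if finite_subset)
  also have "(\<Sum>X\<in>insert y ` Pow U. p ^ card X * (1 - p) ^ card (insert y U - X) * f X)
      = bern_sum p U (\<lambda>X. p * f (insert y X))"
  proof (subst sum.reindex)
    show "inj_on (insert y) (Pow U)" using assms(2) by (auto simp: inj_on_def)
    show "sum ((\<lambda>X. p ^ card X * (1 - p) ^ card (insert y U - X) * f X) \<circ> insert y) (Pow U)
      = bern_sum p U (\<lambda>X. p * f (insert y X))"
      unfolding bern_sum_def using * assms(2)
      by (intro sum.cong) (auto simp: card_insert_disjoint insert_Diff_if)
  qed
  finally show ?thesis
    by (simp add: bern_sum_def sum_distrib_left algebra_simps)
qed

lemma bern_sum_mono:
  assumes "0 \<le> p" "p \<le> 1" "\<And>X. X \<subseteq> U \<Longrightarrow> f X \<le> g X"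
  shows "bern_sum p U f \<le> bern_sum p U g"
  unfolding bern_sum_def using assms by (intro sum_mono mult_left_mono) auto

lemma bern_sum_cong: "(\<And>X. X \<subseteq> U \<Longrightarrow> f X = g X) \<Longrightarrow> bern_sum p U f = bern_sum p U g"
  unfolding bern_sum_def by (intro sum.cong) auto

lemma bern_sum_const:
  assumes "finite U" shows "bern_sum p U (\<lambda>_. c) = c"
  using assms by (induction U) (simp_all add: bern_sum_insert algebra_simps)

lemma bern_sum_add: "bern_sum p U (\<lambda>X. f X + g X) = bern_sum p U f + bern_sum p U g"
  by (simp add: bern_sum_def algebra_simps sum.distrib)

lemma bern_sum_scale: "bern_sum p U (\<lambda>X. c * f X) = c * bern_sum p U f"
  by (simp add: bern_sum_def algebra_simps sum_distrib_left)

lemma bern_sum_image: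
  assumes "inj_on g U"
  shows "bern_sum p (g ` U) f = bern_sum p U (\<lambda>X. f (g ` X))"
proof -
  have "inj_on (image g) (Pow U)" using assms by (rule inj_on_image_Pow)
  moreover have "Pow (g ` U) = image g ` Pow U" by (rule image_Pow_surj[symmetric]) simp
  moreover have "card (g ` U - g ` X) = card (U - X)" "card (g ` X) = card X" if "X \<subseteq> U" for X
  proof -
    have "g ` U - g ` X = g ` (U - X)" using inj_on_image_set_diff[OF assms, of U X] that by auto
    then show "card (g ` U - g ` X) = card (U - X)"
      by (simp add: card_image inj_on_subset[OF assms])
    show "card (g ` X) = card X" by (rule card_image[OF inj_on_subset[OF assms that]])
  qed
  ultimately show ?thesis
    unfolding bern_sum_def by (auto simp: sum.reindex intro!: sum.cong)
qed

text \<open>Induction on the window by conditioning on one element: the covariance is the mean of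
  the two conditional covariances plus the covariance of the conditional means.\<close>

lemma harris_inequality:
  assumes "finite U" "0 \<le> p" "p \<le> 1"
    and "\<And>X Y. X \<subseteq> Y \<Longrightarrow> Y \<subseteq> U \<Longrightarrow> f Y \<le> f X" "\<And>X Y. X \<subseteq> Y \<Longrightarrow> Y \<subseteq> U \<Longrightarrow> g Y \<le> g X"
  shows "bern_sum p U f * bern_sum p U g \<le> bern_sum p U (\<lambda>X. f X * g X)"
  using assms(1,4,5)
proof (induction U arbitrary: f g rule: finite_induct)
  case empty
  then show ?case by simp
next
  case (insert y U)
  let ?E = "bern_sum p U"
  let ?f = "\<lambda>X. f (insert y X)" and ?g = "\<lambda>X. g (insert y X)"
  have 1: "?E ?f * ?E ?g \<le> ?E (\<lambda>X. ?f X * ?g X)"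
    by (rule insert.IH) (auto intro!: insert.prems)
  have 0: "?E f * ?E g \<le> ?E (\<lambda>X. f X * g X)"
    by (rule insert.IH) (auto intro!: insert.prems)
  have "?E ?f \<le> ?E f" "?E ?g \<le> ?E g"
    by (auto intro!: bern_sum_mono assms(2,3) insert.prems)
  \<comment> \<open>Opening \<open>y\<close> lowers both conditional means, so these vary in the
    same direction.\<close>
  then have "0 \<le> p * (1 - p) * ((?E f - ?E ?f) * (?E g - ?E ?g))"
    using assms(2,3) by (intro mult_nonneg_nonneg) auto
  moreover have "p * (?E ?f * ?E ?g) \<le> p * ?E (\<lambda>X. ?f X * ?g X)"
    "(1 - p) * (?E f * ?E g) \<le> (1 - p) * ?E (\<lambda>X. f X * g X)"
    using 0 1 assms(2,3) by (auto intro!: mult_left_mono)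
  ultimately show ?case
    using insert.hyps by (simp add: bern_sum_insert algebra_simps)
qed

text \<open>Only the vertices stepped onto must lie in \<open>X\<close>. The elements of
  \<open>A\<close> count whether open or not, so \<open>A\<close> can serve as the already explored
  part of a cluster.\<close>

definition reach :: "('a \<Rightarrow> 'a \<Rightarrow> bool) \<Rightarrow> 'a set \<Rightarrow> 'a set \<Rightarrow> 'a set" where
  "reach R X A = {y. \<exists>a\<in>A. (\<lambda>u v. v \<in> X \<and> R u v)\<^sup>*\<^sup>* a y}"

lemma reach_self: "A \<subseteq> reach R X A"
  by (auto simp: reach_def)

lemma reach_step: "u \<in> reach R X A \<Longrightarrow> v \<in> X \<Longrightarrow> R u v \<Longrightarrow> v \<in> reach R X A"
  unfolding reach_def by (auto intro: rtranclp.rtrancl_into_rtrancl)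

lemma reach_least:
  assumes "A \<subseteq> B" "\<And>u v. u \<in> B \<Longrightarrow> v \<in> X \<Longrightarrow> R u v \<Longrightarrow> v \<in> B"
  shows "reach R X A \<subseteq> B"
proof
  fix y assume "y \<in> reach R X A"
  then obtain a where "a \<in> A" and "(\<lambda>u v. v \<in> X \<and> R u v)\<^sup>*\<^sup>* a y" by (auto simp: reach_def)
  from this(2) show "y \<in> B"
    by (induction rule: rtranclp_induct) (use \<open>a \<in> A\<close> assms in auto)
qed

lemma reach_mono: "X \<subseteq> Y \<Longrightarrow> A \<subseteq> B \<Longrightarrow> reach R X A \<subseteq> reach R Y B"
  by (rule reach_least) (use reach_self[of B R Y] in \<open>auto intro: reach_step\<close>)

lemma reach_subset: "reach R X A \<subseteq> A \<union> X"
  by (rule reach_least) auto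

lemma finite_reach: "finite A \<Longrightarrow> finite X \<Longrightarrow> finite (reach R X A)"
  by (meson finite_UnI finite_subset reach_subset)

lemma reach_Un: "reach R X (A \<union> B) = reach R X A \<union> reach R X B"
  by (auto simp: reach_def)

text \<open>The exploration step: a neighbour of the explored set that is revealed to be open joins
  the explored set and leaves the randomness.\<close>

lemma reach_insert_open:
  assumes "a \<in> A" "R a y"
  shows "reach R (insert y X) A = reach R X (insert y A)"
proof
  show "reach R (insert y X) A \<subseteq> reach R X (insert y A)"
    by (rule reach_least) (use reach_self[of "insert y A" R X] in \<open>auto intro: reach_step\<close>)
  have "y \<in> reach R (insert y X) A"
    using assms reach_self[of A R "insert y X"] by (auto intro: reach_step)
  then show "reach R X (insert y A) \<subseteq> reach R (insert y X) A"
    using reach_self[of A R "insert y X"] by (intro reach_least) (auto intro: reach_step)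
qed

lemma reach_isolated:
  assumes "\<And>a y. a \<in> A \<Longrightarrow> y \<in> X \<Longrightarrow> R a y \<Longrightarrow> y \<in> A"
  shows "reach R X A = A"
  using assms by (intro equalityI reach_self reach_least) auto

lemma reach_image:
  assumes "inj_on g D" "X \<subseteq> D" "A \<subseteq> D" "\<And>u v. u \<in> D \<Longrightarrow> v \<in> D \<Longrightarrow> R (g u) (g v) \<longleftrightarrow> R u v"
  shows "reach R (g ` X) (g ` A) = g ` reach R X A"
proof
  have sub: "reach R X A \<subseteq> D" using reach_subset[of R X A] assms by auto
  show "reach R (g ` X) (g ` A) \<subseteq> g ` reach R X A"
  proof (rule reach_least)
    show "g ` A \<subseteq> g ` reach R X A" using reach_self by (intro image_mono)
    fix u v assume "u \<in> g ` reach R X A" "v \<in> g ` X" "R u v"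
    then obtain u' v' where "u = g u'" "v = g v'" "u' \<in> reach R X A" "v' \<in> X" by auto
    moreover have "R u' v'"
      using assms(4)[of u' v'] \<open>R u v\<close> calculation sub assms(2) by auto
    ultimately show "v \<in> g ` reach R X A" by (auto intro!: imageI reach_step[of u'])
  qed
  have "reach R X A \<subseteq> D \<inter> g -` reach R (g ` X) (g ` A)"
  proof (rule reach_least)
    show "A \<subseteq> D \<inter> g -` reach R (g ` X) (g ` A)"
      using assms(3) reach_self[of "g ` A" R "g ` X"] by auto
    fix u v assume uv: "u \<in> D \<inter> g -` reach R (g ` X) (g ` A)" "v \<in> X" "R u v"
    then have "v \<in> D" "R (g u) (g v)" using assms(2,4) by auto
    then show "v \<in> D \<inter> g -` reach R (g ` X) (g ` A)"
      using uv by (auto intro: reach_step[of "g u" R "g ` X"])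
  qed
  then show "g ` reach R X A \<subseteq> reach R (g ` X) (g ` A)" by auto
qed

text \<open>Stochastic comparison after H. Vanneuville: giving each vertex of the cluster an independent
  chance \<open>1 - exp (-h)\<close> of being marked, the second factor is the probability that the
  \<open>P\<close>-cluster of \<open>A\<close> contains no mark.  Exploring vertex by vertex, conditioning on
  this event lowers the opening probability from \<open>P\<close> to no less than \<open>P * (1 - M)\<close>.\<close>
lemma cluster_tail_times_laplace:
  fixes R :: "'a \<Rightarrow> 'a \<Rightarrow> bool" and p P h M :: real
  assumes "finite U" "finite A" "A \<inter> U = {}"
    and P: "0 \<le> P" "P \<le> 1" and p: "0 \<le> p" "p \<le> 1" "p \<le> P * (1 - M)" and "0 \<le> h"
    and lap: "\<And>V y. V \<subseteq> U \<Longrightarrow> y \<in> U - V \<Longrightarrow>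
      1 - M \<le> bern_sum P V (\<lambda>X. exp (- h * card (reach R X {y})))"
  shows "bern_sum p U (\<lambda>X. of_bool (n \<le> card (reach R X A)))
      * bern_sum P U (\<lambda>X. exp (- h * card (reach R X A))) \<le> exp (- h * n)"
  using assms(1-3) lap
proof (induction "card U" arbitrary: U A)
  case 0
  then have "U = {}" by simp
  moreover have "reach R {} A = A" by (rule reach_isolated) auto
  ultimately show ?case using \<open>0 \<le> h\<close> by (auto simp: mult_left_mono)
next
  case (Suc k)
  have lap': "1 - M \<le> bern_sum P V (\<lambda>X. exp (- h * card (reach R X {y})))" if "V \<subseteq> U" "y \<in> U - V" for V y
    using Suc.prems(4) that by blast
  show ?case
  proof (cases "\<exists>a\<in>A. \<exists>y\<in>U. R a y")
    case False
    then have "reach R X A = A" if "X \<subseteq> U" for X by (intro reach_isolated) (use that in auto)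
    \<comment> \<open>Nothing is left to explore: the cluster is \<open>A\<close> in every
      configuration, and the claim compares \<open>exp (- h * card A)\<close> with
      \<open>exp (- h * n)\<close> when \<open>n\<close> is at most \<open>card A\<close>.\<close>
    then have eq: "bern_sum q U (\<lambda>X. F (reach R X A)) = F A" for q and F :: "'a set \<Rightarrow> real"
      using bern_sum_cong[of U "\<lambda>X. F (reach R X A)" "\<lambda>_. F A" q] bern_sum_const[OF Suc.prems(1), of q "F A"]
      by simp
    show ?thesis unfolding eq[of _ "\<lambda>C. of_bool (n \<le> card C)"] eq[of _ "\<lambda>C. exp (- h * card C)"]
      using \<open>0 \<le> h\<close> by (auto simp: mult_left_mono)
  next
    case True
    then obtain a y where ay: "a \<in> A" "y \<in> U" "R a y" by auto
    define V where "V = U - {y}"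
    have V: "U = insert y V" "y \<notin> V" "finite V" "card V = k" "V \<subseteq> U"
      using ay Suc.prems(1) Suc.hyps(2) by (auto simp: V_def)
    have yA: "y \<notin> A" using ay Suc.prems(3) by auto
    define T where "T B = bern_sum p V (\<lambda>X. of_bool (n \<le> card (reach R X B)))" for B
    define L where "L B = bern_sum P V (\<lambda>X. exp (- h * card (reach R X B)))" for B
    have open_eq: "reach R (insert y X) A = reach R X (insert y A)" for X
      by (rule reach_insert_open[where R = R, OF ay(1,3)])
    have TU: "bern_sum p U (\<lambda>X. of_bool (n \<le> card (reach R X A))) = p * T (insert y A) + (1 - p) * T A"
      unfolding V(1) T_def by (subst bern_sum_insert[OF V(3,2)]) (simp add: open_eq)
    have LU: "bern_sum P U (\<lambda>X. exp (- h * card (reach R X A))) = P * L (insert y A) + (1 - P) * L A"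
      unfolding V(1) L_def by (subst bern_sum_insert[OF V(3,2)]) (simp add: open_eq)
    have IH: "T B * L B \<le> exp (- h * n)" if "B = A \<or> B = insert y A" for B
      unfolding T_def L_def
    proof (rule Suc.hyps(1))
      show "1 - M \<le> bern_sum P W (\<lambda>X. exp (- h * card (reach R X {z})))" if "W \<subseteq> V" "z \<in> V - W" for W z
        by (rule lap') (use that V in auto)
    qed (use V Suc.prems(1-3) that yA in auto)
    have fin: "finite (reach R X B)" if "X \<subseteq> V" "B \<subseteq> insert y A" for X B
      using V(3) Suc.prems(2) that by (meson finite.insertI finite_reach finite_subset)
    have T_mono: "T A \<le> T (insert y A)"
      unfolding T_def
    proof (rule bern_sum_mono[OF p(1,2)])
      fix X assume X: "X \<subseteq> V"
      have "card (reach R X A) \<le> card (reach R X (insert y A))"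
        by (rule card_mono[OF fin[OF X] reach_mono]) auto
      then show "of_bool (n \<le> card (reach R X A)) \<le> (of_bool (n \<le> card (reach R X (insert y A))) :: real)"
        by auto
    qed
    have L_nonneg: "0 \<le> L B" for B
      unfolding L_def bern_sum_def using P by (intro sum_nonneg) auto
    \<comment> \<open>Adding \<open>y\<close> to the explored set costs at most the factor
      \<open>1 - M\<close>: the two clusters together cover the joint one, and by Harris their
      decreasing Laplace weights are positively correlated.\<close>
    have "(1 - M) * L A \<le> L {y} * L A"
      by (rule mult_right_mono[OF _ L_nonneg]) (use V lap'[of V y] in \<open>auto simp: L_def\<close>)
    also have "\<dots> \<le> bern_sum P V (\<lambda>X. exp (- h * card (reach R X {y})) * exp (- h * card (reach R X A)))"
      unfolding L_def
    proof (rule harris_inequality[OF V(3) P])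
      fix X Y assume XY: "X \<subseteq> Y" "Y \<subseteq> V"
      have "card (reach R X B) \<le> card (reach R Y B)" if "B = {y} \<or> B = A" for B
        by (rule card_mono[OF fin[OF XY(2)] reach_mono[OF XY(1)]]) (use that in auto)
      then show "exp (- h * card (reach R Y {y})) \<le> exp (- h * card (reach R X {y}))"
        "exp (- h * card (reach R Y A)) \<le> exp (- h * card (reach R X A))"
        using \<open>0 \<le> h\<close> by (auto simp: mult_left_mono)
    qed
    also have "\<dots> \<le> L (insert y A)"
      unfolding L_def
    proof (rule bern_sum_mono[OF P])
      fix X assume X: "X \<subseteq> V"
      have "card (reach R X (insert y A)) \<le> card (reach R X {y}) + card (reach R X A)"
        using reach_Un[of R X "{y}" A] card_Un_le[of "reach R X {y}" "reach R X A"] by simp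
      then have "h * card (reach R X (insert y A)) \<le> h * (real (card (reach R X {y})) + card (reach R X A))"
        using \<open>0 \<le> h\<close> by (intro mult_left_mono) auto
      then show "exp (- h * card (reach R X {y})) * exp (- h * card (reach R X A))
          \<le> exp (- h * card (reach R X (insert y A)))"
        by (simp add: exp_add[symmetric] algebra_simps)
    qed
    finally have L1: "(1 - M) * L A \<le> L (insert y A)" .
    have M0: "0 \<le> M"
    proof -
      have "1 - M \<le> bern_sum P V (\<lambda>_. 1)"
        using lap'[of V y] V \<open>0 \<le> h\<close>
          bern_sum_mono[OF P, of V "\<lambda>X. exp (- h * card (reach R X {y}))" "\<lambda>_. 1"]
        by auto
      then show ?thesis using bern_sum_const[OF V(3)] by simp
    qed
    \<comment> \<open>\<open>v\<close> is the normalisation of the law tilted by the Laplace weight.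
      Under that law \<open>y\<close> is open with probability \<open>P * L (insert y A) / v\<close>
      when \<open>v\<close> is positive, and this is at least \<open>p\<close>.\<close>
    define v where "v = P * L (insert y A) + (1 - P) * L A"
    have v0: "0 \<le> v" unfolding v_def using P L_nonneg by auto
    have "(1 - M) * v \<le> L (insert y A)"
    proof -
      have "(1 - M) * L (insert y A) \<le> 1 * L (insert y A)"
        using M0 L_nonneg by (intro mult_right_mono) auto
      then have "P * ((1 - M) * L (insert y A)) + (1 - P) * ((1 - M) * L A)
          \<le> P * L (insert y A) + (1 - P) * L (insert y A)"
        using L1 P by (intro add_mono mult_left_mono) auto
      then show ?thesis by (simp add: v_def algebra_simps)
    qed
    then have "P * ((1 - M) * v) \<le> P * L (insert y A)" by (rule mult_left_mono[OF _ P(1)])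
    moreover have "p * v \<le> P * (1 - M) * v" by (rule mult_right_mono[OF p(3) v0])
    ultimately have "p * v \<le> P * L (insert y A)" by (simp add: mult.assoc)
    \<comment> \<open>Since the tail grows when \<open>y\<close> is opened, replacing the weight
      \<open>p * v\<close> of the open branch by the larger tilted weight can only increase the
      product.\<close>
    then have "0 \<le> (T (insert y A) - T A) * (P * L (insert y A) - p * v)"
      using T_mono by (intro mult_nonneg_nonneg) auto
    then have "(p * T (insert y A) + (1 - p) * T A) * v
        \<le> P * (T (insert y A) * L (insert y A)) + (1 - P) * (T A * L A)"
      by (simp add: v_def algebra_simps)
    also have "\<dots> \<le> P * exp (- h * n) + (1 - P) * exp (- h * n)"
      using IH P by (intro add_mono mult_left_mono) auto
    also have "\<dots> = exp (- h * n)" by (simp add: algebra_simps)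
    finally show ?thesis unfolding TU LU v_def .
  qed
qed

section \<open>Spectral measures of local operators\<close>

primrec mat_pow :: "('v \<Rightarrow> 'v \<Rightarrow> real) \<Rightarrow> 'v set \<Rightarrow> nat \<Rightarrow> 'v \<Rightarrow> 'v \<Rightarrow> real" where
  "mat_pow H F 0 x y = (if x = y then 1 else 0)"
| "mat_pow H F (Suc n) x y = (\<Sum>z\<in>F. H x z * mat_pow H F n z y)"

lemma mat_pow_eigenbasis:
  assumes "eigenbasis H F m e l" "x \<in> F" "y \<in> F"
  shows "mat_pow H F n x y = (\<Sum>i<m. l i ^ n * (e i x * e i y))"
  using assms(2)
proof (induction n arbitrary: x)
  case 0
  then show ?case using assms(1,3) by (simp add: eigenbasis_def)
next
  case (Suc n)
  have "mat_pow H F (Suc n) x y = (\<Sum>z\<in>F. \<Sum>i<m. (l i ^ n * e i y) * (H x z * e i z))"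
    by (simp add: Suc.IH sum_distrib_left algebra_simps)
  also have "\<dots> = (\<Sum>i<m. (l i ^ n * e i y) * matvec H F (e i) x)"
    by (subst sum.swap) (simp add: matvec_def sum_distrib_left)
  also have "\<dots> = (\<Sum>i<m. l i ^ Suc n * (e i x * e i y))"
    using assms(1) Suc.prems by (intro sum.cong) (auto simp: eigenbasis_def)
  finally show ?case .
qed

text \<open>Evaluate the eigenvalue equation at a coordinate of maximal modulus.\<close>

lemma eigenvalue_row_bound:
  assumes "eigenbasis H F m e l" "finite F" "i < m"
    and row: "\<And>x. x \<in> F \<Longrightarrow> (\<Sum>y\<in>F. \<bar>H x y\<bar>) \<le> C"
  shows "\<bar>l i\<bar> \<le> C"
proof -
  have norm: "dot F (e i) (e i) = 1" and eig: "\<And>x. x \<in> F \<Longrightarrow> matvec H F (e i) x = l i * e i x"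
    using assms(1,3) by (auto simp: eigenbasis_def)
  have "F \<noteq> {}" using norm by (auto simp: dot_def)
  then have "Max ((\<lambda>y. \<bar>e i y\<bar>) ` F) \<in> (\<lambda>y. \<bar>e i y\<bar>) ` F" using assms(2) by (intro Max_in) auto
  then obtain x where x: "x \<in> F" "Max ((\<lambda>y. \<bar>e i y\<bar>) ` F) = \<bar>e i x\<bar>" by auto
  have max: "\<bar>e i y\<bar> \<le> \<bar>e i x\<bar>" if "y \<in> F" for y
    unfolding x(2)[symmetric] using that assms(2) by (intro Max_ge) auto
  have pos: "0 < \<bar>e i x\<bar>"
  proof (rule ccontr)
    assume "\<not> ?thesis"
    then have "e i y = 0" if "y \<in> F" for y using max[OF that] by auto
    then show False using norm by (simp add: dot_def)
  qed
  have "\<bar>l i\<bar> * \<bar>e i x\<bar> = \<bar>\<Sum>y\<in>F. H x y * e i y\<bar>"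
    using eig[OF x(1)] by (simp add: matvec_def abs_mult)
  also have "\<dots> \<le> (\<Sum>y\<in>F. \<bar>H x y\<bar> * \<bar>e i x\<bar>)"
    by (rule order.trans[OF sum_abs]) (auto simp: abs_mult intro!: sum_mono mult_left_mono max)
  also have "\<dots> \<le> C * \<bar>e i x\<bar>"
    unfolding sum_distrib_right[symmetric] by (intro mult_right_mono row x(1)) auto
  finally show ?thesis using pos by simp
qed

text \<open>The spectral measure at \<open>x\<close>: an atom of mass \<open>(e i x)\<^sup>2\<close>
  at each \<open>l i\<close>. Taking an image of a measure on the indices adds up the masses of
  repeated eigenvalues.\<close>

definition eigen_measure :: "nat \<Rightarrow> (nat \<Rightarrow> 'v \<Rightarrow> real) \<Rightarrow> (nat \<Rightarrow> real) \<Rightarrow> 'v \<Rightarrow> real measure" where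
  "eigen_measure m e l x = distr (point_measure {..<m} (\<lambda>i. ennreal ((e i x)\<^sup>2))) borel l"

lemma eigen_measure_sets [simp]: "sets (eigen_measure m e l x) = sets borel" "space (eigen_measure m e l x) = UNIV"
  by (simp_all add: eigen_measure_def)

lemma emeasure_eigen_measure:
  assumes "B \<in> sets borel"
  shows "emeasure (eigen_measure m e l x) B = ennreal (\<Sum>i | i < m \<and> l i \<in> B. (e i x)\<^sup>2)"
proof -
  have "emeasure (eigen_measure m e l x) B = emeasure (point_measure {..<m} (\<lambda>i. ennreal ((e i x)\<^sup>2))) (l -` B \<inter> {..<m})"
    unfolding eigen_measure_def using assms by (subst emeasure_distr) (auto simp: space_point_measure)
  also have "\<dots> = (\<Sum>i\<in>l -` B \<inter> {..<m}. ennreal ((e i x)\<^sup>2))"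
    by (rule emeasure_point_measure_finite) auto
  also have "l -` B \<inter> {..<m} = {i. i < m \<and> l i \<in> B}" by auto
  finally show ?thesis by (simp add: sum_ennreal)
qed

lemma measure_eigen_measure:
  assumes "B \<in> sets borel"
  shows "measure (eigen_measure m e l x) B = (\<Sum>i | i < m \<and> l i \<in> B. (e i x)\<^sup>2)"
  by (simp add: measure_def emeasure_eigen_measure[OF assms] sum_nonneg)

lemma integral_eigen_measure:
  assumes "f \<in> borel_measurable borel"
  shows "(\<integral>t. f t \<partial>eigen_measure m e l x) = (\<Sum>i<m. (e i x)\<^sup>2 * f (l i))"
  unfolding eigen_measure_def using assms
  by (subst integral_distr) (auto simp: lebesgue_integral_point_measure_finite)

lemma eigen_measure_moment:
  assumes "eigenbasis H F m e l" "x \<in> F"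
  shows "(\<integral>t. t ^ n \<partial>eigen_measure m e l x) = mat_pow H F n x x"
  by (subst integral_eigen_measure) (auto simp: mat_pow_eigenbasis[OF assms(1,2,2)] power2_eq_square mult.commute)

lemma eigen_measure_prob_space:
  assumes "eigenbasis H F m e l" "x \<in> F"
  shows "prob_space (eigen_measure m e l x)"
proof
  have "(\<Sum>i<m. (e i x)\<^sup>2) = 1" using assms by (simp add: eigenbasis_def power2_eq_square)
  then show "emeasure (eigen_measure m e l x) (space (eigen_measure m e l x)) = 1"
    by (simp add: emeasure_eigen_measure lessThan_def)
qed

lemma eigen_measure_supported:
  assumes "eigenbasis H F m e l" "x \<in> F" "\<And>i. i < m \<Longrightarrow> \<bar>l i\<bar> \<le> C"
  shows "supported_measure C (eigen_measure m e l x)"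
proof -
  have "{i. i < m \<and> l i \<in> UNIV - {-C..C}} = {}" using assms(3) by (fastforce simp: abs_le_iff)
  then have "emeasure (eigen_measure m e l x) (UNIV - {-C..C}) = 0"
    by (subst emeasure_eigen_measure) (simp, simp only: sum.empty ennreal_0)
  then show ?thesis
    using eigen_measure_prob_space[OF assms(1,2)] by (simp add: supported_measure_def prob_space_def)
qed

text \<open>Walks of at most \<open>n\<close> steps from \<open>x\<close> never leave
  \<open>V\<close>, so truncation to \<open>V\<close> does not affect the first \<open>n\<close>
  powers in row \<open>x\<close>.\<close>

lemma mpow_eq_mat_pow:
  assumes V: "finite V" "V \<subseteq> W"
    and a: "\<And>z y. a z y \<Longrightarrow> y \<in> W"
    and H: "\<And>z y. y \<noteq> z \<Longrightarrow> \<not> a z y \<Longrightarrow> H z y = 0"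
    and "\<And>j z. j \<le> n \<Longrightarrow> (a ^^ j) x z \<Longrightarrow> z \<in> V"
  shows "mpow H W a n x y = mat_pow H V n x y"
  using assms(5)
proof (induction n arbitrary: x)
  case 0
  then show ?case by simp
next
  case (Suc n)
  have x: "x \<in> V" using Suc.prems[of 0 x] by simp
  have nb: "z \<in> V" if "a x z" for z
    using Suc.prems[of 1 z] that by (auto simp: relpowp_1)
  have sub: "{z \<in> W. z = x \<or> a x z} \<subseteq> V" using x nb by auto
  have "mpow H W a n z y = mat_pow H V n z y" if "z = x \<or> a x z" for z
  proof (rule Suc.IH)
    fix j w assume "j \<le> n" "(a ^^ j) z w"
    then show "w \<in> V"
      using that Suc.prems[of j w] Suc.prems[of "Suc j" w] relpowp_Suc_I2[of a x z j w] by auto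
  qed
  then have "mpow H W a (Suc n) x y = (\<Sum>z\<in>{z \<in> W. z = x \<or> a x z}. H x z * mat_pow H V n z y)"
    by simp
  also have "\<dots> = (\<Sum>z\<in>V. H x z * mat_pow H V n z y)"
    by (rule sum.mono_neutral_left[OF V(1) sub]) (use H V(2) in auto)
  finally show ?case by simp
qed

text \<open>The row bound over every finite \<open>V\<close> confines the eigenvalues of all finite
  truncations to [-C, C], the common support that the limit of spectral measures requires.\<close>

locale local_operator =
  fixes H :: "'v \<Rightarrow> 'v \<Rightarrow> real" and W :: "'v set" and a :: "'v \<Rightarrow> 'v \<Rightarrow> bool" and C :: real
  assumes H_sym: "H x y = H y x"
    and H_local: "y \<noteq> x \<Longrightarrow> \<not> a x y \<Longrightarrow> H x y = 0"
    and H_row: "finite V \<Longrightarrow> (\<Sum>y\<in>V. \<bar>H x y\<bar>) \<le> C"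
    and adj_sym: "a x y \<Longrightarrow> a y x"
    and adj_vertex: "a x y \<Longrightarrow> y \<in> W"
    and adj_finite: "finite {y. a x y}"
begin

lemma C_nonneg: "0 \<le> C"
  using H_row[of "{}"] by simp

definition moment_measure :: "'v \<Rightarrow> real measure \<Rightarrow> bool" where
  "moment_measure x \<mu> \<longleftrightarrow> supported_measure C \<mu> \<and> (\<forall>n. (\<integral>t. t ^ n \<partial>\<mu>) = mpow H W a n x x)"

lemma relpowp_vertex: "(a ^^ j) x y \<Longrightarrow> x \<in> W \<Longrightarrow> y \<in> W"
  by (cases j) (auto intro: adj_vertex)

lemma finite_relpowp: "finite {z. (a ^^ j) x z}"
proof (induction j)
  case (Suc j)
  have "{z. (a ^^ Suc j) x z} = (\<Union>y\<in>{z. (a ^^ j) x z}. {z. a y z})" by auto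
  then show ?case using Suc adj_finite by simp
qed simp

text \<open>Truncate to the balls \<open>V j\<close> around \<open>x\<close>. The
  \<open>n\<close>-th moment of the truncated spectral measure is constant from \<open>j = n\<close>
  on, so all moments converge, even on an infinite cluster.\<close>

lemma moment_measure_exists:
  assumes "x \<in> W"
  shows "\<exists>\<mu>. moment_measure x \<mu>"
proof -
  define V where "V j = {z. \<exists>i\<le>j. (a ^^ i) x z}" for j
  have V: "finite (V j)" "V j \<subseteq> W" "x \<in> V j" for j
  proof -
    have "V j = (\<Union>i\<in>{..j}. {z. (a ^^ i) x z})" by (auto simp: V_def)
    then show "finite (V j)" using finite_relpowp by simp
    show "V j \<subseteq> W" using relpowp_vertex assms by (auto simp: V_def)
    show "x \<in> V j" by (auto simp: V_def intro!: exI[of _ 0])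
  qed
  have "\<exists>m e l. eigenbasis H (V j) m e l" for j
    using eigenbasis_exists[OF V(1), where H = H] H_sym by metis
  then obtain m e l where eb: "\<And>j. eigenbasis H (V j) (m j) (e j) (l j)" by metis
  have "\<exists>\<nu>. supported_measure C \<nu> \<and> (\<forall>n. (\<integral>t. t ^ n \<partial>\<nu>) = mpow H W a n x x)"
  proof (rule moment_measure_limit[OF C_nonneg])
    show "supported_measure C (eigen_measure (m j) (e j) (l j) x)" for j
      using eigenvalue_row_bound[OF eb V(1)] H_row[OF V(1)]
      by (intro eigen_measure_supported[OF eb V(3)]) blast
    show "prob_space (eigen_measure (m j) (e j) (l j) x)" for j
      by (rule eigen_measure_prob_space[OF eb V(3)])
    show "(\<lambda>j. \<integral>t. t ^ n \<partial>eigen_measure (m j) (e j) (l j) x) \<longlonglongrightarrow> mpow H W a n x x" for n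
    proof (rule tendsto_eventually, unfold eventually_sequentially, intro exI allI impI)
      fix j assume "n \<le> j"
      then have "mpow H W a n x x = mat_pow H (V j) n x x"
        by (intro mpow_eq_mat_pow V adj_vertex H_local) (auto simp: V_def intro: order.trans)
      then show "(\<integral>t. t ^ n \<partial>eigen_measure (m j) (e j) (l j) x) = mpow H W a n x x"
        by (simp add: eigen_measure_moment[OF eb V(3)])
    qed
  qed
  then show ?thesis by (simp add: moment_measure_def)
qed

text \<open>This resolves the definite description once and for all: moments and bounded support
  leave no other candidate.\<close>

lemma spec_cdf_eq:
  assumes "x \<in> W" "moment_measure x \<mu>"
  shows "spec_cdf H W a x E = measure \<mu> {..E}"
proof -
  let ?P = "\<lambda>\<mu>. sets \<mu> = sets borel \<and> finite_measure \<mu> \<and> (\<exists>C. emeasure \<mu> (UNIV - {-C..C}) = 0)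
    \<and> (\<forall>n. (\<integral>t. t ^ n \<partial>\<mu>) = mpow H W a n x x)"
  have "(THE \<mu>. ?P \<mu>) = \<mu>"
  proof (rule the_equality)
    show "?P \<mu>" using assms(2) by (auto simp: moment_measure_def supported_measure_def)
    fix \<nu> assume \<nu>: "?P \<nu>"
    then obtain D where "supported_measure D \<nu>" by (auto simp: supported_measure_def)
    then show "\<nu> = \<mu>"
      by (rule supported_measure_unique[of D \<nu> C \<mu>]) (use \<nu> assms(2) in \<open>auto simp: moment_measure_def\<close>)
  qed
  then show ?thesis using assms(1) by (simp add: spec_cdf_def)
qed

lemma spec_cdf_bounds: "0 \<le> spec_cdf H W a x E" "spec_cdf H W a x E \<le> 1"
proof -
  have "0 \<le> spec_cdf H W a x E \<and> spec_cdf H W a x E \<le> 1"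
  proof (cases "x \<in> W")
    case True
    then obtain \<mu> where \<mu>: "moment_measure x \<mu>" using moment_measure_exists by blast
    interpret finite_measure \<mu> using \<mu> by (simp add: moment_measure_def supported_measure_def)
    have "(\<integral>t. t ^ 0 \<partial>\<mu>) = mpow H W a 0 x x" using \<mu> by (simp only: moment_measure_def)
    then have "measure \<mu> (space \<mu>) = 1" by simp
    then show ?thesis using bounded_measure[of "{..E}"] by (simp add: spec_cdf_eq[OF True \<mu>])
  qed (simp add: spec_cdf_def)
  then show "0 \<le> spec_cdf H W a x E" "spec_cdf H W a x E \<le> 1" by auto
qed

text \<open>No walk leaves a cluster, so for a finite one the truncation is exact at every power and
  the spectral measure is that of a finite matrix.\<close>

lemma spec_cdf_finite_cluster:
  assumes V: "V = {y. a\<^sup>*\<^sup>* x y}" "finite V" and eb: "eigenbasis H V m e l"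
    and "x \<in> W" "y \<in> V"
  shows "spec_cdf H W a y E = (\<Sum>i | i < m \<and> l i \<le> E. (e i y)\<^sup>2)"
proof -
  have star: "z \<in> W" if "a\<^sup>*\<^sup>* x z" for z
    using that by cases (use \<open>x \<in> W\<close> in \<open>auto intro: adj_vertex\<close>)
  have sub: "V \<subseteq> W" using star V by auto
  have "moment_measure y (eigen_measure m e l y)"
    unfolding moment_measure_def
  proof (intro conjI allI)
    show "supported_measure C (eigen_measure m e l y)"
      using eigenvalue_row_bound[OF eb V(2)] H_row[OF V(2)]
      by (intro eigen_measure_supported[OF eb \<open>y \<in> V\<close>]) blast
    show "(\<integral>t. t ^ n \<partial>eigen_measure m e l y) = mpow H W a n y y" for n
      unfolding eigen_measure_moment[OF eb \<open>y \<in> V\<close>]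
    proof (rule mpow_eq_mat_pow[symmetric, OF V(2) sub])
      fix j z assume "(a ^^ j) y z"
      then have "a\<^sup>*\<^sup>* y z" by (rule relpowp_imp_rtranclp)
      then show "z \<in> V" using \<open>y \<in> V\<close> V by auto
    qed (auto intro: adj_vertex H_local)
  qed
  from spec_cdf_eq[OF _ this] show ?thesis
    using sub \<open>y \<in> V\<close> by (auto simp: measure_eigen_measure)
qed

end

section \<open>A Faber--Krahn inequality on the lamplighter group\<close>

locale lamplighter_cayley =
  fixes m :: int and S :: "ll set"
  assumes m: "2 \<le> m" and gen: "cayley_gen_set m S"
begin

abbreviation G where "G \<equiv> ll_carrier m"
abbreviation mult (infixl "\<otimes>" 70) where "mult \<equiv> ll_mult m"
abbreviation inve where "inve \<equiv> ll_inv m"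

section \<open>Group laws and left invariance of the Cayley graph\<close>

lemma one_G: "ll_one \<in> G"
  using m by (simp add: ll_one_def ll_carrier_def)

lemma mult_G:
  assumes "a \<in> G" "b \<in> G" shows "a \<otimes> b \<in> G"
proof -
  have "{i. (fst a i + fst b (i - snd a)) mod m \<noteq> 0} \<subseteq> {i. fst a i \<noteq> 0} \<union> (\<lambda>i. i + snd a) ` {i. fst b i \<noteq> 0}"
  proof
    fix i assume i: "i \<in> {i. (fst a i + fst b (i - snd a)) mod m \<noteq> 0}"
    then have "fst a i \<noteq> 0 \<or> fst b (i - snd a) \<noteq> 0" by auto
    then show "i \<in> {i. fst a i \<noteq> 0} \<union> (\<lambda>i. i + snd a) ` {i. fst b i \<noteq> 0}"
      by (auto simp: image_iff intro: exI[of _ "i - snd a"])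
  qed
  then have "finite {i. (fst a i + fst b (i - snd a)) mod m \<noteq> 0}"
    by (rule finite_subset) (use assms in \<open>auto simp: ll_carrier_def\<close>)
  then show ?thesis using m by (auto simp: ll_mult_def ll_carrier_def)
qed

lemma inve_G:
  assumes "a \<in> G" shows "inve a \<in> G"
proof -
  have "{i. (- fst a (i + snd a)) mod m \<noteq> 0} \<subseteq> (\<lambda>i. i - snd a) ` {i. fst a i \<noteq> 0}"
  proof
    fix i assume i: "i \<in> {i. (- fst a (i + snd a)) mod m \<noteq> 0}"
    then have "fst a (i + snd a) \<noteq> 0" by auto
    then show "i \<in> (\<lambda>i. i - snd a) ` {i. fst a i \<noteq> 0}"
      by (auto simp: image_iff intro: exI[of _ "i + snd a"])
  qed
  then have "finite {i. (- fst a (i + snd a)) mod m \<noteq> 0}"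
    by (rule finite_subset) (use assms in \<open>auto simp: ll_carrier_def\<close>)
  then show ?thesis using m by (auto simp: ll_inv_def ll_carrier_def)
qed

lemma mult_assoc: "a \<otimes> b \<otimes> c = a \<otimes> (b \<otimes> c)"
  by (simp add: ll_mult_def mod_add_left_eq mod_add_right_eq add.assoc diff_diff_eq)

lemma one_mult: "a \<in> G \<Longrightarrow> ll_one \<otimes> a = a"
  by (auto simp: ll_mult_def ll_one_def ll_carrier_def fun_eq_iff)

lemma mult_one: "a \<in> G \<Longrightarrow> a \<otimes> ll_one = a"
  by (auto simp: ll_mult_def ll_one_def ll_carrier_def fun_eq_iff)

lemma inve_mult: "inve a \<otimes> a = ll_one"
  by (auto simp: ll_mult_def ll_one_def ll_inv_def fun_eq_iff mod_simps)

lemma mult_inve: "a \<otimes> inve a = ll_one"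
  by (auto simp: ll_mult_def ll_one_def ll_inv_def fun_eq_iff mod_simps)

lemma inve_mult_cancel: "x \<in> G \<Longrightarrow> inve g \<otimes> (g \<otimes> x) = x"
  by (simp add: mult_assoc[symmetric] inve_mult one_mult)

lemma mult_inve_cancel: "x \<in> G \<Longrightarrow> g \<otimes> (inve g \<otimes> x) = x"
  by (simp add: mult_assoc[symmetric] mult_inve one_mult)

lemma mult_cancel_right_inve: "x \<in> G \<Longrightarrow> x \<otimes> g \<otimes> inve g = x"
  by (simp add: mult_assoc mult_inve mult_one)

lemma mult_cancel_inve_right: "x \<in> G \<Longrightarrow> x \<otimes> inve g \<otimes> g = x"
  by (simp add: mult_assoc inve_mult mult_one)

lemma inj_left: "inj_on ((\<otimes>) g) G"
  by (rule inj_on_inverseI[of _ "(\<otimes>) (inve g)"]) (rule inve_mult_cancel)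

lemma inj_right: "inj_on (\<lambda>x. x \<otimes> g) G"
  by (rule inj_on_inverseI[of _ "\<lambda>x. x \<otimes> inve g"]) (rule mult_cancel_right_inve)

lemma inve_inve: "a \<in> G \<Longrightarrow> inve (inve a) = a"
  using inve_mult_cancel[of a "inve a"] by (simp add: inve_mult mult_one inve_G)

lemma S_G: "s \<in> S \<Longrightarrow> s \<in> G"
  using gen unfolding cayley_gen_set_def by (elim conjE) (rule subsetD)

lemma finite_S: "finite S"
  using gen unfolding cayley_gen_set_def by simp

lemma inve_S: "s \<in> S \<Longrightarrow> inve s \<in> S"
  using gen unfolding cayley_gen_set_def by (elim conjE) (rule bspec)

lemma G_gen: "g \<in> G \<Longrightarrow> g \<in> ll_gen m S"
  using gen unfolding cayley_gen_set_def by (elim conjE) (rule subsetD)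


lemma gen_G: "g \<in> ll_gen m S \<Longrightarrow> g \<in> G"
proof (induction rule: ll_gen.induct)
  case one
  show ?case by (rule one_G)
next
  case (step g s)
  show ?case by (rule mult_G[OF step.IH S_G[OF step.hyps(2)]])
qed

lemma cay_adj_iff: "cay_adj m S x y \<longleftrightarrow> x \<in> G \<and> (\<exists>s\<in>S. y = x \<otimes> s)"
  by (auto simp: cay_adj_def intro: mult_G S_G)

lemma cay_adj_sym: "cay_adj m S x y \<Longrightarrow> cay_adj m S y x"
proof -
  assume "cay_adj m S x y"
  then obtain s where s: "x \<in> G" "y \<in> G" "s \<in> S" "y = x \<otimes> s" by (auto simp: cay_adj_def)
  then have "x = y \<otimes> inve s" by (simp add: mult_cancel_right_inve)
  then show ?thesis using s(1,2) inve_S[OF s(3)] unfolding cay_adj_def by blast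
qed

lemma cay_adj_G: "cay_adj m S x y \<Longrightarrow> x \<in> G" "cay_adj m S x y \<Longrightarrow> y \<in> G"
  by (auto simp: cay_adj_def)

lemma cay_adj_translate:
  assumes "g \<in> G" "x \<in> G" "y \<in> G"
  shows "cay_adj m S (g \<otimes> x) (g \<otimes> y) \<longleftrightarrow> cay_adj m S x y"
proof -
  have "g \<otimes> y = g \<otimes> x \<otimes> s \<longleftrightarrow> y = x \<otimes> s" if "s \<in> S" for s
    using inj_on_eq_iff[OF inj_left[of g], of y "x \<otimes> s"] assms that mult_G[OF assms(2) S_G[OF that]]
    by (simp add: mult_assoc)
  then show ?thesis using assms by (auto simp: cay_adj_iff mult_G)
qed

lemma neighbours: "x \<in> G \<Longrightarrow> {y. cay_adj m S x y} = (\<otimes>) x ` S"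
  by (auto simp: cay_adj_iff)

lemma finite_neighbours: "finite {y. cay_adj m S x y}"
proof -
  have "{y. cay_adj m S x y} \<subseteq> (\<otimes>) x ` S" by (auto simp: cay_adj_iff)
  then show ?thesis using finite_S finite_surj by blast
qed

lemma card_neighbours: "card {y. cay_adj m S x y} \<le> card S"
proof -
  have "{y. cay_adj m S x y} \<subseteq> (\<otimes>) x ` S" by (auto simp: cay_adj_iff)
  then show ?thesis using finite_S surj_card_le by blast
qed

end

locale lamplighter_function = lamplighter_cayley +
  fixes F :: "ll set" and \<psi> :: "ll \<Rightarrow> real"
  assumes F: "finite F" "F \<subseteq> G" and supp: "x \<notin> F \<Longrightarrow> \<psi> x = 0" and nonneg: "0 \<le> \<psi> x"
begin

definition corr :: "ll \<Rightarrow> real" where "corr g = (\<Sum>x\<in>F. \<psi> x * \<psi> (x \<otimes> g))"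

text \<open>The l2 norm of the difference between \<psi> and its right translate by
  \<open>g\<close>. Writing it through correlations avoids choosing a finite window that contains
  both supports.\<close>

definition displ :: "ll \<Rightarrow> real" where "displ g = sqrt (2 * (corr ll_one - corr g))"

lemma corr_one: "corr ll_one = (\<Sum>x\<in>F. (\<psi> x)\<^sup>2)"
  unfolding corr_def by (intro sum.cong) (use F mult_one in \<open>auto simp: power2_eq_square\<close>)

text \<open>Expand the square; \<open>A\<close> contains the supports of \<psi> and of its
  translate, so both squared norms equal \<open>corr ll_one\<close>.\<close>

lemma sum_displacement:
  assumes g: "g \<in> G" and A: "finite A" "A \<subseteq> G" "F \<subseteq> A" "(\<lambda>x. x \<otimes> inve g) ` F \<subseteq> A"
  shows "(\<Sum>x\<in>A. (\<psi> x - \<psi> (x \<otimes> g))\<^sup>2) = 2 * (corr ll_one - corr g)"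
proof -
  have 1: "(\<Sum>x\<in>A. (\<psi> x)\<^sup>2) = corr ll_one"
    unfolding corr_one by (rule sum.mono_neutral_right[OF A(1,3)]) (auto simp: supp)
  have "(\<Sum>x\<in>F. (\<psi> x)\<^sup>2) = (\<Sum>x\<in>(\<lambda>x. x \<otimes> inve g) ` F. (\<psi> (x \<otimes> g))\<^sup>2)"
    using F inj_on_subset[OF inj_right F(2)]
    by (subst sum.reindex) (auto simp: mult_cancel_inve_right subset_eq intro!: sum.cong)
  also have "\<dots> = (\<Sum>x\<in>A. (\<psi> (x \<otimes> g))\<^sup>2)"
  proof (rule sum.mono_neutral_left[OF A(1,4)])
    have "x \<in> (\<lambda>x. x \<otimes> inve g) ` F" if "x \<in> A" "x \<otimes> g \<in> F" for x
      using that A(2) mult_cancel_right_inve[of x g] by (metis imageI subsetD)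
    then have "x \<otimes> g \<notin> F" if "x \<in> A - (\<lambda>x. x \<otimes> inve g) ` F" for x using that by blast
    then show "\<forall>x\<in>A - (\<lambda>x. x \<otimes> inve g) ` F. (\<psi> (x \<otimes> g))\<^sup>2 = 0" by (simp add: supp)
  qed
  finally have 2: "(\<Sum>x\<in>A. (\<psi> (x \<otimes> g))\<^sup>2) = corr ll_one" by (simp add: corr_one)
  have "(\<Sum>x\<in>A. \<psi> x * \<psi> (x \<otimes> g)) = corr g"
    unfolding corr_def by (rule sum.mono_neutral_right[OF A(1,3)]) (auto simp: supp)
  then have 3: "(\<Sum>x\<in>A. 2 * \<psi> x * \<psi> (x \<otimes> g)) = 2 * corr g"
    by (simp add: sum_distrib_left[symmetric] mult.assoc)
  show ?thesis
    unfolding power2_diff sum.distrib sum_subtractf 1 2 3 by (simp add: algebra_simps)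
qed

lemma translate_inve_G: "g \<in> G \<Longrightarrow> (\<lambda>x. x \<otimes> inve g) ` F \<subseteq> G"
  using F mult_G inve_G by blast

lemma corr_le:
  assumes "g \<in> G" shows "corr g \<le> corr ll_one"
proof -
  let ?A = "F \<union> (\<lambda>x. x \<otimes> inve g) ` F"
  have "0 \<le> (\<Sum>x\<in>?A. (\<psi> x - \<psi> (x \<otimes> g))\<^sup>2)" by (rule sum_nonneg) simp
  also have "\<dots> = 2 * (corr ll_one - corr g)"
    using F translate_inve_G[OF assms] by (intro sum_displacement[OF assms]) simp_all
  finally show ?thesis by simp
qed

lemma L2_displacement_le:
  assumes "g \<in> G" "finite A" "A \<subseteq> G"
  shows "L2_set (\<lambda>x. \<psi> x - \<psi> (x \<otimes> g)) A \<le> displ g"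
proof -
  let ?B = "A \<union> F \<union> (\<lambda>x. x \<otimes> inve g) ` F"
  have "(\<Sum>x\<in>A. (\<psi> x - \<psi> (x \<otimes> g))\<^sup>2) \<le> (\<Sum>x\<in>?B. (\<psi> x - \<psi> (x \<otimes> g))\<^sup>2)"
    using assms F by (intro sum_mono2) auto
  also have "\<dots> = 2 * (corr ll_one - corr g)"
    using assms F translate_inve_G[OF assms(1)] by (intro sum_displacement) auto
  finally show ?thesis by (simp add: L2_set_def displ_def)
qed

text \<open>Triangle inequality through the intermediate translate by \<open>g\<close>; right
  translation by \<open>g\<close> is injective and only relabels the second summand.\<close>

lemma displ_mult:
  assumes "g \<in> G" "h \<in> G"
  shows "displ (g \<otimes> h) \<le> displ g + displ h"
proof -
  define A where "A = F \<union> (\<lambda>x. x \<otimes> inve (g \<otimes> h)) ` F"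
  have gh: "g \<otimes> h \<in> G" using mult_G assms by blast
  have A: "finite A" "A \<subseteq> G" using F translate_inve_G[OF gh] by (simp_all add: A_def)
  have Ag: "finite ((\<lambda>x. x \<otimes> g) ` A)" "(\<lambda>x. x \<otimes> g) ` A \<subseteq> G" using A mult_G assms by blast+
  have "displ (g \<otimes> h) = L2_set (\<lambda>x. \<psi> x - \<psi> (x \<otimes> (g \<otimes> h))) A"
    unfolding displ_def L2_set_def by (subst sum_displacement[OF gh A]) (simp_all add: A_def)
  also have "\<dots> = L2_set (\<lambda>x. (\<psi> x - \<psi> (x \<otimes> g)) + (\<psi> (x \<otimes> g) - \<psi> (x \<otimes> g \<otimes> h))) A"
    by (simp add: mult_assoc)
  also have "\<dots> \<le> L2_set (\<lambda>x. \<psi> x - \<psi> (x \<otimes> g)) A + L2_set (\<lambda>x. \<psi> (x \<otimes> g) - \<psi> (x \<otimes> g \<otimes> h)) A"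
    by (rule L2_set_triangle_ineq)
  also have "L2_set (\<lambda>x. \<psi> (x \<otimes> g) - \<psi> (x \<otimes> g \<otimes> h)) A
      = L2_set (\<lambda>y. \<psi> y - \<psi> (y \<otimes> h)) ((\<lambda>x. x \<otimes> g) ` A)"
    unfolding L2_set_def by (subst sum.reindex[OF inj_on_subset[OF inj_right A(2)]]) simp
  also have "L2_set (\<lambda>x. \<psi> x - \<psi> (x \<otimes> g)) A + \<dots> \<le> displ g + displ h"
    by (intro add_mono L2_displacement_le assms A Ag)
  finally show ?thesis .
qed

lemma displ_one: "displ ll_one = 0"
  by (simp add: displ_def)

end

context lamplighter_cayley
begin

definition walker :: "int set \<Rightarrow> nat \<Rightarrow> ll" where
  "walker P r = ((\<lambda>i. of_bool (i \<in> P)), int r)"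

lemma walker_G: "P \<subseteq> {0..<int r} \<Longrightarrow> walker P r \<in> G"
  using m finite_subset[of P "{0..<int r}"] by (simp add: walker_def ll_carrier_def)

lemma walker_Suc:
  assumes "P \<subseteq> {0..<int (Suc r)}"
  shows "walker P (Suc r) = walker (P - {int r}) r \<otimes> walker (if int r \<in> P then {0} else {}) 1"
proof -
  \<comment> \<open>The lamp of the last letter sits at position \<open>r\<close>, which earlier
    letters leave dark, so no addition of lamp states wraps around modulo \<open>m\<close>.\<close>
  have "of_bool (i \<in> P) = (of_bool (i \<in> P - {int r}) + of_bool (i - int r \<in> (if int r \<in> P then {0} else {}))) mod m" for i
    using m by (cases "i = int r"; cases "i \<in> P"; cases "int r \<in> P") simp_all
  then show ?thesis by (simp add: walker_def ll_mult_def)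
qed

lemma walker_inj: "inj (\<lambda>P. walker P r)"
proof (rule injI)
  fix P P' assume eq: "walker P r = walker P' r"
  have "i \<in> P \<longleftrightarrow> i \<in> P'" for i
    using fun_cong[OF arg_cong[OF eq, of fst], of i] by (simp add: walker_def of_bool_eq_iff)
  then show "P = P'" by blast
qed

text \<open>Records only the consequence of word length at most \<open>n\<close> that the argument
  uses: displacement grows at most linearly along a word, uniformly over all test functions.\<close>

definition has_length :: "ll \<Rightarrow> nat \<Rightarrow> bool" where
  "has_length g n \<longleftrightarrow> (\<forall>F \<psi> \<delta>. lamplighter_function m S F \<psi> \<longrightarrow> 0 \<le> \<delta> \<longrightarrow>
     (\<forall>s\<in>S. lamplighter_function.displ m F \<psi> s \<le> \<delta>) \<longrightarrow> lamplighter_function.displ m F \<psi> g \<le> n * \<delta>)"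

lemma has_length_mult:
  assumes "g \<in> G" "h \<in> G" "has_length g i" "has_length h j"
  shows "has_length (g \<otimes> h) (i + j)"
  unfolding has_length_def
proof (intro allI impI)
  fix F and \<psi> :: "ll \<Rightarrow> real" and \<delta> :: real assume *: "lamplighter_function m S F \<psi>" "0 \<le> \<delta>"
    "\<forall>s\<in>S. lamplighter_function.displ m F \<psi> s \<le> \<delta>"
  interpret lamplighter_function m S F \<psi> by (rule *)
  have "displ g \<le> i * \<delta>" "displ h \<le> j * \<delta>" using assms(3,4) * by (auto simp: has_length_def)
  then show "displ (g \<otimes> h) \<le> real (i + j) * \<delta>"
    using displ_mult[OF assms(1,2)] by (simp add: algebra_simps)
qed

lemma has_length_one: "has_length ll_one 0"
  unfolding has_length_def by (simp add: lamplighter_function.displ_one)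

lemma has_length_mono:
  assumes "has_length g i" "i \<le> j" shows "has_length g j"
  unfolding has_length_def
proof (intro allI impI)
  fix F and \<psi> :: "ll \<Rightarrow> real" and \<delta> :: real assume *: "lamplighter_function m S F \<psi>" "0 \<le> \<delta>"
    "\<forall>s\<in>S. lamplighter_function.displ m F \<psi> s \<le> \<delta>"
  have "lamplighter_function.displ m F \<psi> g \<le> i * \<delta>" using assms(1) * by (auto simp: has_length_def)
  also have "\<dots> \<le> j * \<delta>" using * assms(2) by (intro mult_right_mono) auto
  finally show "lamplighter_function.displ m F \<psi> g \<le> j * \<delta>" .
qed

lemma has_length_exists: "g \<in> ll_gen m S \<Longrightarrow> \<exists>n. has_length g n"
proof (induction rule: ll_gen.induct)
  case one
  then show ?case using has_length_one by blast
next
  case (step g s)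
  then have "has_length s 1" by (auto simp: has_length_def)
  then show ?case using step has_length_mult gen_G S_G by blast
qed

text \<open>Both letters are words in \<open>S\<close>, and \<open>L\<close> exceeds the lengths of
  these words; each step of the walker therefore costs at most \<open>L\<close>.\<close>

lemma walker_length_linear:
  obtains L where "0 < L" "\<And>P r. P \<subseteq> {0..<int r} \<Longrightarrow> has_length (walker P r) (r * L)"
proof -
  have t: "walker {} 1 \<in> G" "walker {0} 1 \<in> G" by (auto intro!: walker_G)
  obtain i j where ij: "has_length (walker {} 1) i" "has_length (walker {0} 1) j"
    using has_length_exists[OF G_gen[OF t(1)]] has_length_exists[OF G_gen[OF t(2)]] by blast
  define L where "L = i + j + 1"
  have L: "has_length (walker {} 1) L" "has_length (walker {0} 1) L"
    using ij by (auto simp: L_def intro: has_length_mono)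
  have "has_length (walker P r) (r * L)" if "P \<subseteq> {0..<int r}" for P r
    using that
  proof (induction r arbitrary: P)
    case 0
    then have "walker P 0 = ll_one" by (auto simp: walker_def ll_one_def)
    then show ?case using has_length_one by simp
  next
    case (Suc r)
    have sub: "P - {int r} \<subseteq> {0..<int r}" using Suc.prems by auto
    have "has_length (walker (P - {int r}) r \<otimes> walker (if int r \<in> P then {0} else {}) 1) (r * L + L)"
      using Suc.IH[OF sub] L t walker_G[OF sub] by (intro has_length_mult) auto
    then show ?case by (simp add: walker_Suc[OF Suc.prems] add.commute)
  qed
  then show ?thesis using that[of L] by (simp add: L_def)
qed

text \<open>Averaging the squared displacement over exponentially many products of the two
  letters \<open>(0, 1)\<close> and \<open>(\<delta>\<^sub>0, 1)\<close>, which generate a free semigroup: if there are at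
  least \<open>2 * card F\<close> of them, they move most of the mass of \<open>\<psi>\<close> away from itself.\<close>
lemma faber_krahn:
  fixes \<psi> :: "ll \<Rightarrow> real" and L :: nat
  assumes L: "\<And>P. P \<subseteq> {0..<int r} \<Longrightarrow> has_length (walker P r) (r * L)"
    and lf: "lamplighter_function m S F \<psi>" and card: "2 * card F \<le> 2 ^ r"
  shows "(\<Sum>x\<in>F. (\<psi> x)\<^sup>2) \<le> 2 * (real r * L)\<^sup>2 * (card S * (\<Sum>x\<in>F. (\<psi> x)\<^sup>2) - (\<Sum>x\<in>F. \<Sum>s\<in>S. \<psi> x * \<psi> (x \<otimes> s)))"
proof -
  interpret lamplighter_function m S F \<psi> by (rule lf)
  define c where "c = corr ll_one"
  define Q where "Q = (\<Sum>s\<in>S. c - corr s)"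
  have Q_eq: "Q = card S * c - (\<Sum>x\<in>F. \<Sum>s\<in>S. \<psi> x * \<psi> (x \<otimes> s))"
  proof -
    have "(\<Sum>s\<in>S. corr s) = (\<Sum>x\<in>F. \<Sum>s\<in>S. \<psi> x * \<psi> (x \<otimes> s))"
      unfolding corr_def by (rule sum.swap)
    then show ?thesis by (simp add: Q_def sum_subtractf)
  qed
  have Q0: "0 \<le> Q" unfolding Q_def c_def by (intro sum_nonneg) (simp add: corr_le S_G)
  \<comment> \<open>\<open>Q\<close> is a sum of nonnegative terms, one for each generator, so it
    bounds each of them; there is no averaging over generators.\<close>
  have displ_S: "displ s \<le> sqrt (2 * Q)" if "s \<in> S" for s
  proof -
    have "c - corr s \<le> Q" unfolding Q_def
      by (rule member_le_sum[OF that _ finite_S]) (simp add: c_def corr_le S_G)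
    then show ?thesis by (simp add: displ_def c_def)
  qed
  define \<P> where "\<P> = Pow {0..<int r}"
  have \<P>: "finite \<P>" "card \<P> = 2 ^ r" by (simp_all add: \<P>_def card_Pow)
  have disp: "2 * (c - corr (walker P r)) \<le> (real r * L)\<^sup>2 * (2 * Q)" if "P \<in> \<P>" for P
  proof -
    have P: "P \<subseteq> {0..<int r}" using that by (simp add: \<P>_def)
    have "displ (walker P r) \<le> real (r * L) * sqrt (2 * Q)"
      using L[OF P] lf Q0 displ_S unfolding has_length_def by auto
    moreover have "0 \<le> displ (walker P r)"
      using corr_le[OF walker_G[OF P]] by (simp add: displ_def)
    ultimately have "(displ (walker P r))\<^sup>2 \<le> (real (r * L) * sqrt (2 * Q))\<^sup>2"
      by (rule power_mono)
    then show ?thesis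
      using corr_le[OF walker_G[OF P]] Q0 by (simp add: displ_def c_def power_mult_distrib)
  qed
  have "(\<Sum>P\<in>\<P>. corr (walker P r)) = (\<Sum>x\<in>F. \<psi> x * (\<Sum>P\<in>\<P>. \<psi> (x \<otimes> walker P r)))"
    unfolding corr_def by (subst sum.swap) (simp add: sum_distrib_left)
  \<comment> \<open>For fixed \<open>x\<close> the \<open>2 ^ r\<close> points
    \<open>x \<otimes> walker P r\<close> are distinct, so the inner sum meets each point of the
    support at most once.\<close>
  also have "\<dots> \<le> (\<Sum>x\<in>F. \<psi> x * (\<Sum>y\<in>F. \<psi> y))"
  proof (intro sum_mono mult_left_mono nonneg)
    fix x assume "x \<in> F"
    then have x: "x \<in> G" using F by auto
    have inj: "inj_on (\<lambda>P. x \<otimes> walker P r) \<P>"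
    proof (rule inj_onI)
      fix P P' assume PP: "P \<in> \<P>" "P' \<in> \<P>" "x \<otimes> walker P r = x \<otimes> walker P' r"
      then have "walker P r = walker P' r"
        using inj_on_eq_iff[OF inj_left[of x], of "walker P r" "walker P' r"] walker_G by (simp add: \<P>_def)
      then show "P = P'" using walker_inj[of r] unfolding inj_def by blast
    qed
    have "(\<Sum>P\<in>\<P>. \<psi> (x \<otimes> walker P r)) = sum \<psi> ((\<lambda>P. x \<otimes> walker P r) ` \<P>)"
      by (simp add: sum.reindex[OF inj])
    also have "\<dots> = sum \<psi> (((\<lambda>P. x \<otimes> walker P r) ` \<P>) \<inter> F)"
      using \<P>(1) by (intro sum.mono_neutral_right) (auto simp: supp)
    also have "\<dots> \<le> sum \<psi> F" using F(1) nonneg by (intro sum_mono2) auto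
    finally show "(\<Sum>P\<in>\<P>. \<psi> (x \<otimes> walker P r)) \<le> sum \<psi> F" .
  qed
  also have "\<dots> = (\<Sum>x\<in>F. \<psi> x)\<^sup>2" by (simp add: sum_distrib_right[symmetric] power2_eq_square)
  also have "\<dots> \<le> card F * c"
    using sum_squared_le_sum_of_squares[where I = F and f = \<psi>] by (simp add: c_def corr_one mult.commute)
  finally have corr_sum: "(\<Sum>P\<in>\<P>. corr (walker P r)) \<le> card F * c" .
  have c0: "0 \<le> c" by (simp add: c_def corr_one sum_nonneg)
  \<comment> \<open>Cauchy-Schwarz and \<open>card\<close> bound the average correlation by half of
    \<open>c\<close>, so the average squared displacement is at least \<open>c\<close>.\<close>
  have "real (2 * card F) * c \<le> 2 ^ r * c"
    using of_nat_mono[OF card, where 'a = real] c0 by (intro mult_right_mono) simp_all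
  then have "2 ^ r * c \<le> 2 * (2 ^ r * c) - 2 * (card F * c)" by (simp add: mult.assoc mult.commute[of c])
  also have "\<dots> \<le> (\<Sum>P\<in>\<P>. 2 * (c - corr (walker P r)))"
  proof -
    have "(\<Sum>P\<in>\<P>. 2 * (c - corr (walker P r))) = 2 * (2 ^ r * c) - 2 * (\<Sum>P\<in>\<P>. corr (walker P r))"
      using \<P> by (simp add: sum_distrib_left[symmetric] sum_subtractf right_diff_distrib)
    then show ?thesis using corr_sum by simp
  qed
  also have "\<dots> \<le> (\<Sum>P\<in>\<P>. (real r * L)\<^sup>2 * (2 * Q))" by (rule sum_mono) (rule disp)
  also have "\<dots> = 2 ^ r * ((real r * L)\<^sup>2 * (2 * Q))" using \<P> by simp
  finally have "c \<le> (real r * L)\<^sup>2 * (2 * Q)" by simp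
  then show ?thesis unfolding Q_eq by (simp add: c_def corr_one algebra_simps)
qed

text \<open>Off-diagonal entries are nonpositive, so the energy drops when the eigenvector is
  replaced by its modulus and again when closed edges of the Cayley graph inside \<open>F\<close>
  are added. The diagonal stays \<open>card S\<close>, so \<open>faber_krahn\<close> applies to what
  remains.\<close>

lemma eigenvalue_lower_bound:
  assumes L: "\<And>P. P \<subseteq> {0..<int r} \<Longrightarrow> has_length (walker P r) (r * L)"
    and F: "finite F" "F \<subseteq> G" "2 * card F \<le> 2 ^ r"
    and a: "\<And>x y. a x y \<Longrightarrow> cay_adj m S x y"
    and eb: "eigenbasis (lap_A (card S) W a) F n e l" and "i < n"
  shows "1 \<le> 2 * (real r * L)\<^sup>2 * l i"
proof -
  define \<psi> where "\<psi> x = (if x \<in> F then \<bar>e i x\<bar> else 0)" for x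
  have lf: "lamplighter_function m S F \<psi>"
    by unfold_locales (use F in \<open>auto simp: \<psi>_def\<close>)
  have "dot F (e i) (e i) = 1" using eb \<open>i < n\<close> by (simp add: eigenbasis_def)
  then have norm: "(\<Sum>x\<in>F. (\<psi> x)\<^sup>2) = 1" by (simp add: dot_def \<psi>_def power2_eq_square)
  have "card S * (\<Sum>x\<in>F. (\<psi> x)\<^sup>2) - (\<Sum>x\<in>F. \<Sum>s\<in>S. \<psi> x * \<psi> (x \<otimes> s))
      \<le> (\<Sum>x\<in>F. e i x * (card S * e i x)) - (\<Sum>x\<in>F. e i x * (\<Sum>y\<in>F. (if a x y then 1 else 0) * e i y))"
  proof (rule diff_mono)
    show "real (card S) * (\<Sum>x\<in>F. (\<psi> x)\<^sup>2) \<le> (\<Sum>x\<in>F. e i x * (card S * e i x))"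
      by (simp add: sum_distrib_left \<psi>_def power2_eq_square algebra_simps)
    show "(\<Sum>x\<in>F. e i x * (\<Sum>y\<in>F. (if a x y then 1 else 0) * e i y)) \<le> (\<Sum>x\<in>F. \<Sum>s\<in>S. \<psi> x * \<psi> (x \<otimes> s))"
    proof (rule sum_mono)
      fix x assume x: "x \<in> F"
      then have xG: "x \<in> G" using F by auto
      have inj: "inj_on ((\<otimes>) x) S" by (rule inj_on_subset[OF inj_left]) (auto intro: S_G)
      have "e i x * (\<Sum>y\<in>F. (if a x y then 1 else 0) * e i y) = (\<Sum>y\<in>F. (if a x y then 1 else 0) * (e i x * e i y))"
        by (simp add: sum_distrib_left algebra_simps)
      also have "\<dots> \<le> (\<Sum>y\<in>F. (if y \<in> (\<otimes>) x ` S then 1 else 0) * (\<psi> x * \<psi> y))"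
      proof (rule sum_mono)
        fix y assume y: "y \<in> F"
        have "e i x * e i y \<le> \<psi> x * \<psi> y"
          using x y abs_ge_self[of "e i x * e i y"] by (simp add: \<psi>_def abs_mult)
        moreover have "y \<in> (\<otimes>) x ` S" if "a x y" using a[OF that] neighbours[OF xG] by blast
        ultimately show "(if a x y then 1 else 0) * (e i x * e i y) \<le> (if y \<in> (\<otimes>) x ` S then 1 else 0) * (\<psi> x * \<psi> y)"
          by (auto simp: \<psi>_def)
      qed
      also have "\<dots> = (\<Sum>y\<in>F \<inter> (\<otimes>) x ` S. \<psi> x * \<psi> y)"
        by (simp add: sum.inter_restrict[OF F(1)] if_distrib[of "\<lambda>t. t * _"] cong: if_cong)
      also have "\<dots> = (\<Sum>y\<in>(\<otimes>) x ` S. \<psi> x * \<psi> y)"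
        by (rule sum.mono_neutral_left) (auto simp: \<psi>_def finite_S)
      also have "\<dots> = (\<Sum>s\<in>S. \<psi> x * \<psi> (x \<otimes> s))" by (simp add: sum.reindex[OF inj])
      finally show "e i x * (\<Sum>y\<in>F. (if a x y then 1 else 0) * e i y) \<le> (\<Sum>s\<in>S. \<psi> x * \<psi> (x \<otimes> s))" .
    qed
  qed
  also have "\<dots> = dot F (e i) (matvec (lap_A (card S) W a) F (e i))"
  proof -
    have "matvec (lap_A (card S) W a) F (e i) x
        = card S * e i x - (\<Sum>y\<in>F. (if a x y then 1 else 0) * e i y)" if "x \<in> F" for x
    proof -
      have "matvec (lap_A (card S) W a) F (e i) x
        = (\<Sum>y\<in>F. if x = y then card S * e i y else 0) - (\<Sum>y\<in>F. (if a x y then 1 else 0) * e i y)"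
        unfolding matvec_def lap_A_def sum_subtractf[symmetric]
        by (intro sum.cong) (auto simp: algebra_simps)
      then show ?thesis using F(1) that by simp
    qed
    then show ?thesis by (simp add: dot_def right_diff_distrib sum_subtractf)
  qed
  also have "\<dots> = l i" by (rule eigenbasis_energy[OF eb \<open>i < n\<close>])
  finally have le: "card S * (\<Sum>x\<in>F. (\<psi> x)\<^sup>2) - (\<Sum>x\<in>F. \<Sum>s\<in>S. \<psi> x * \<psi> (x \<otimes> s)) \<le> l i" .
  have "1 \<le> 2 * (real r * L)\<^sup>2 * (card S * (\<Sum>x\<in>F. (\<psi> x)\<^sup>2) - (\<Sum>x\<in>F. \<Sum>s\<in>S. \<psi> x * \<psi> (x \<otimes> s)))"
    using faber_krahn[OF L lf F(3)] by (simp add: norm)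
  also have "\<dots> \<le> 2 * (real r * L)\<^sup>2 * l i" using le by (intro mult_left_mono) auto
  finally show ?thesis .
qed

end

section \<open>Percolation clusters and measurability\<close>

lemma pred_countable_Bex:
  assumes "countable X" "\<And>i. i \<in> X \<Longrightarrow> Measurable.pred N (\<lambda>x. P x i)"
  shows "Measurable.pred N (\<lambda>x. \<exists>i\<in>X. P x i)"
proof -
  have "{x \<in> space N. \<exists>i\<in>X. P x i} = (\<Union>i\<in>X. {x \<in> space N. P x i})" by auto
  also have "\<dots> \<in> sets N" using assms by (intro sets.countable_UN') (auto simp: pred_def)
  finally show ?thesis by (simp add: pred_def)
qed

lemma pred_countable_Ball:
  assumes "countable X" "\<And>i. i \<in> X \<Longrightarrow> Measurable.pred N (\<lambda>x. P x i)"
  shows "Measurable.pred N (\<lambda>x. \<forall>i\<in>X. P x i)"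
proof -
  have "Measurable.pred N (\<lambda>x. \<not> (\<exists>i\<in>X. \<not> P x i))"
    using assms by (intro pred_intros_logic(2) pred_countable_Bex)
  then show ?thesis by simp
qed

locale perc_graph = lamplighter_cayley +
  fixes model :: perc_model
begin

abbreviation I where "I \<equiv> perc_index model m S"
abbreviation adj where "adj \<equiv> perc_adj model m S"
abbreviation W where "W \<equiv> perc_V model m S"

text \<open>The indices that must be open for the step from \<open>x\<close> to \<open>y\<close>.
  This lets most arguments treat both models at once.\<close>

definition links :: "ll \<Rightarrow> ll \<Rightarrow> ll set set" where
  "links x y = (case model of Site \<Rightarrow> {{x}, {y}} | Bond \<Rightarrow> {{x, y}})"

lemma finite_links: "finite (links x y)"
  unfolding links_def by (cases model) simp_all

lemma links_I: "cay_adj m S x y \<Longrightarrow> e \<in> links x y \<Longrightarrow> e \<in> I"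
  unfolding links_def perc_index_def cay_edges_def
proof (cases model)
  case Site
  assume "cay_adj m S x y" "e \<in> (case model of Site \<Rightarrow> {{x}, {y}} | Bond \<Rightarrow> {{x, y}})"
  with Site show "e \<in> (case model of Site \<Rightarrow> (\<lambda>x. {x}) ` G | Bond \<Rightarrow> {{x, y} |x y. cay_adj m S x y})"
    using cay_adj_G[of x y] by auto
next
  case Bond
  assume "cay_adj m S x y" "e \<in> (case model of Site \<Rightarrow> {{x}, {y}} | Bond \<Rightarrow> {{x, y}})"
  with Bond show "e \<in> (case model of Site \<Rightarrow> (\<lambda>x. {x}) ` G | Bond \<Rightarrow> {{x, y} |x y. cay_adj m S x y})"
    by (simp only: perc_model.case mem_Collect_eq singleton_iff) blast
qed

lemma adj_iff: "adj \<omega> x y \<longleftrightarrow> cay_adj m S x y \<and> (\<forall>e\<in>links x y. \<omega> e)"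
  unfolding perc_adj_def links_def by (cases model) simp_all

text \<open>A description of the open vertices common to both models; in the bond model the symmetry
  of adjacency is used when \<open>x\<close> is the second endpoint.\<close>

lemma W_iff: "x \<in> W \<omega> \<longleftrightarrow> x \<in> G \<and> (\<exists>e\<in>I. x \<in> e \<and> \<omega> e)"
proof (cases model)
  case Site
  then show ?thesis by (simp add: perc_V_def perc_index_def)
next
  case Bond
  have "(\<exists>y. cay_adj m S x y \<and> \<omega> {x, y}) \<longleftrightarrow> (\<exists>e\<in>cay_edges m S. x \<in> e \<and> \<omega> e)"
  proof
    assume "\<exists>e\<in>cay_edges m S. x \<in> e \<and> \<omega> e"
    then obtain u v where uv: "cay_adj m S u v" "x \<in> {u, v}" "\<omega> {u, v}"
      unfolding cay_edges_def by blast
    have "x = u \<or> x = v" using uv(2) by simp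
    then show "\<exists>y. cay_adj m S x y \<and> \<omega> {x, y}"
    proof
      assume "x = u"
      then show ?thesis using uv by blast
    next
      assume "x = v"
      then have "cay_adj m S x u \<and> \<omega> {x, u}" using uv cay_adj_sym by (simp add: insert_commute)
      then show ?thesis by blast
    qed
  qed (unfold cay_edges_def, blast)
  with Bond show ?thesis by (simp add: perc_V_def perc_index_def)
qed

lemma index_finite: "e \<in> I \<Longrightarrow> finite e" and index_card: "e \<in> I \<Longrightarrow> card e \<le> 2"
  and index_nonempty: "e \<in> I \<Longrightarrow> e \<noteq> {}" and index_G: "e \<in> I \<Longrightarrow> e \<subseteq> G"
proof -
  assume "e \<in> I"
  then obtain x y where e: "e = {x, y}" "x \<in> G" "y \<in> G"
  proof (cases model)
    case Site
    then show ?thesis using \<open>e \<in> I\<close> that unfolding perc_index_def by force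
  next
    case Bond
    then show ?thesis using \<open>e \<in> I\<close> that cay_adj_G unfolding perc_index_def cay_edges_def by auto
  qed
  then show "finite e" "card e \<le> 2" "e \<noteq> {}" "e \<subseteq> G"
    using card_insert_le_m1[of 2 "{y}" x] by simp_all
qed

lemma adj_sym: "adj \<omega> x y \<Longrightarrow> adj \<omega> y x"
  unfolding adj_iff links_def using cay_adj_sym
  by (auto simp: insert_commute split: perc_model.splits)

lemma adj_cay: "adj \<omega> x y \<Longrightarrow> cay_adj m S x y"
  by (simp add: adj_iff)

lemma adj_G: "adj \<omega> x y \<Longrightarrow> y \<in> G"
  by (rule cay_adj_G(2)[OF adj_cay])

lemma adj_W: assumes "adj \<omega> x y" shows "y \<in> W \<omega>"
proof -
  have "\<exists>e\<in>links x y. y \<in> e" unfolding links_def by (cases model) simp_all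
  then obtain e where "e \<in> links x y" "y \<in> e" by blast
  then show ?thesis using assms links_I[of x y e] cay_adj_G(2)[of x y] unfolding W_iff adj_iff by blast
qed

lemma W_G: "W \<omega> \<subseteq> G"
proof
  fix x assume "x \<in> W \<omega>"
  then show "x \<in> G" by (simp add: W_iff)
qed

lemma finite_adj: "finite {y. adj \<omega> x y}"
  by (rule finite_subset[OF _ finite_neighbours[of x]]) (simp add: Collect_mono adj_cay)

lemma card_adj: "card {y. adj \<omega> x y} \<le> card S"
  by (rule order.trans[OF card_mono[OF finite_neighbours[of x]] card_neighbours]) (simp add: Collect_mono adj_cay)

lemma countable_G: "countable G"
proof -
  have "ll_gen m S \<subseteq> foldl (\<otimes>) ll_one ` lists S"
  proof
    fix g assume "g \<in> ll_gen m S"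
    then show "g \<in> foldl (\<otimes>) ll_one ` lists S"
    proof (induction rule: ll_gen.induct)
      case one
      show ?case by (rule image_eqI[of _ _ "[]"]) simp_all
    next
      case (step g s)
      then obtain w where w: "w \<in> lists S" "g = foldl (\<otimes>) ll_one w" by blast
      then have "g \<otimes> s = foldl (\<otimes>) ll_one (w @ [s])" "w @ [s] \<in> lists S"
        using step.hyps(2) by simp_all
      then show ?case by (rule image_eqI)
    qed
  qed
  moreover have "countable (foldl (\<otimes>) ll_one ` lists S)"
    using finite_S by (intro countable_image countable_lists countable_finite)
  ultimately have "countable (ll_gen m S)" by (rule countable_subset)
  moreover have "G \<subseteq> ll_gen m S" using G_gen by blast
  ultimately show ?thesis using countable_subset by blast
qed

lemma countable_I: "countable I"
proof -
  have "I \<subseteq> {e. finite e \<and> e \<subseteq> G}" using index_finite index_G by blast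
  then show ?thesis
    using countable_Collect_finite_subset[OF countable_G] by (rule countable_subset)
qed

definition hamiltonian :: "lap_kind \<Rightarrow> (ll set \<Rightarrow> bool) \<Rightarrow> ll \<Rightarrow> ll \<Rightarrow> real" where
  "hamiltonian lk \<omega> = (case lk of LapA \<Rightarrow> lap_A (card S) (W \<omega>) (adj \<omega>) | LapD \<Rightarrow> lap_D (card S) (W \<omega>) (adj \<omega>))"

abbreviation ham_pow where "ham_pow lk \<omega> \<equiv> mpow (hamiltonian lk \<omega>) (W \<omega>) (adj \<omega>)"

abbreviation percolates where "percolates \<omega> \<equiv> has_inf_cluster (W \<omega>) (adj \<omega>)"

lemma deg_bounds: "0 \<le> deg (W \<omega>) (adj \<omega>) x" "deg (W \<omega>) (adj \<omega>) x \<le> card S"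
proof -
  have "{y \<in> W \<omega>. adj \<omega> x y} = {y. adj \<omega> x y}" using adj_W by blast
  then show "0 \<le> deg (W \<omega>) (adj \<omega>) x" "deg (W \<omega>) (adj \<omega>) x \<le> card S"
    using card_adj by (simp_all add: deg_def)
qed

text \<open>The diagonal contributes at most twice \<open>card S\<close>, the largest case being
  \<open>LapD\<close> at a vertex of degree 0, and the neighbours at most \<open>card S\<close>
  more.\<close>

lemma local_operator_hamiltonian:
  "local_operator (hamiltonian lk \<omega>) (W \<omega>) (adj \<omega>) (3 * card S)"
proof
  fix x y V
  show "hamiltonian lk \<omega> x y = hamiltonian lk \<omega> y x"
    using adj_sym by (cases lk) (auto simp: hamiltonian_def lap_A_def lap_D_def)
  show "hamiltonian lk \<omega> x y = 0" if "y \<noteq> x" "\<not> adj \<omega> x y"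
    using that by (cases lk) (simp_all add: hamiltonian_def lap_A_def lap_D_def)
  show "(\<Sum>y\<in>V. \<bar>hamiltonian lk \<omega> x y\<bar>) \<le> 3 * card S" if V: "finite V"
  proof -
    have "(\<Sum>y\<in>V. \<bar>hamiltonian lk \<omega> x y\<bar>) \<le> (\<Sum>y\<in>V. (if x = y then 2 * real (card S) else 0) + of_bool (adj \<omega> x y))"
      using deg_bounds[of \<omega> x]
      by (intro sum_mono, cases lk) (auto simp: hamiltonian_def lap_A_def lap_D_def)
    also have "\<dots> \<le> 2 * card S + real (card (V \<inter> {y. adj \<omega> x y}))"
      using V by (simp add: sum.distrib)
    also have "card (V \<inter> {y. adj \<omega> x y}) \<le> card S"
      using card_mono[OF finite_adj, of "V \<inter> {y. adj \<omega> x y}" \<omega> x] card_adj[of \<omega> x] by simp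
    finally show ?thesis by simp
  qed
qed (simp_all add: adj_sym adj_W finite_adj)

abbreviation cdf_at :: "lap_kind \<Rightarrow> real \<Rightarrow> ll \<Rightarrow> (ll set \<Rightarrow> bool) \<Rightarrow> real" where
  "cdf_at lk E x \<omega> \<equiv> spec_cdf (hamiltonian lk \<omega>) (W \<omega>) (adj \<omega>) x E"

lemma ids_integrand_eq: "ids_integrand lk model m S E = cdf_at lk E ll_one"
  by (simp add: ids_integrand_def hamiltonian_def fun_eq_iff Let_def)

definition cluster :: "(ll set \<Rightarrow> bool) \<Rightarrow> ll \<Rightarrow> ll set" where
  "cluster \<omega> x = {y. (adj \<omega>)\<^sup>*\<^sup>* x y}"

lemma cluster_self: "x \<in> cluster \<omega> x"
  by (simp add: cluster_def)

lemma cluster_G: "x \<in> G \<Longrightarrow> cluster \<omega> x \<subseteq> G"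
proof
  fix y assume "x \<in> G" "y \<in> cluster \<omega> x"
  then have "(adj \<omega>)\<^sup>*\<^sup>* x y" by (simp add: cluster_def)
  then show "y \<in> G" by cases (use \<open>x \<in> G\<close> adj_G in blast)+
qed

lemma cluster_W: assumes "x \<in> W \<omega>" shows "cluster \<omega> x \<subseteq> W \<omega>"
proof
  fix y assume "y \<in> cluster \<omega> x"
  then have "(adj \<omega>)\<^sup>*\<^sup>* x y" by (simp add: cluster_def)
  then show "y \<in> W \<omega>" by cases (use assms adj_W in blast)+
qed

lemma cluster_eq: assumes "y \<in> cluster \<omega> x" shows "cluster \<omega> y = cluster \<omega> x"
proof -
  have "symp (adj \<omega>)\<^sup>*\<^sup>*" using adj_sym by (intro symp_rtranclp sympI)
  then show ?thesis using assms unfolding cluster_def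
    by (auto dest: sympD intro: rtranclp_trans)
qed

end

locale percolation = perc_graph +
  fixes p :: real
  assumes p: "0 \<le> p" "p \<le> 1"
begin

abbreviation M where "M \<equiv> perc_space model m S p"

sublocale prod: product_prob_space "\<lambda>_. measure_pmf (bernoulli_pmf p)" I
  by unfold_locales

sublocale prob_space M
  unfolding perc_space_def by (rule prod.prob_space_axioms)

lemma measurable_index [measurable (raw)]: "e \<in> I \<Longrightarrow> Measurable.pred M (\<lambda>\<omega>. \<omega> e)"
  unfolding perc_space_def using measurable_component_singleton[of e I "\<lambda>_. measure_pmf (bernoulli_pmf p)"]
  by (simp cong: measurable_cong_sets)

lemma measurable_adj [measurable]: "Measurable.pred M (\<lambda>\<omega>. adj \<omega> x y)"
proof (cases "cay_adj m S x y")
  case True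
  have "Measurable.pred M (\<lambda>\<omega>. \<forall>e\<in>links x y. \<omega> e)"
    using finite_links links_I[OF True] by (intro pred_intros_finite measurable_index)
  then show ?thesis using True by (simp add: adj_iff)
qed (simp add: adj_iff)

lemma measurable_W [measurable]: "Measurable.pred M (\<lambda>\<omega>. x \<in> W \<omega>)"
proof -
  have "Measurable.pred M (\<lambda>\<omega>. \<exists>e\<in>{e \<in> I. x \<in> e}. \<omega> e)"
    using countable_I by (intro pred_countable_Bex measurable_index) (auto intro: countable_subset[rotated])
  then have "Measurable.pred M (\<lambda>\<omega>. x \<in> G \<and> (\<exists>e\<in>{e \<in> I. x \<in> e}. \<omega> e))" by measurable
  moreover have "x \<in> W \<omega> \<longleftrightarrow> x \<in> G \<and> (\<exists>e\<in>{e \<in> I. x \<in> e}. \<omega> e)" for \<omega>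
    unfolding W_iff by blast
  ultimately show ?thesis by presburger
qed

lemma measurable_relpowp: "Measurable.pred M (\<lambda>\<omega>. (adj \<omega> ^^ n) x y)"
proof (induction n arbitrary: y)
  case (Suc n)
  have "(adj \<omega> ^^ Suc n) x y \<longleftrightarrow> (\<exists>z\<in>G. (adj \<omega> ^^ n) x z \<and> adj \<omega> z y)" for \<omega>
    unfolding relpowp.simps relcompp_apply using cay_adj_G(1) adj_cay by blast
  moreover have "Measurable.pred M (\<lambda>\<omega>. \<exists>z\<in>G. (adj \<omega> ^^ n) x z \<and> adj \<omega> z y)"
    by (intro pred_countable_Bex countable_G pred_intros_logic Suc measurable_adj)
  ultimately show ?case by simp
qed simp

lemma measurable_cluster [measurable]: "Measurable.pred M (\<lambda>\<omega>. y \<in> cluster \<omega> x)"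
  unfolding cluster_def mem_Collect_eq rtranclp_power
  by (intro pred_intros_countable measurable_relpowp)

text \<open>Infinite means escaping each of the countably many finite subsets of the group.\<close>

lemma measurable_infinite_cluster [measurable]:
  assumes "x \<in> G" shows "Measurable.pred M (\<lambda>\<omega>. infinite (cluster \<omega> x))"
proof -
  have "infinite (cluster \<omega> x) \<longleftrightarrow> (\<forall>F\<in>{F. finite F \<and> F \<subseteq> G}. \<exists>y\<in>G - F. y \<in> cluster \<omega> x)" for \<omega>
  proof
    assume inf: "infinite (cluster \<omega> x)"
    show "\<forall>F\<in>{F. finite F \<and> F \<subseteq> G}. \<exists>y\<in>G - F. y \<in> cluster \<omega> x"
    proof
      fix F assume "F \<in> {F. finite F \<and> F \<subseteq> G}"
      then have "\<not> cluster \<omega> x \<subseteq> F" using inf finite_subset by blast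
      then show "\<exists>y\<in>G - F. y \<in> cluster \<omega> x" using cluster_G[OF assms] by blast
    qed
  next
    assume *: "\<forall>F\<in>{F. finite F \<and> F \<subseteq> G}. \<exists>y\<in>G - F. y \<in> cluster \<omega> x"
    show "infinite (cluster \<omega> x)"
    proof
      assume "finite (cluster \<omega> x)"
      then show False using * cluster_G[OF assms, of \<omega>] by blast
    qed
  qed
  moreover have "Measurable.pred M (\<lambda>\<omega>. \<forall>F\<in>{F. finite F \<and> F \<subseteq> G}. \<exists>y\<in>G - F. y \<in> cluster \<omega> x)"
    by (intro pred_countable_Ball pred_countable_Bex countable_Collect_finite_subset countable_Diff countable_G
        measurable_cluster)
  ultimately show ?thesis by simp
qed

lemma measurable_has_inf_cluster: "Measurable.pred M (\<lambda>\<omega>. percolates \<omega>)"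
proof -
  have "percolates \<omega> \<longleftrightarrow> (\<exists>x\<in>G. x \<in> W \<omega> \<and> infinite (cluster \<omega> x))" for \<omega>
    using W_G[of \<omega>] unfolding has_inf_cluster_def cluster_def by blast
  moreover have "Measurable.pred M (\<lambda>\<omega>. \<exists>x\<in>G. x \<in> W \<omega> \<and> infinite (cluster \<omega> x))"
    by (intro pred_countable_Bex countable_G pred_intros_logic measurable_W measurable_infinite_cluster)
  ultimately show ?thesis by simp
qed

lemma measurable_deg [measurable]: "(\<lambda>\<omega>. deg (W \<omega>) (adj \<omega>) x) \<in> borel_measurable M"
proof -
  have "deg (W \<omega>) (adj \<omega>) x = (\<Sum>y\<in>{y. cay_adj m S x y}. of_bool (adj \<omega> x y))" for \<omega>
  proof -
    have "{y \<in> W \<omega>. adj \<omega> x y} = {y. cay_adj m S x y} \<inter> {y. adj \<omega> x y}" using adj_W adj_cay by blast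
    then show ?thesis unfolding deg_def using finite_neighbours[of x] by simp
  qed
  then show ?thesis by simp
qed

lemma measurable_hamiltonian [measurable]: "(\<lambda>\<omega>. hamiltonian lk \<omega> x y) \<in> borel_measurable M"
  unfolding hamiltonian_def lap_A_def lap_D_def by (cases lk) simp_all

lemma measurable_mpow: "(\<lambda>\<omega>. ham_pow lk \<omega> n x y) \<in> borel_measurable M"
proof (induction n arbitrary: x)
  case (Suc n)
  let ?N = "insert x {z. cay_adj m S x z}"
  have "ham_pow lk \<omega> (Suc n) x y
    = (\<Sum>z\<in>?N. if z \<in> W \<omega> \<and> (z = x \<or> adj \<omega> x z)
        then hamiltonian lk \<omega> x z * ham_pow lk \<omega> n z y else 0)" for \<omega>
  proof -
    have *: "{z \<in> W \<omega>. z = x \<or> adj \<omega> x z} = {z \<in> ?N. z \<in> W \<omega> \<and> (z = x \<or> adj \<omega> x z)}"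
      using adj_cay by blast
    have "finite ?N" using finite_neighbours[of x] by simp
    then show ?thesis unfolding mpow.simps * by (rule sum.inter_filter)
  qed
  moreover have "(\<lambda>\<omega>. \<Sum>z\<in>?N. if z \<in> W \<omega> \<and> (z = x \<or> adj \<omega> x z)
        then hamiltonian lk \<omega> x z * ham_pow lk \<omega> n z y else 0) \<in> borel_measurable M"
    using Suc by measurable
  ultimately show ?case by presburger
qed simp

text \<open>The support radius is the same for all configurations, so one choice of coefficients
  expresses the distribution function as a pointwise limit of combinations of \<open>mpow\<close>
  entries, which are measurable.\<close>

lemma measurable_cdf_at [measurable]: "cdf_at lk E x \<in> borel_measurable M"
proof -
  define C where "C = real (3 * card S)"
  obtain a :: "nat \<Rightarrow> nat \<Rightarrow> real" and d where ad: "\<And>\<mu>. supported_measure C \<mu> \<Longrightarrow>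
      (\<lambda>j. \<Sum>i\<le>d j. a j i * (\<integral>t. t ^ i \<partial>\<mu>)) \<longlonglongrightarrow> measure \<mu> {..E}"
    using cdf_from_moments[of C E] by blast
  show ?thesis
  proof (rule borel_measurable_LIMSEQ_real)
    fix \<omega>
    interpret local_operator "hamiltonian lk \<omega>" "W \<omega>" "adj \<omega>" C
      unfolding C_def by (rule local_operator_hamiltonian)
    show "(\<lambda>j. if x \<in> W \<omega> then \<Sum>i\<le>d j. a j i * ham_pow lk \<omega> i x x else 0)
        \<longlonglongrightarrow> cdf_at lk E x \<omega>"
    proof (cases "x \<in> W \<omega>")
      case True
      then obtain \<mu> where \<mu>: "moment_measure x \<mu>" using moment_measure_exists by blast
      then show ?thesis
        using ad[of \<mu>] True by (simp add: moment_measure_def spec_cdf_eq[OF True \<mu>])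
    qed (simp add: spec_cdf_def)
  next
    show "(\<lambda>\<omega>. if x \<in> W \<omega> then \<Sum>i\<le>d j. a j i * ham_pow lk \<omega> i x x else 0)
        \<in> borel_measurable M" for j
      using measurable_mpow by measurable
  qed
qed

lemma cdf_at_bounds: "0 \<le> cdf_at lk E x \<omega>" "cdf_at lk E x \<omega> \<le> 1"
  using local_operator.spec_cdf_bounds[OF local_operator_hamiltonian] by auto

lemma integrable_cdf_at: "integrable M (cdf_at lk E x)"
  by (rule integrable_const_bound[of _ 1]) (use cdf_at_bounds in \<open>auto simp: abs_of_nonneg\<close>)

end

section \<open>Clusters as site percolation on the index set\<close>

lemma reach_insert_self: "y \<in> A \<Longrightarrow> reach R (insert y X) A = reach R X A"
proof
  assume "y \<in> A"
  then show "reach R (insert y X) A \<subseteq> reach R X A"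
    using reach_self[of A R X] by (intro reach_least) (auto intro: reach_step)
qed (rule reach_mono, auto)

text \<open>A finite part of a cluster is witnessed by finitely many finite paths, hence already
  within one window.\<close>

lemma reach_exhaustion:
  assumes "incseq U" "F \<subseteq> reach R X A" "finite F" "X \<subseteq> (\<Union>j. U j)"
  shows "\<exists>j. F \<subseteq> reach R (X \<inter> U j) A"
proof -
  have mono: "reach R (X \<inter> U i) A \<subseteq> reach R (X \<inter> U j) A" if "i \<le> j" for i j
    using assms(1) that by (intro reach_mono) (auto simp: incseq_def)
  have "reach R X A \<subseteq> (\<Union>j. reach R (X \<inter> U j) A)"
  proof (rule reach_least)
    show "A \<subseteq> (\<Union>j. reach R (X \<inter> U j) A)" using reach_self[of A] by blast
    fix u v assume "u \<in> (\<Union>j. reach R (X \<inter> U j) A)" "v \<in> X" "R u v"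
    then obtain i j where ij: "u \<in> reach R (X \<inter> U i) A" "v \<in> U j" using assms(4) by blast
    have "u \<in> reach R (X \<inter> U (max i j)) A" "v \<in> U (max i j)"
      using ij mono[of i "max i j"] incseqD[OF assms(1), of j "max i j"] by auto
    then show "v \<in> (\<Union>j. reach R (X \<inter> U j) A)" using \<open>v \<in> X\<close> \<open>R u v\<close> by (blast intro: reach_step)
  qed
  with assms(2) have "F \<subseteq> (\<Union>j. reach R (X \<inter> U j) A)" by blast
  with assms(3) show ?thesis
  proof (induction F rule: finite_induct)
    case (insert x F)
    then obtain i j where "F \<subseteq> reach R (X \<inter> U i) A" "x \<in> reach R (X \<inter> U j) A" by auto
    then have "insert x F \<subseteq> reach R (X \<inter> U (max i j)) A"
      using mono[of i "max i j"] mono[of j "max i j"] by auto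
    then show ?case by blast
  qed simp
qed

text \<open>An infinite set has \<open>card\<close> 0, so infinite clusters have to be included
  explicitly.\<close>

definition at_least :: "nat \<Rightarrow> 'a set \<Rightarrow> bool" where
  "at_least n A \<longleftrightarrow> infinite A \<or> n \<le> card A"

lemma at_least_superset: "n \<le> card A \<Longrightarrow> A \<subseteq> B \<Longrightarrow> at_least n B"
  unfolding at_least_def using card_mono[of B A] by linarith

lemma at_least_reach_iff:
  assumes "incseq U" "\<And>j. finite (U j)" "finite A" "X \<subseteq> (\<Union>j. U j)"
  shows "at_least n (reach R X A) \<longleftrightarrow> (\<exists>j. n \<le> card (reach R (X \<inter> U j) A))"
proof
  assume "at_least n (reach R X A)"
  then obtain F where F: "F \<subseteq> reach R X A" "finite F" "card F = n"
    unfolding at_least_def by (metis infinite_arbitrarily_large obtain_subset_with_card_n)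
  obtain j where j: "F \<subseteq> reach R (X \<inter> U j) A" using reach_exhaustion[OF assms(1) F(1,2) assms(4)] by blast
  have "finite (reach R (X \<inter> U j) A)" using assms by (intro finite_reach) auto
  then show "\<exists>j. n \<le> card (reach R (X \<inter> U j) A)" using card_mono[OF _ j] F(3) by blast
next
  assume "\<exists>j. n \<le> card (reach R (X \<inter> U j) A)"
  then obtain j where j: "n \<le> card (reach R (X \<inter> U j) A)" by blast
  have "reach R (X \<inter> U j) A \<subseteq> reach R X A" by (rule reach_mono) auto
  with j show "at_least n (reach R X A)" by (rule at_least_superset)
qed

context perc_graph
begin

text \<open>The graph on indices whose site percolation has essentially the given clusters: the
  Cayley graph itself in the site model, its line graph with loops in the bond model.\<close>

definition touching :: "ll set \<Rightarrow> ll set \<Rightarrow> bool" where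
  "touching e e' \<longleftrightarrow> (case model of
      Site \<Rightarrow> (\<exists>x y. e = {x} \<and> e' = {y} \<and> cay_adj m S x y) | Bond \<Rightarrow> e \<inter> e' \<noteq> {})"

definition opens :: "(ll set \<Rightarrow> bool) \<Rightarrow> ll set set" where
  "opens \<omega> = {e \<in> I. \<omega> e}"

abbreviation index_cluster :: "(ll set \<Rightarrow> bool) \<Rightarrow> ll set \<Rightarrow> ll set set" where
  "index_cluster \<omega> e \<equiv> reach touching (opens \<omega>) {e}"

lemma index_Site: "model = Site \<Longrightarrow> e \<in> I \<longleftrightarrow> (\<exists>x\<in>G. e = {x})"
  unfolding perc_index_def by (simp add: image_iff)

lemma index_Bond: "model = Bond \<Longrightarrow> e \<in> I \<longleftrightarrow> (\<exists>x y. e = {x, y} \<and> cay_adj m S x y)"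
  unfolding perc_index_def cay_edges_def by simp

lemma adj_Site: "model = Site \<Longrightarrow> adj \<omega> x y \<longleftrightarrow> cay_adj m S x y \<and> \<omega> {x} \<and> \<omega> {y}"
  by (simp add: perc_adj_def)

lemma adj_Bond: "model = Bond \<Longrightarrow> adj \<omega> x y \<longleftrightarrow> cay_adj m S x y \<and> \<omega> {x, y}"
  by (simp add: perc_adj_def)

lemma touching_Site: "model = Site \<Longrightarrow> touching e e' \<longleftrightarrow> (\<exists>x y. e = {x} \<and> e' = {y} \<and> cay_adj m S x y)"
  unfolding touching_def by simp

lemma touching_Bond: "model = Bond \<Longrightarrow> touching e e' \<longleftrightarrow> e \<inter> e' \<noteq> {}"
  unfolding touching_def by simp

lemma opens_I: "e \<in> opens \<omega> \<Longrightarrow> e \<in> I" and opens_open: "e \<in> opens \<omega> \<Longrightarrow> \<omega> e"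
  by (simp_all add: opens_def)

lemma opens_connected:
  assumes "e \<in> opens \<omega>" "v \<in> e" "v' \<in> e"
  shows "(adj \<omega>)\<^sup>*\<^sup>* v v'"
proof (cases model)
  case Site
  obtain x where "e = {x}" using index_Site[OF Site, of e] opens_I[OF assms(1)] by blast
  then have "v = v'" using assms by simp
  then show ?thesis by simp
next
  case Bond
  obtain x y where xy: "e = {x, y}" "cay_adj m S x y"
    using index_Bond[OF Bond, of e] opens_I[OF assms(1)] by blast
  have "adj \<omega> x y" using adj_Bond[OF Bond] opens_open[OF assms(1)] xy by simp
  then have "adj \<omega> x y" "adj \<omega> y x" using adj_sym by blast+
  moreover have "v = x \<or> v = y" "v' = x \<or> v' = y" using assms(2,3) xy(1) by simp_all
  ultimately show ?thesis by (elim disjE) simp_all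
qed

lemma touching_connected:
  assumes "e \<in> opens \<omega>" "e' \<in> opens \<omega>" "touching e e'"
  shows "\<exists>v\<in>e. \<exists>v'\<in>e'. (adj \<omega>)\<^sup>*\<^sup>* v v'"
proof (cases model)
  case Site
  obtain x y where xy: "e = {x}" "e' = {y}" "cay_adj m S x y"
    using assms(3) touching_Site[OF Site] by blast
  then have "adj \<omega> x y"
    using adj_Site[OF Site] opens_open[OF assms(1)] opens_open[OF assms(2)] by simp
  then show ?thesis using xy by blast
next
  case Bond
  then have "e \<inter> e' \<noteq> {}" using assms(3) touching_Bond by blast
  then show ?thesis by blast
qed

lemma reach_touching_connected:
  assumes "e \<in> opens \<omega>" "v \<in> e"
  shows "index_cluster \<omega> e \<subseteq> opens \<omega> \<inter> Pow (cluster \<omega> v)"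
proof (rule reach_least)
  show "{e} \<subseteq> opens \<omega> \<inter> Pow (cluster \<omega> v)"
    using assms opens_connected[OF assms] unfolding cluster_def by blast
  fix u w assume u: "u \<in> opens \<omega> \<inter> Pow (cluster \<omega> v)" and w: "w \<in> opens \<omega>" "touching u w"
  then obtain z z' where z: "z \<in> u" "z' \<in> w" "(adj \<omega>)\<^sup>*\<^sup>* z z'" using touching_connected[of u \<omega> w] by blast
  have vz: "(adj \<omega>)\<^sup>*\<^sup>* v z" using u z(1) unfolding cluster_def by blast
  have "(adj \<omega>)\<^sup>*\<^sup>* v y" if "y \<in> w" for y
    using vz z(3) opens_connected[OF w(1) z(2) that] by (meson rtranclp_trans)
  then show "w \<in> opens \<omega> \<inter> Pow (cluster \<omega> v)" using w(1) unfolding cluster_def by blast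
qed

lemma adj_touching:
  assumes "adj \<omega> x y" "e \<in> opens \<omega>" "x \<in> e"
  shows "\<exists>e'\<in>opens \<omega>. y \<in> e' \<and> touching e e'"
proof (cases model)
  case Site
  have e: "e = {x}" using index_Site[OF Site, of e] opens_I[OF assms(2)] assms(3) by blast
  have xy: "cay_adj m S x y" "\<omega> {y}" using assms(1) adj_Site[OF Site] by blast+
  have "{y} \<in> opens \<omega>"
    using cay_adj_G(2)[OF xy(1)] xy(2) index_Site[OF Site, of "{y}"] unfolding opens_def by blast
  moreover have "touching e {y}" using touching_Site[OF Site] e xy(1) by blast
  ultimately show ?thesis by blast
next
  case Bond
  have xy: "cay_adj m S x y" "\<omega> {x, y}" using assms(1) adj_Bond[OF Bond] by blast+
  then have "{x, y} \<in> opens \<omega>" using index_Bond[OF Bond, of "{x, y}"] unfolding opens_def by blast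
  moreover have "touching e {x, y}" using touching_Bond[OF Bond] assms(3) by blast
  ultimately show ?thesis by blast
qed

lemma cluster_subset_reach:
  assumes "e \<in> opens \<omega>" "v \<in> e"
  shows "cluster \<omega> v \<subseteq> \<Union> (index_cluster \<omega> e)"
proof
  fix y assume "y \<in> cluster \<omega> v"
  then have "(adj \<omega>)\<^sup>*\<^sup>* v y" by (simp add: cluster_def)
  then show "y \<in> \<Union> (index_cluster \<omega> e)"
  proof (induction rule: rtranclp_induct)
    case base
    then show ?case using assms reach_self[of "{e}" touching "opens \<omega>"] by blast
  next
    case (step y z)
    then obtain e' where e': "e' \<in> index_cluster \<omega> e" "y \<in> e'" by blast
    have "e' \<in> opens \<omega>" using e'(1) reach_touching_connected[OF assms] by blast
    then obtain e'' where "e'' \<in> opens \<omega>" "z \<in> e''" "touching e' e''"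
      using adj_touching[OF step.hyps(2) _ e'(2)] by blast
    then show ?case using reach_step[OF e'(1)] by blast
  qed
qed

text \<open>Each index covers at most two vertices; this is the source of the factor 2 in all size
  comparisons.\<close>

lemma at_least_cluster_reach:
  assumes "e \<in> opens \<omega>" "v \<in> e" "at_least (2 * n) (cluster \<omega> v)"
  shows "at_least n (index_cluster \<omega> e)"
proof (rule ccontr)
  let ?R = "index_cluster \<omega> e"
  assume "\<not> at_least n ?R"
  then have R: "finite ?R" "card ?R < n" by (simp_all add: at_least_def)
  have RI: "?R \<subseteq> I" using reach_touching_connected[OF assms(1,2)] by (auto simp: opens_def)
  have fin: "finite (\<Union>?R)" using R(1) RI index_finite by blast
  have "card (cluster \<omega> v) \<le> card (\<Union>?R)"
    by (rule card_mono[OF fin cluster_subset_reach[OF assms(1,2)]])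
  also have "\<dots> \<le> (\<Sum>e\<in>?R. card e)" by (rule card_Union_le_sum_card)
  also have "\<dots> \<le> card ?R * 2"
    using sum_bounded_above[of ?R card 2] RI index_card by (simp add: subset_eq)
  also have "\<dots> < 2 * n" using R(2) by simp
  finally have "card (cluster \<omega> v) < 2 * n" .
  moreover have "finite (cluster \<omega> v)"
    by (rule finite_subset[OF cluster_subset_reach[OF assms(1,2)] fin])
  ultimately show False using assms(3) by (simp add: at_least_def)
qed

lemma image_index:
  assumes g: "g \<in> G" and e: "e \<in> I"
  shows "(\<otimes>) g ` e \<in> I"
proof (cases model)
  case Site
  obtain x where "x \<in> G" "e = {x}" using index_Site[OF Site, of e] e by blast
  then have "(\<otimes>) g ` e = {g \<otimes> x}" "g \<otimes> x \<in> G" using mult_G[OF g] by simp_all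
  then show ?thesis using index_Site[OF Site, of "(\<otimes>) g ` e"] by blast
next
  case Bond
  obtain x y where xy: "e = {x, y}" "cay_adj m S x y" using index_Bond[OF Bond, of e] e by blast
  have "cay_adj m S (g \<otimes> x) (g \<otimes> y)"
    using cay_adj_translate[OF g cay_adj_G[OF xy(2)]] xy(2) by simp
  moreover have "(\<otimes>) g ` e = {g \<otimes> x, g \<otimes> y}" using xy(1) by simp
  ultimately show ?thesis using index_Bond[OF Bond, of "(\<otimes>) g ` e"] by blast
qed

lemma inj_image_index: "inj_on (image ((\<otimes>) g)) I"
  by (rule inj_on_subset[OF inj_on_image_Pow[OF inj_left[of g]]]) (use index_G in blast)

lemma touching_image:
  assumes "g \<in> G" "e \<in> I" "e' \<in> I"
  shows "touching ((\<otimes>) g ` e) ((\<otimes>) g ` e') \<longleftrightarrow> touching e e'"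
proof (cases model)
  case Site
  obtain x where "e = {x}" "x \<in> G" using assms(2) index_Site[OF Site, of e] by blast
  moreover obtain y where "e' = {y}" "y \<in> G" using assms(3) index_Site[OF Site, of e'] by blast
  ultimately have "e = {x}" "e' = {y}" "x \<in> G" "y \<in> G" by simp_all
  moreover have "touching {u} {v} \<longleftrightarrow> cay_adj m S u v" for u v
    using touching_Site[OF Site, of "{u}" "{v}"] by blast
  ultimately show ?thesis using cay_adj_translate[OF assms(1)] by simp
next
  case Bond
  have "(\<otimes>) g ` e \<inter> (\<otimes>) g ` e' = (\<otimes>) g ` (e \<inter> e')"
    by (rule inj_on_image_Int[OF inj_left index_G[OF assms(2)] index_G[OF assms(3)], symmetric])
  then show ?thesis unfolding touching_Bond[OF Bond] by (simp only: image_is_empty)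
qed

lemma finite_incident: "finite {e \<in> I. x \<in> e}"
proof -
  have "{e \<in> I. x \<in> e} \<subseteq> insert {x} ((\<lambda>y. {x, y}) ` {y. cay_adj m S x y})"
  proof
    fix e assume "e \<in> {e \<in> I. x \<in> e}"
    then have e: "e \<in> I" "x \<in> e" by auto
    show "e \<in> insert {x} ((\<lambda>y. {x, y}) ` {y. cay_adj m S x y})"
    proof (cases model)
      case Site
      show ?thesis using e index_Site[OF Site, of e] by blast
    next
      case Bond
      obtain u v where uv: "e = {u, v}" "cay_adj m S u v" using e(1) index_Bond[OF Bond, of e] by blast
      have "x = u \<or> x = v" using e(2) uv(1) by simp
      then show ?thesis
      proof
        assume "x = v"
        then have "e = {x, u}" "cay_adj m S x u" using uv cay_adj_sym by (simp_all add: insert_commute)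
        then show ?thesis by blast
      qed (use uv in blast)
    qed
  qed
  then show ?thesis by (rule finite_subset) (simp add: finite_neighbours)
qed

lemma index_exhaustion:
  "\<exists>U :: nat \<Rightarrow> ll set set. incseq U \<and> (\<forall>j. finite (U j)) \<and> (\<Union>j. U j) = I"
proof (intro exI conjI allI)
  define U where "U j = {e \<in> I. to_nat_on I e < j}" for j
  show "incseq U" unfolding U_def by (intro monoI) auto
  show "finite (U j)" for j
  proof (rule finite_imageD)
    show "finite (to_nat_on I ` U j)" by (rule finite_subset[of _ "{..<j}"]) (auto simp: U_def)
    show "inj_on (to_nat_on I) (U j)"
      by (rule inj_on_subset[OF inj_on_to_nat_on[OF countable_I]]) (auto simp: U_def)
  qed
  show "(\<Union>j. U j) = I" unfolding U_def by auto
qed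

end

context percolation
begin

lemma prob_opens_eq:
  assumes U: "finite U" "U \<subseteq> I" "X \<subseteq> U"
  shows "{\<omega> \<in> space M. opens \<omega> \<inter> U = X} \<in> events"
    and "prob {\<omega> \<in> space M. opens \<omega> \<inter> U = X} = p ^ card X * (1 - p) ^ card (U - X)"
proof -
  let ?A = "{\<omega> \<in> space M. \<forall>e\<in>U. \<omega> e \<in> {e \<in> X}}"
  have eq: "{\<omega> \<in> space M. opens \<omega> \<inter> U = X} = ?A"
    using U unfolding opens_def by blast
  have "Measurable.pred M (\<lambda>\<omega>. \<forall>e\<in>U. \<omega> e = (e \<in> X))"
    by (intro pred_intros_finite(3) U(1) pred_intros_logic measurable_index) (use U(2) in auto)
  then show "{\<omega> \<in> space M. opens \<omega> \<inter> U = X} \<in> events" unfolding eq by (simp add: pred_def)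
  have "emeasure M ?A = (\<Prod>e\<in>U. emeasure (measure_pmf (bernoulli_pmf p)) {e \<in> X})"
    unfolding perc_space_def by (rule prod.emeasure_PiM_Collect[OF U(2,1)]) simp
  also have "\<dots> = (\<Prod>e\<in>U. ennreal (if e \<in> X then p else 1 - p))"
    using p by (intro prod.cong refl) (simp add: emeasure_pmf_single)
  also have "\<dots> = ennreal (\<Prod>e\<in>U. if e \<in> X then p else 1 - p)"
    using p by (intro prod_ennreal) auto
  also have "(\<Prod>e\<in>U. if e \<in> X then p else 1 - p) = p ^ card X * (1 - p) ^ card (U - X)"
    using U by (subst prod.If_cases) (auto simp: Int_absorb1 Diff_eq Collect_neg_eq)
  finally show "prob {\<omega> \<in> space M. opens \<omega> \<inter> U = X} = p ^ card X * (1 - p) ^ card (U - X)"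
    using p by (simp add: eq measure_def)
qed

text \<open>The bridge from the infinite product measure to the finite sums \<open>bern_sum\<close>:
  decompose by the open set inside the window.\<close>

lemma prob_finite_window:
  assumes U: "finite U" "U \<subseteq> I"
  shows "{\<omega> \<in> space M. Q (opens \<omega> \<inter> U)} \<in> events"
    and "prob {\<omega> \<in> space M. Q (opens \<omega> \<inter> U)} = bern_sum p U (\<lambda>X. of_bool (Q X))"
proof -
  let ?D = "\<lambda>X. {\<omega> \<in> space M. opens \<omega> \<inter> U = X}"
  have eq: "{\<omega> \<in> space M. Q (opens \<omega> \<inter> U)} = (\<Union>X\<in>{X \<in> Pow U. Q X}. ?D X)" by auto
  have fin: "finite {X \<in> Pow U. Q X}" using U by simp
  show "{\<omega> \<in> space M. Q (opens \<omega> \<inter> U)} \<in> events"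
    unfolding eq using prob_opens_eq(1)[OF U] fin by (intro sets.finite_UN) auto
  have "prob (\<Union>X\<in>{X \<in> Pow U. Q X}. ?D X) = (\<Sum>X\<in>{X \<in> Pow U. Q X}. prob (?D X))"
    using prob_opens_eq(1)[OF U] by (intro finite_measure_finite_Union fin) (auto simp: disjoint_family_on_def)
  also have "\<dots> = (\<Sum>X\<in>{X \<in> Pow U. Q X}. p ^ card X * (1 - p) ^ card (U - X))"
    using prob_opens_eq(2)[OF U] by (intro sum.cong) auto
  also have "\<dots> = (\<Sum>X\<in>Pow U. if Q X then p ^ card X * (1 - p) ^ card (U - X) else 0)"
    by (rule sum.inter_filter) (simp add: U)
  also have "\<dots> = bern_sum p U (\<lambda>X. of_bool (Q X))"
    unfolding bern_sum_def by (intro sum.cong) auto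
  finally show "prob {\<omega> \<in> space M. Q (opens \<omega> \<inter> U)} = bern_sum p U (\<lambda>X. of_bool (Q X))"
    by (simp only: eq)
qed

lemma at_least_reach_limit:
  assumes "incseq U" "\<And>j. finite (U j)" "(\<Union>j. U j) = I"
  shows "{\<omega> \<in> space M. at_least n (index_cluster \<omega> e)} \<in> events"
    and "(\<lambda>j. prob {\<omega> \<in> space M. n \<le> card (reach touching (opens \<omega> \<inter> U j) {e})})
      \<longlonglongrightarrow> prob {\<omega> \<in> space M. at_least n (index_cluster \<omega> e)}"
proof -
  let ?A = "\<lambda>j. {\<omega> \<in> space M. n \<le> card (reach touching (opens \<omega> \<inter> U j) {e})}"
  have UI: "U j \<subseteq> I" for j using assms(3) by blast
  have "opens \<omega> \<subseteq> (\<Union>j. U j)" for \<omega> using assms(3) by (auto simp: opens_def)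
  then have eq: "{\<omega> \<in> space M. at_least n (index_cluster \<omega> e)} = (\<Union>j. ?A j)"
    using at_least_reach_iff[OF assms(1,2)] by auto
  have ev: "?A j \<in> events" for j by (rule prob_finite_window(1)[OF assms(2) UI])
  then show "{\<omega> \<in> space M. at_least n (index_cluster \<omega> e)} \<in> events" unfolding eq by auto
  have "incseq ?A"
  proof (intro monoI subsetI)
    fix i j :: nat and \<omega> assume "i \<le> j" "\<omega> \<in> ?A i"
    have "reach touching (opens \<omega> \<inter> U i) {e} \<subseteq> reach touching (opens \<omega> \<inter> U j) {e}"
      using assms(1) \<open>i \<le> j\<close> by (intro reach_mono) (auto simp: incseq_def)
    then have "card (reach touching (opens \<omega> \<inter> U i) {e}) \<le> card (reach touching (opens \<omega> \<inter> U j) {e})"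
      using assms(2) by (intro card_mono finite_reach) auto
    then show "\<omega> \<in> ?A j" using \<open>\<omega> \<in> ?A i\<close> by simp
  qed
  then show "(\<lambda>j. prob (?A j)) \<longlonglongrightarrow> prob {\<omega> \<in> space M. at_least n (index_cluster \<omega> e)}"
    unfolding eq using ev by (intro finite_Lim_measure_incseq) auto
qed

lemma prob_at_least_reach_le:
  assumes "\<And>U. finite U \<Longrightarrow> U \<subseteq> I - {e} \<Longrightarrow> bern_sum p U (\<lambda>X. of_bool (n \<le> card (reach touching X {e}))) \<le> c"
  shows "prob {\<omega> \<in> space M. at_least n (index_cluster \<omega> e)} \<le> c"
proof -
  obtain U where U: "incseq U" "\<And>j. finite (U j)" "(\<Union>j. U j) = I" using index_exhaustion
    by (elim exE conjE) (rule that, simp_all)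
  show ?thesis
  proof (rule LIMSEQ_le_const2[OF at_least_reach_limit(2)[OF U]], intro exI allI impI)
    fix j
    \<comment> \<open>The starting index belongs to the cluster in any case, so its own state may be
      dropped from the window.\<close>
    have "reach touching (opens \<omega> \<inter> U j) {e} = reach touching (opens \<omega> \<inter> (U j - {e})) {e}" for \<omega>
    proof -
      have "insert e (opens \<omega> \<inter> (U j - {e})) = insert e (opens \<omega> \<inter> U j)" by blast
      then show ?thesis using reach_insert_self[of e "{e}" touching] by (metis singletonI)
    qed
    then have "{\<omega> \<in> space M. n \<le> card (reach touching (opens \<omega> \<inter> U j) {e})}
        = {\<omega> \<in> space M. n \<le> card (reach touching (opens \<omega> \<inter> (U j - {e})) {e})}" by simp
    also have "prob \<dots> = bern_sum p (U j - {e}) (\<lambda>X. of_bool (n \<le> card (reach touching X {e})))"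
      by (rule prob_finite_window(2)) (use U in blast)+
    also have "\<dots> \<le> c" by (rule assms) (use U in blast)+
    finally show "prob {\<omega> \<in> space M. n \<le> card (reach touching (opens \<omega> \<inter> U j) {e})} \<le> c" .
  qed
qed

text \<open>Absence of infinite clusters gives decay uniformly over all finite windows, since every
  index is a translate of one of the finitely many indices containing the identity.\<close>
lemma uniform_decay:
  assumes no_inf: "prob {\<omega> \<in> space M. percolates \<omega>} = 0" and "0 < \<epsilon>"
  shows "\<exists>N. \<forall>U e. finite U \<longrightarrow> U \<subseteq> I \<longrightarrow> e \<in> I - U \<longrightarrow>
    p * bern_sum p U (\<lambda>X. of_bool (N \<le> card (reach touching X {e}))) \<le> \<epsilon>"
proof -
  obtain Q where Q: "incseq Q" "\<And>j. finite (Q j)" "(\<Union>j. Q j) = I" using index_exhaustion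
    by (elim exE conjE) (rule that, simp_all)
  let ?B = "\<lambda>e n. {\<omega> \<in> space M. \<omega> e \<and> at_least n (index_cluster \<omega> e)}"
  have ev: "?B e n \<in> events" if "e \<in> I" for e n
    using measurable_index[OF that] at_least_reach_limit(1)[OF Q] by (simp add: pred_def sets.sets_Collect_conj)
  have "\<exists>N. prob (?B e N) < \<epsilon>" if e: "e \<in> I" for e
  proof -
    \<comment> \<open>Continuity from above: these events decrease to the event that
      \<open>e\<close> is open with an infinite index cluster, which entails percolation.\<close>
    have "(\<lambda>n. prob (?B e n)) \<longlonglongrightarrow> prob (\<Inter>n. ?B e n)"
      using ev[OF e] by (intro finite_Lim_measure_decseq) (auto simp: decseq_def at_least_def)
    also have "prob (\<Inter>n. ?B e n) = 0"
    proof -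
      have "(\<Inter>n. ?B e n) \<subseteq> {\<omega> \<in> space M. percolates \<omega>}"
      proof
        fix \<omega> assume "\<omega> \<in> (\<Inter>n. ?B e n)"
        then have \<omega>: "\<omega> \<in> space M" "\<omega> e" "\<And>n. at_least n (index_cluster \<omega> e)" by auto
        have inf: "infinite (index_cluster \<omega> e)"
          using \<omega>(3)[of "Suc (card (index_cluster \<omega> e))"] by (auto simp: at_least_def)
        obtain v where v: "v \<in> e" using index_nonempty[OF e] by blast
        have eo: "e \<in> opens \<omega>" using e \<omega> by (simp add: opens_def)
        have "infinite (cluster \<omega> v)"
        proof
          assume "finite (cluster \<omega> v)"
          then have "finite (Pow (cluster \<omega> v))" by simp
          then show False using inf reach_touching_connected[OF eo v] finite_subset by blast
        qed
        moreover have "v \<in> W \<omega>" using e v \<omega>(2) index_G unfolding W_iff by blast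
        ultimately show "\<omega> \<in> {\<omega> \<in> space M. percolates \<omega>}"
          using \<omega>(1) unfolding has_inf_cluster_def cluster_def by blast
      qed
      then have "prob (\<Inter>n. ?B e n) \<le> prob {\<omega> \<in> space M. percolates \<omega>}"
        using measurable_has_inf_cluster by (intro finite_measure_mono) (simp_all add: pred_def)
      then show ?thesis using no_inf measure_nonneg[of M] by (simp add: antisym)
    qed
    finally have "\<forall>\<^sub>F n in sequentially. prob (?B e n) < \<epsilon>" using \<open>0 < \<epsilon>\<close> by (rule order_tendstoD)
    then show ?thesis by (auto simp: eventually_sequentially)
  qed
  then have "\<forall>e\<in>I. \<exists>N. prob (?B e N) < \<epsilon>" by blast
  then obtain N0 where "\<forall>e\<in>I. prob (?B e (N0 e)) < \<epsilon>" unfolding bchoice_iff by (elim exE) (rule that)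
  then have N0: "prob (?B e (N0 e)) < \<epsilon>" if "e \<in> I" for e using that by (rule bspec)
  \<comment> \<open>Left translations carry every index to one of these, so a maximum over finitely
    many thresholds suffices.\<close>
  let ?reps = "{e \<in> I. ll_one \<in> e}"
  define N where "N = Max (insert 0 (N0 ` ?reps))"
  have N: "N0 e \<le> N" if "e \<in> ?reps" for e
    unfolding N_def by (rule Max_ge) (use that finite_incident in simp_all)
  have rep: "p * bern_sum p U (\<lambda>X. of_bool (N \<le> card (reach touching X {e}))) \<le> \<epsilon>"
    if U: "finite U" "U \<subseteq> I" "e \<notin> U" and e: "e \<in> ?reps" for U e
  proof -
    have eI: "e \<in> I" using e by simp
    have eU: "finite (insert e U)" "insert e U \<subseteq> I" using U eI by auto
    \<comment> \<open>The factor \<open>p\<close> is the probability that \<open>e\<close> itself is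
      open. It is needed because \<open>reach\<close> counts \<open>e\<close> regardless, while
      absence of percolation speaks about open indices only.\<close>
    have "p * bern_sum p U (\<lambda>X. of_bool (N \<le> card (reach touching X {e})))
        = bern_sum p (insert e U) (\<lambda>X. of_bool (e \<in> X \<and> N \<le> card (reach touching X {e})))"
    proof -
      have "bern_sum p U (\<lambda>X. of_bool (e \<in> X \<and> N \<le> card (reach touching X {e}))) = bern_sum p U (\<lambda>_. 0)"
        using U(3) by (intro bern_sum_cong) auto
      then show ?thesis
        using bern_sum_const[OF U(1)] by (simp add: bern_sum_insert[OF U(1,3)] reach_insert_self)
    qed
    also have "\<dots> = prob {\<omega> \<in> space M. e \<in> opens \<omega> \<inter> insert e U \<and> N \<le> card (reach touching (opens \<omega> \<inter> insert e U) {e})}"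
      by (rule prob_finite_window(2)[OF eU, symmetric])
    also have "\<dots> \<le> prob (?B e (N0 e))"
    proof (intro finite_measure_mono ev eI subsetI)
      fix \<omega> assume "\<omega> \<in> {\<omega> \<in> space M. e \<in> opens \<omega> \<inter> insert e U \<and> N \<le> card (reach touching (opens \<omega> \<inter> insert e U) {e})}"
      then have \<omega>: "\<omega> \<in> space M" "\<omega> e" "N0 e \<le> card (reach touching (opens \<omega> \<inter> insert e U) {e})"
        using N[OF e] by (auto simp: opens_def)
      have "reach touching (opens \<omega> \<inter> insert e U) {e} \<subseteq> index_cluster \<omega> e"
        by (rule reach_mono) auto
      with \<omega>(3) have "at_least (N0 e) (index_cluster \<omega> e)" by (rule at_least_superset)
      then show "\<omega> \<in> ?B e (N0 e)" using \<omega> by simp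
    qed
    also have "\<dots> \<le> \<epsilon>" using N0[OF eI] by simp
    finally show ?thesis .
  qed
  show ?thesis
  proof (intro exI[of _ N] allI impI)
    fix U e assume U: "finite U" "U \<subseteq> I" and e: "e \<in> I - U"
    then obtain v where v: "v \<in> e" "v \<in> G" using index_nonempty[of e] index_G[of e] by blast
    \<comment> \<open>The translation that takes a vertex \<open>v\<close> of \<open>e\<close> to
      the identity.\<close>
    define T where "T = image ((\<otimes>) (inve v))"
    have gG: "inve v \<in> G" by (rule inve_G[OF v(2)])
    have injU: "inj_on T U" unfolding T_def by (rule inj_on_subset[OF inj_image_index U(2)])
    have "ll_one \<in> T e" unfolding T_def using v inve_mult by (metis image_eqI)
    moreover have "T e' \<in> I" if "e' \<in> I" for e' unfolding T_def by (rule image_index[OF gG that])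
    moreover have "T e \<notin> T ` U"
      using inj_image_index[of "inve v"] e U(2) unfolding T_def by (auto simp: inj_on_def)
    ultimately have "p * bern_sum p (T ` U) (\<lambda>X. of_bool (N \<le> card (reach touching X {T e}))) \<le> \<epsilon>"
      using U e by (intro rep) auto
    moreover have "card (reach touching (T ` X) {T e}) = card (reach touching X {e})" if "X \<subseteq> U" for X
    proof -
      have sub: "X \<subseteq> I" "{e} \<subseteq> I" using that U(2) e by auto
      have "reach touching (T ` X) (T ` {e}) = T ` reach touching X {e}"
        unfolding T_def
        by (rule reach_image[OF inj_image_index sub]) (rule touching_image[OF gG])
      moreover have "inj_on T (reach touching X {e})"
        unfolding T_def using reach_subset[of touching X "{e}"] sub
        by (intro inj_on_subset[OF inj_image_index]) blast
      ultimately show ?thesis by (simp add: card_image)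
    qed
    ultimately show "p * bern_sum p U (\<lambda>X. of_bool (N \<le> card (reach touching X {e}))) \<le> \<epsilon>"
      using bern_sum_cong[of U "\<lambda>X. of_bool (N \<le> card (reach touching (T ` X) {T e}))"
          "\<lambda>X. of_bool (N \<le> card (reach touching X {e}))" p]
      by (simp add: bern_sum_image[OF injU])
  qed
qed

end

section \<open>Translation invariance and mass transport\<close>

context perc_graph
begin

lemma at_least_cluster_iff:
  assumes "x \<in> G"
  shows "at_least n (cluster \<omega> x) \<longleftrightarrow> (\<exists>F\<in>{F. finite F \<and> F \<subseteq> G}. card F = n \<and> (\<forall>y\<in>F. y \<in> cluster \<omega> x))"
proof
  assume "at_least n (cluster \<omega> x)"
  then obtain F where F: "F \<subseteq> cluster \<omega> x" "finite F" "card F = n"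
    unfolding at_least_def by (metis infinite_arbitrarily_large obtain_subset_with_card_n)
  have "F \<subseteq> G" using F(1) cluster_G[OF assms, of \<omega>] by (rule order.trans)
  then show "\<exists>F\<in>{F. finite F \<and> F \<subseteq> G}. card F = n \<and> (\<forall>y\<in>F. y \<in> cluster \<omega> x)" using F by blast
next
  assume "\<exists>F\<in>{F. finite F \<and> F \<subseteq> G}. card F = n \<and> (\<forall>y\<in>F. y \<in> cluster \<omega> x)"
  then obtain F where "card F = n" "F \<subseteq> cluster \<omega> x" by blast
  then show "at_least n (cluster \<omega> x)" by (intro at_least_superset[of n F]) auto
qed

text \<open>The configuration seen from \<open>g\<close>. Restricting the function to
  \<open>I\<close> keeps it inside the space of the product measure.\<close>

definition recenter :: "ll \<Rightarrow> (ll set \<Rightarrow> bool) \<Rightarrow> ll set \<Rightarrow> bool" where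
  "recenter g \<omega> = (\<lambda>e\<in>I. \<omega> ((\<otimes>) g ` e))"

lemma recenter_index: "e \<in> I \<Longrightarrow> recenter g \<omega> e = \<omega> ((\<otimes>) g ` e)"
  by (simp add: recenter_def)

lemma recenter_adj:
  assumes "g \<in> G" "x \<in> G" "y \<in> G"
  shows "adj (recenter g \<omega>) x y \<longleftrightarrow> adj \<omega> (g \<otimes> x) (g \<otimes> y)"
proof (cases "cay_adj m S x y")
  case True
  have "links (g \<otimes> x) (g \<otimes> y) = image ((\<otimes>) g) ` links x y"
    unfolding links_def by (cases model) simp_all
  moreover have "recenter g \<omega> e = \<omega> ((\<otimes>) g ` e)" if "e \<in> links x y" for e
    by (rule recenter_index[OF links_I[OF True that]])
  ultimately show ?thesis unfolding adj_iff cay_adj_translate[OF assms] by simp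
next
  case False
  then show ?thesis unfolding adj_iff cay_adj_translate[OF assms] by simp
qed

lemma image_image_inve: "g \<in> G \<Longrightarrow> A \<subseteq> G \<Longrightarrow> (\<otimes>) g ` (\<otimes>) (inve g) ` A = A"
  unfolding image_image by (rule trans[OF image_cong[OF refl] image_ident]) (rule mult_inve_cancel, rule subsetD)

lemma recenter_W:
  assumes g: "g \<in> G" and x: "x \<in> G"
  shows "x \<in> W (recenter g \<omega>) \<longleftrightarrow> g \<otimes> x \<in> W \<omega>"
proof
  assume "x \<in> W (recenter g \<omega>)"
  then obtain e where e: "e \<in> I" "x \<in> e" "recenter g \<omega> e" unfolding W_iff by blast
  then have "\<omega> ((\<otimes>) g ` e)" by (simp add: recenter_index)
  moreover have "(\<otimes>) g ` e \<in> I" by (rule image_index[OF g e(1)])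
  moreover have "g \<otimes> x \<in> (\<otimes>) g ` e" using e(2) by (rule imageI)
  ultimately show "g \<otimes> x \<in> W \<omega>" using mult_G[OF g x] unfolding W_iff by blast
next
  assume "g \<otimes> x \<in> W \<omega>"
  then obtain e where e: "e \<in> I" "g \<otimes> x \<in> e" "\<omega> e" unfolding W_iff by blast
  let ?e = "(\<otimes>) (inve g) ` e"
  have eI: "?e \<in> I" by (rule image_index[OF inve_G[OF g] e(1)])
  have "recenter g \<omega> ?e" using e(3) image_image_inve[OF g index_G[OF e(1)]] by (simp only: recenter_index[OF eI])
  moreover have "x \<in> ?e" using e(2) inve_mult_cancel[OF x, of g] by (metis imageI)
  ultimately show "x \<in> W (recenter g \<omega>)" using eI x unfolding W_iff by blast
qed

lemma mult_surj: "g \<in> G \<Longrightarrow> z \<in> G \<Longrightarrow> \<exists>y\<in>G. z = g \<otimes> y"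
  using mult_inve_cancel[of z g] mult_G[OF inve_G] by metis

lemma recenter_cluster:
  assumes g: "g \<in> G" and x: "x \<in> G"
  shows "cluster \<omega> (g \<otimes> x) = (\<otimes>) g ` cluster (recenter g \<omega>) x"
proof
  show "(\<otimes>) g ` cluster (recenter g \<omega>) x \<subseteq> cluster \<omega> (g \<otimes> x)"
  proof (rule image_subsetI)
    fix y assume "y \<in> cluster (recenter g \<omega>) x"
    then have "(adj (recenter g \<omega>))\<^sup>*\<^sup>* x y" by (simp add: cluster_def)
    then have "(adj \<omega>)\<^sup>*\<^sup>* (g \<otimes> x) (g \<otimes> y)"
    proof (induction rule: rtranclp_induct)
      case (step y z)
      have "y \<in> G" "z \<in> G" using cay_adj_G[OF adj_cay[OF step.hyps(2)]] by blast+
      then have "adj \<omega> (g \<otimes> y) (g \<otimes> z)" using recenter_adj[OF g] step.hyps(2) by blast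
      then show ?case using step.IH by (rule rtranclp.rtrancl_into_rtrancl[rotated])
    qed simp
    then show "g \<otimes> y \<in> cluster \<omega> (g \<otimes> x)" by (simp add: cluster_def)
  qed
  show "cluster \<omega> (g \<otimes> x) \<subseteq> (\<otimes>) g ` cluster (recenter g \<omega>) x"
  proof
    fix z assume "z \<in> cluster \<omega> (g \<otimes> x)"
    then have "(adj \<omega>)\<^sup>*\<^sup>* (g \<otimes> x) z" by (simp add: cluster_def)
    then show "z \<in> (\<otimes>) g ` cluster (recenter g \<omega>) x"
    proof (induction rule: rtranclp_induct)
      case base
      show ?case by (rule imageI) (rule cluster_self)
    next
      case (step z z')
      then obtain y where y: "z = g \<otimes> y" "y \<in> cluster (recenter g \<omega>) x" by blast
      have yG: "y \<in> G" using y(2) cluster_G[OF x] by (rule subsetD[rotated])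
      obtain y' where y': "y' \<in> G" "z' = g \<otimes> y'" using mult_surj[OF g adj_G[OF step.hyps(2)]] by blast
      have "adj (recenter g \<omega>) y y'"
        using step.hyps(2) recenter_adj[OF g yG y'(1), of \<omega>] y(1) y'(2) by simp
      then have "y' \<in> cluster (recenter g \<omega>) x"
        using y(2) unfolding cluster_def by (simp add: rtranclp.rtrancl_into_rtrancl)
      then show ?case unfolding y'(2) by (rule imageI)
    qed
  qed
qed

lemma recenter_neighbours:
  assumes g: "g \<in> G" and x: "x \<in> G"
    and P: "\<And>y. y \<in> G \<Longrightarrow> P (g \<otimes> y) \<longleftrightarrow> Q y"
  shows "{z \<in> W \<omega>. P z} = (\<otimes>) g ` {y \<in> W (recenter g \<omega>). Q y}"
proof
  show "{z \<in> W \<omega>. P z} \<subseteq> (\<otimes>) g ` {y \<in> W (recenter g \<omega>). Q y}"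
  proof
    fix z assume z: "z \<in> {z \<in> W \<omega>. P z}"
    then have "z \<in> W \<omega>" "P z" by simp_all
    moreover obtain y where y: "y \<in> G" "z = g \<otimes> y" using mult_surj[OF g] \<open>z \<in> W \<omega>\<close> W_G by blast
    ultimately have "y \<in> W (recenter g \<omega>)" "Q y" using recenter_W[OF g y(1), of \<omega>] P[OF y(1)] by simp_all
    then show "z \<in> (\<otimes>) g ` {y \<in> W (recenter g \<omega>). Q y}" using y(2) by blast
  qed
  show "(\<otimes>) g ` {y \<in> W (recenter g \<omega>). Q y} \<subseteq> {z \<in> W \<omega>. P z}"
  proof (rule image_subsetI)
    fix y assume y: "y \<in> {y \<in> W (recenter g \<omega>). Q y}"
    then have "y \<in> W (recenter g \<omega>)" "Q y" by simp_all
    moreover have yG: "y \<in> G" using calculation(1) W_G by (rule subsetD[rotated])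
    ultimately show "g \<otimes> y \<in> {z \<in> W \<omega>. P z}" using recenter_W[OF g yG, of \<omega>] P[OF yG] by simp
  qed
qed

lemma left_eq_iff: "x \<in> G \<Longrightarrow> y \<in> G \<Longrightarrow> g \<otimes> x = g \<otimes> y \<longleftrightarrow> x = y"
  by (rule inj_on_eq_iff[OF inj_left])

lemma recenter_hamiltonian:
  assumes g: "g \<in> G" and x: "x \<in> G" and y: "y \<in> G"
  shows "hamiltonian lk (recenter g \<omega>) x y = hamiltonian lk \<omega> (g \<otimes> x) (g \<otimes> y)"
proof -
  have "{z \<in> W \<omega>. adj \<omega> (g \<otimes> x) z} = (\<otimes>) g ` {y \<in> W (recenter g \<omega>). adj (recenter g \<omega>) x y}"
    by (rule recenter_neighbours[OF g x]) (simp add: recenter_adj[OF g x])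
  moreover have "inj_on ((\<otimes>) g) {y \<in> W (recenter g \<omega>). adj (recenter g \<omega>) x y}"
    using W_G by (intro inj_on_subset[OF inj_left]) blast
  ultimately have "deg (W \<omega>) (adj \<omega>) (g \<otimes> x) = deg (W (recenter g \<omega>)) (adj (recenter g \<omega>)) x"
    unfolding deg_def by (simp add: card_image)
  then show ?thesis
    by (cases lk; cases "x = y")
      (simp_all add: hamiltonian_def lap_A_def lap_D_def recenter_adj[OF g x y] recenter_adj[OF g y y] left_eq_iff[OF x y])
qed

lemma recenter_mpow:
  assumes g: "g \<in> G" and "x \<in> G" and y: "y \<in> G"
  shows "ham_pow lk (recenter g \<omega>) n x y
    = ham_pow lk \<omega> n (g \<otimes> x) (g \<otimes> y)"
  using assms(2)
proof (induction n arbitrary: x)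
  case 0
  then show ?case by (simp add: left_eq_iff y)
next
  case (Suc n)
  let ?N = "{z \<in> W (recenter g \<omega>). z = x \<or> adj (recenter g \<omega>) x z}"
  have NG: "?N \<subseteq> G" using W_G by blast
  have "{z \<in> W \<omega>. z = g \<otimes> x \<or> adj \<omega> (g \<otimes> x) z} = (\<otimes>) g ` ?N"
    by (rule recenter_neighbours[OF g Suc.prems]) (simp add: recenter_adj[OF g Suc.prems] left_eq_iff Suc.prems)
  then have "ham_pow lk \<omega> (Suc n) (g \<otimes> x) (g \<otimes> y)
      = (\<Sum>z\<in>?N. hamiltonian lk \<omega> (g \<otimes> x) (g \<otimes> z) * ham_pow lk \<omega> n (g \<otimes> z) (g \<otimes> y))"
    by (simp add: sum.reindex[OF inj_on_subset[OF inj_left NG]])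
  also have "\<dots> = (\<Sum>z\<in>?N. hamiltonian lk (recenter g \<omega>) x z
      * ham_pow lk (recenter g \<omega>) n z y)"
  proof (rule sum.cong[OF refl])
    fix z assume "z \<in> ?N"
    then have z: "z \<in> G" using NG by (rule subsetD[rotated])
    show "hamiltonian lk \<omega> (g \<otimes> x) (g \<otimes> z) * ham_pow lk \<omega> n (g \<otimes> z) (g \<otimes> y)
      = hamiltonian lk (recenter g \<omega>) x z * ham_pow lk (recenter g \<omega>) n z y"
      by (simp only: Suc.IH[OF z] recenter_hamiltonian[OF g Suc.prems z])
  qed
  finally show ?case by simp
qed

text \<open>\<open>spec_cdf\<close> depends on its operator only through membership in the vertex
  set and the diagonal moments, and both are translation covariant.\<close>

lemma recenter_cdf_at:
  assumes "g \<in> G" "x \<in> G"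
  shows "cdf_at lk E x (recenter g \<omega>) = cdf_at lk E (g \<otimes> x) \<omega>"
  unfolding spec_cdf_def recenter_W[OF assms] recenter_mpow[OF assms(1,2,2)] ..

text \<open>The diagonal Laplacian dominates the adjacency one as a quadratic form, but its spectral
  distribution function is dominated only after summation over a whole finite cluster.\<close>
lemma cluster_trace_le:
  assumes x: "x \<in> W \<omega>" and fin: "finite (cluster \<omega> x)"
  shows "(\<Sum>y\<in>cluster \<omega> x. cdf_at LapD E y \<omega>) \<le> (\<Sum>y\<in>cluster \<omega> x. cdf_at LapA E y \<omega>)"
proof -
  let ?V = "cluster \<omega> x"
  \<comment> \<open>Summing the squared entries of a normalised eigenvector over the whole cluster
    gives 1, so the sum counts eigenvalues.\<close>
  have trace: "(\<Sum>y\<in>?V. cdf_at lk E y \<omega>) = card {i. i < n \<and> l i \<le> E}"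
    if eb: "eigenbasis (hamiltonian lk \<omega>) ?V n e l" for lk n e l
  proof -
    interpret local_operator "hamiltonian lk \<omega>" "W \<omega>" "adj \<omega>" "3 * card S"
      by (rule local_operator_hamiltonian)
    have "(\<Sum>y\<in>?V. cdf_at lk E y \<omega>) = (\<Sum>y\<in>?V. \<Sum>i | i < n \<and> l i \<le> E. (e i y)\<^sup>2)"
      by (rule sum.cong[OF refl]) (rule spec_cdf_finite_cluster[OF cluster_def fin eb x])
    also have "\<dots> = (\<Sum>i | i < n \<and> l i \<le> E. dot ?V (e i) (e i))"
      unfolding dot_def power2_eq_square by (rule sum.swap)
    also have "\<dots> = (\<Sum>i | i < n \<and> l i \<le> E. 1)"
      using eb by (intro sum.cong) (auto simp: eigenbasis_def)
    finally show ?thesis by simp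
  qed
  have sym: "hamiltonian lk \<omega> y z = hamiltonian lk \<omega> z y" for lk y z
    by (rule local_operator.H_sym[OF local_operator_hamiltonian])
  obtain n e l where A: "eigenbasis (hamiltonian LapA \<omega>) ?V n e l"
    by (rule eigenbasis_exists[OF fin, of "hamiltonian LapA \<omega>"]) (rule sym)
  obtain k f r where D: "eigenbasis (hamiltonian LapD \<omega>) ?V k f r"
    by (rule eigenbasis_exists[OF fin, of "hamiltonian LapD \<omega>"]) (rule sym)
  have "dot ?V f (matvec (hamiltonian LapA \<omega>) ?V f) \<le> dot ?V f (matvec (hamiltonian LapD \<omega>) ?V f)" for f
  proof -
    \<comment> \<open>The two operators differ by multiplication with \<open>card S\<close> minus
      the degree, which is nonnegative.\<close>
    have *: "matvec (hamiltonian LapD \<omega>) ?V f y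
        = matvec (hamiltonian LapA \<omega>) ?V f y + (card S - deg (W \<omega>) (adj \<omega>) y) * f y" if "y \<in> ?V" for y
    proof -
      have "matvec (hamiltonian LapD \<omega>) ?V f y
        = (\<Sum>z\<in>?V. hamiltonian LapA \<omega> y z * f z + (if y = z then (card S - deg (W \<omega>) (adj \<omega>) y) * f z else 0))"
        unfolding matvec_def by (rule sum.cong) (simp_all add: hamiltonian_def lap_A_def lap_D_def algebra_simps)
      then show ?thesis using fin that by (simp add: sum.distrib matvec_def)
    qed
    have "dot ?V f (matvec (hamiltonian LapD \<omega>) ?V f)
      = (\<Sum>y\<in>?V. f y * matvec (hamiltonian LapA \<omega>) ?V f y + (card S - deg (W \<omega>) (adj \<omega>) y) * (f y)\<^sup>2)"
      unfolding dot_def by (rule sum.cong) (simp_all only: *, simp add: algebra_simps power2_eq_square)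
    then have "dot ?V f (matvec (hamiltonian LapD \<omega>) ?V f)
      = dot ?V f (matvec (hamiltonian LapA \<omega>) ?V f) + (\<Sum>y\<in>?V. (card S - deg (W \<omega>) (adj \<omega>) y) * (f y)\<^sup>2)"
      by (simp only: dot_def sum.distrib)
    moreover have "0 \<le> (\<Sum>y\<in>?V. (card S - deg (W \<omega>) (adj \<omega>) y) * (f y)\<^sup>2)"
      using deg_bounds by (intro sum_nonneg mult_nonneg_nonneg) simp_all
    ultimately show ?thesis by simp
  qed
  from eigenvalue_count_antimono[OF fin A D this, of E] show ?thesis
    unfolding trace[OF A] trace[OF D] by simp
qed

end

context percolation
begin

lemma recenter_measurable: "g \<in> G \<Longrightarrow> recenter g \<in> measurable M M"
  unfolding perc_space_def recenter_def
  by (intro measurable_restrict measurable_component_singleton image_index)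

text \<open>Translation acts as an injective reindexing of an independent, identically distributed
  family.\<close>

lemma distr_recenter:
  assumes "g \<in> G"
  shows "distr M M (recenter g) = M"
proof -
  have "distr (PiM I (\<lambda>_. measure_pmf (bernoulli_pmf p))) (PiM I (\<lambda>_. measure_pmf (bernoulli_pmf p)))
      (\<lambda>\<omega>. \<lambda>e\<in>I. \<omega> ((\<otimes>) g ` e)) = PiM I (\<lambda>_. measure_pmf (bernoulli_pmf p))"
    by (rule distr_PiM_reindex[where M = "\<lambda>_. measure_pmf (bernoulli_pmf p)"])
      (use inj_image_index image_index[OF assms] in \<open>simp_all add: measure_pmf.prob_space_axioms Pi_iff\<close>)
  then show ?thesis unfolding perc_space_def recenter_def[abs_def] .
qed

lemma measurable_at_least_cluster [measurable]:
  assumes "x \<in> G" shows "Measurable.pred M (\<lambda>\<omega>. at_least n (cluster \<omega> x))"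
  unfolding at_least_cluster_iff[OF assms]
  by (intro pred_countable_Bex countable_Collect_finite_subset countable_G pred_intros_logic
      pred_countable_Ball measurable_cluster countable_finite) simp_all

lemma measurable_card_cluster [measurable]:
  assumes x: "x \<in> G" shows "(\<lambda>\<omega>. real (card (cluster \<omega> x))) \<in> borel_measurable M"
proof -
  have "Measurable.pred M (\<lambda>\<omega>. card (cluster \<omega> x) = n)" for n
  proof -
    have "card (cluster \<omega> x) = n \<longleftrightarrow> (infinite (cluster \<omega> x) \<and> n = 0) \<or>
      (\<not> infinite (cluster \<omega> x) \<and> at_least n (cluster \<omega> x) \<and> \<not> at_least (Suc n) (cluster \<omega> x))" for \<omega>
      by (auto simp: at_least_def intro: card_ge_0_finite)
    moreover have "Measurable.pred M (\<lambda>\<omega>. (infinite (cluster \<omega> x) \<and> n = 0) \<or>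
      (\<not> infinite (cluster \<omega> x) \<and> at_least n (cluster \<omega> x) \<and> \<not> at_least (Suc n) (cluster \<omega> x)))"
      by (intro pred_intros_logic measurable_infinite_cluster[OF x] measurable_at_least_cluster[OF x]) simp
    ultimately show ?thesis by presburger
  qed
  then have "(\<lambda>\<omega>. card (cluster \<omega> x)) \<in> measurable M (count_space UNIV)"
    by (simp add: measurable_count_space_eq_countable pred_def vimage_def Int_def conj_commute)
  then show ?thesis by measurable
qed

text \<open>The mass that \<open>x\<close> sends to \<open>y\<close> when it spreads its spectral
  value evenly over its cluster. On an infinite cluster \<open>card\<close> is 0 and division by 0
  makes every share vanish.\<close>

definition share :: "lap_kind \<Rightarrow> real \<Rightarrow> ll \<Rightarrow> ll \<Rightarrow> (ll set \<Rightarrow> bool) \<Rightarrow> ennreal" where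
  "share lk E x y \<omega> = ennreal (cdf_at lk E x \<omega> / card (cluster \<omega> x)) * indicator (cluster \<omega> x) y"

lemma share_measurable [measurable]:
  assumes [measurable]: "x \<in> G" shows "share lk E x y \<in> borel_measurable M"
proof -
  have "(\<lambda>\<omega>. indicator (cluster \<omega> x) y :: ennreal) \<in> borel_measurable M"
    unfolding indicator_def by measurable
  then show ?thesis unfolding share_def by measurable
qed

lemma share_recenter:
  assumes "g \<in> G" "x \<in> G" "y \<in> G"
  shows "share lk E x y (recenter g \<omega>) = share lk E (g \<otimes> x) (g \<otimes> y) \<omega>"
proof -
  have C: "cluster (recenter g \<omega>) x \<subseteq> G" by (rule cluster_G[OF assms(2)])
  have "card (cluster \<omega> (g \<otimes> x)) = card (cluster (recenter g \<omega>) x)"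
    unfolding recenter_cluster[OF assms(1,2)] by (rule card_image[OF inj_on_subset[OF inj_left C]])
  moreover have "g \<otimes> y \<in> cluster \<omega> (g \<otimes> x) \<longleftrightarrow> y \<in> cluster (recenter g \<omega>) x"
    unfolding recenter_cluster[OF assms(1,2)] by (rule inj_on_image_mem_iff[OF inj_left assms(3) C])
  ultimately show ?thesis
    by (simp add: share_def recenter_cdf_at[OF assms(1,2)] indicator_def)
qed

text \<open>Translating by \<open>inve y\<close> turns the mass sent from the identity to
  \<open>y\<close> into mass sent from \<open>inve y\<close> to the identity; inversion then
  permutes the group.\<close>

lemma mass_transport:
  "(\<integral>\<^sup>+\<omega>. \<integral>\<^sup>+y. share lk E ll_one y \<omega> \<partial>count_space G \<partial>M) = (\<integral>\<^sup>+\<omega>. \<integral>\<^sup>+y. share lk E y ll_one \<omega> \<partial>count_space G \<partial>M)"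
proof -
  have transport: "(\<integral>\<^sup>+\<omega>. share lk E ll_one y \<omega> \<partial>M) = (\<integral>\<^sup>+\<omega>. share lk E (inve y) ll_one \<omega> \<partial>M)" if y: "y \<in> G" for y
  proof -
    have "(\<integral>\<^sup>+\<omega>. share lk E ll_one y \<omega> \<partial>M) = (\<integral>\<^sup>+\<omega>. share lk E ll_one y \<omega> \<partial>distr M M (recenter (inve y)))"
      by (simp only: distr_recenter[OF inve_G[OF y]])
    also have "\<dots> = (\<integral>\<^sup>+\<omega>. share lk E ll_one y (recenter (inve y) \<omega>) \<partial>M)"
      by (rule nn_integral_distr[OF recenter_measurable[OF inve_G[OF y]]])
        (simp add: share_measurable[OF one_G])
    finally show ?thesis
      by (simp only: share_recenter[OF inve_G[OF y] one_G y] mult_one[OF inve_G[OF y]] inve_mult)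
  qed
  have "(\<integral>\<^sup>+\<omega>. \<integral>\<^sup>+y. share lk E ll_one y \<omega> \<partial>count_space G \<partial>M) = (\<integral>\<^sup>+y. \<integral>\<^sup>+\<omega>. share lk E ll_one y \<omega> \<partial>M \<partial>count_space G)"
    by (rule nn_integral_count_space_nn_integral[OF countable_G]) (rule share_measurable[OF one_G])
  also have "\<dots> = (\<integral>\<^sup>+y. \<integral>\<^sup>+\<omega>. share lk E (inve y) ll_one \<omega> \<partial>M \<partial>count_space G)"
    by (rule nn_integral_cong) (simp only: space_count_space transport)
  also have "\<dots> = (\<integral>\<^sup>+y. \<integral>\<^sup>+\<omega>. share lk E y ll_one \<omega> \<partial>M \<partial>count_space G)"
    by (rule nn_integral_bij_count_space[where f = "\<lambda>y. \<integral>\<^sup>+\<omega>. share lk E y ll_one \<omega> \<partial>M"])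
      (rule bij_betw_byWitness[where f' = inve], (use inve_inve inve_G in blast)+)
  also have "\<dots> = (\<integral>\<^sup>+\<omega>. \<integral>\<^sup>+y. share lk E y ll_one \<omega> \<partial>count_space G \<partial>M)"
    by (rule nn_integral_count_space_nn_integral[OF countable_G, symmetric]) (rule share_measurable)
  finally show ?thesis .
qed

end

section \<open>The subcritical phase\<close>

context percolation
begin

text \<open>Tail times Laplace transform is at most \<open>exp (- h * n)\<close>. For small
  \<open>h\<close> the decay at \<open>P\<close> keeps the transform at least one half, which leaves
  the tail bound with factor 2.\<close>

lemma exponential_decay:
  assumes P: "p < P" "P \<le> 1"
    and no_inf: "measure (perc_space model m S P)
      {\<omega> \<in> space (perc_space model m S P). percolates \<omega>} = 0"
  shows "\<exists>h>0. \<forall>e\<in>I. \<forall>n. prob {\<omega> \<in> space M. at_least n (index_cluster \<omega> e)} \<le> 2 * exp (- h * n)"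
proof -
  have P0: "0 < P" using p P by simp
  interpret P: percolation m S model P by unfold_locales (use P0 P in simp_all)
  define c where "c = (P - p) / (2 * P)"
  have c: "0 < c" "c \<le> 1 / 2" "p \<le> P * (1 - c)" using P0 P p by (simp_all add: c_def field_simps)
  obtain N where N: "\<And>U e. finite U \<Longrightarrow> U \<subseteq> I \<Longrightarrow> e \<in> I - U \<Longrightarrow>
      P * bern_sum P U (\<lambda>X. of_bool (N \<le> card (reach touching X {e}))) \<le> P * (c / 2)"
    using P.uniform_decay[OF no_inf, of "P * (c / 2)"] P0 c(1) by auto
  \<comment> \<open>Makes \<open>h * N\<close> at most \<open>c / 2\<close>, so a cluster with at
    most \<open>N\<close> elements loses at most \<open>c / 2\<close> in its Laplace weight; the
    added 1 covers \<open>N = 0\<close>.\<close>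
  define h where "h = c / (2 * (real N + 1))"
  have h: "0 < h" using c by (simp add: h_def)
  have hN: "1 - c / 2 \<le> exp (- h * N)"
  proof -
    have "h * N \<le> c / 2" using c(1) by (simp add: h_def field_simps)
    then show ?thesis using exp_ge_add_one_self[of "- h * N"] by simp
  qed
  have lap: "1 - c \<le> bern_sum P U (\<lambda>X. exp (- h * card (reach touching X {e})))"
    if U: "finite U" "U \<subseteq> I" "e \<in> I - U" for U e
  proof -
    define b where "b = bern_sum P U (\<lambda>X. of_bool (N \<le> card (reach touching X {e})))"
    have b: "b \<le> c / 2" using N[OF U] P0 by (simp add: b_def)
    \<comment> \<open>One factor \<open>1 - c / 2\<close> is the weight of clusters below size
      \<open>N\<close>, the other bounds their probability.\<close>
    have "1 - c \<le> (1 - c / 2) * (1 - c / 2)" by (simp add: algebra_simps)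
    also have "\<dots> \<le> exp (- h * N) * (1 - b)" using hN b c by (intro mult_mono) auto
    also have "\<dots> = bern_sum P U (\<lambda>X. exp (- h * N) * (1 + (-1) * of_bool (N \<le> card (reach touching X {e}))))"
      unfolding bern_sum_scale bern_sum_add bern_sum_const[OF U(1)] b_def by simp
    also have "\<dots> \<le> bern_sum P U (\<lambda>X. exp (- h * card (reach touching X {e})))"
    proof (rule bern_sum_mono)
      fix X
      show "exp (- h * N) * (1 + (-1) * of_bool (N \<le> card (reach touching X {e})))
        \<le> exp (- h * card (reach touching X {e}))"
        using h by (cases "N \<le> card (reach touching X {e})") simp_all
    qed (use P0 P in simp_all)
    finally show ?thesis .
  qed
  have "prob {\<omega> \<in> space M. at_least n (index_cluster \<omega> e)} \<le> 2 * exp (- h * n)" if e: "e \<in> I" for e n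
  proof (rule prob_at_least_reach_le)
    fix U assume U: "finite U" "U \<subseteq> I - {e}"
    define u where "u = bern_sum p U (\<lambda>X. of_bool (n \<le> card (reach touching X {e})))"
    define v where "v = bern_sum P U (\<lambda>X. exp (- h * card (reach touching X {e})))"
    have "u * v \<le> exp (- h * n)"
      unfolding u_def v_def
    proof (rule cluster_tail_times_laplace[where M = c])
      show "1 - c \<le> bern_sum P V (\<lambda>X. exp (- h * card (reach touching X {y})))"
        if "V \<subseteq> U" "y \<in> U - V" for V y
        by (rule lap) (use that U finite_subset in blast)+
    qed (use U P0 P p c h in auto)
    moreover have "1 / 2 \<le> v"
    proof -
      have "U \<subseteq> I" "e \<in> I - U" using U e by blast+
      from lap[OF U(1) this] show ?thesis using c(2) by (simp add: v_def)
    qed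
    moreover have "0 \<le> u" unfolding u_def bern_sum_def using p by (intro sum_nonneg) auto
    ultimately have "u * (1 / 2) \<le> exp (- h * n)" using mult_left_mono[of "1 / 2" v u] by linarith
    then show "bern_sum p U (\<lambda>X. of_bool (n \<le> card (reach touching X {e}))) \<le> 2 * exp (- h * n)"
      by (simp add: u_def)
  qed
  then show ?thesis using h by blast
qed

end

context perc_graph
begin

text \<open>Makes the set in \<open>p_crit\<close> nonempty, so that its supremum is
  meaningful.\<close>

lemma no_percolation_at_zero:
  "measure (perc_space model m S 0) {\<omega> \<in> space (perc_space model m S 0). percolates \<omega>} = 0"
proof -
  interpret percolation m S model 0 by unfold_locales simp_all
  have "AE \<omega> in M. \<not> \<omega> e" if e: "e \<in> I" for e
  proof -
    have "prob {\<omega> \<in> space M. e \<in> opens \<omega> \<inter> {e}} = bern_sum 0 (insert e {}) (\<lambda>X. of_bool (e \<in> X))"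
      by (rule prob_finite_window(2)) (use e in simp_all)
    also have "\<dots> = 0" by (subst bern_sum_insert) simp_all
    finally have "prob {\<omega> \<in> space M. e \<in> opens \<omega> \<inter> {e}} = 0" .
    moreover have "{\<omega> \<in> space M. e \<in> opens \<omega> \<inter> {e}} = {\<omega> \<in> space M. \<omega> e}"
      using e by (auto simp: opens_def)
    ultimately show ?thesis
      using measurable_index[OF e] by (simp add: AE_iff_measurable[OF _ refl] emeasure_eq_measure pred_def)
  qed
  then have "AE \<omega> in M. \<forall>e\<in>I. \<not> \<omega> e" by (simp add: AE_ball_countable[OF countable_I])
  then have "AE \<omega> in M. \<not> percolates \<omega>"
  proof eventually_elim
    fix \<omega> assume "\<forall>e\<in>I. \<not> \<omega> e"
    then have "W \<omega> = {}" unfolding set_eq_iff W_iff by blast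
    then show "\<not> percolates \<omega>" by (simp add: has_inf_cluster_def)
  qed
  then show ?thesis
    using measurable_has_inf_cluster
    by (subst (asm) AE_iff_measurable[OF _ refl]) (simp_all add: pred_def emeasure_eq_measure)
qed

text \<open>A number below a supremum lies below a member of the set, and a member \<open>P\<close>
  is a parameter without percolation.\<close>

lemma subcritical_witness:
  assumes "p < p_crit model m S"
  shows "\<exists>P\<le>1. p < P \<and> measure (perc_space model m S P)
      {\<omega> \<in> space (perc_space model m S P). percolates \<omega>} = 0"
proof -
  let ?A = "{p \<in> {0..1}. measure (perc_space model m S p)
      {\<omega> \<in> space (perc_space model m S p). percolates \<omega>} = 0}"
  have "0 \<in> ?A" using no_percolation_at_zero by simp
  then have "?A \<noteq> {}" by blast
  moreover have "bdd_above ?A" by (rule bdd_aboveI[of _ 1]) simp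
  ultimately have "\<exists>P\<in>?A. p < P"
    using assms less_cSup_iff[of ?A p] unfolding p_crit_def by simp
  then show ?thesis by auto
qed

end

section \<open>The integrated density of states\<close>

context percolation
begin

text \<open>An open vertex lies in one of finitely many open indices, whose index cluster has at
  least half as many elements; a union bound finishes.\<close>

lemma cluster_tail:
  assumes h: "\<And>e n. e \<in> I \<Longrightarrow> prob {\<omega> \<in> space M. at_least n (index_cluster \<omega> e)} \<le> 2 * exp (- h * real n)"
    and x: "x \<in> G"
  shows "prob {\<omega> \<in> space M. x \<in> W \<omega> \<and> at_least (2 * n) (cluster \<omega> x)} \<le> 2 * card {e \<in> I. x \<in> e} * exp (- h * n)"
proof -
  let ?R = "{e \<in> I. x \<in> e}"
  let ?B = "\<lambda>e. {\<omega> \<in> space M. at_least n (index_cluster \<omega> e)}"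
  obtain U :: "nat \<Rightarrow> ll set set" where U: "incseq U" "\<And>j. finite (U j)" "(\<Union>j. U j) = I" using index_exhaustion
    by (elim exE conjE) (rule that, simp_all)
  have ev: "?B e \<in> events" for e by (rule at_least_reach_limit(1)[OF U])
  have "{\<omega> \<in> space M. x \<in> W \<omega> \<and> at_least (2 * n) (cluster \<omega> x)} \<subseteq> (\<Union>e\<in>?R. ?B e)"
  proof
    fix \<omega> assume "\<omega> \<in> {\<omega> \<in> space M. x \<in> W \<omega> \<and> at_least (2 * n) (cluster \<omega> x)}"
    then have \<omega>: "\<omega> \<in> space M" "x \<in> W \<omega>" "at_least (2 * n) (cluster \<omega> x)" by simp_all
    then obtain e where e: "e \<in> I" "x \<in> e" "\<omega> e" unfolding W_iff by blast
    then have "at_least n (index_cluster \<omega> e)"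
      by (intro at_least_cluster_reach[OF _ e(2) \<omega>(3)]) (simp add: opens_def)
    then show "\<omega> \<in> (\<Union>e\<in>?R. ?B e)" using e(1,2) \<omega>(1) by blast
  qed
  then have "prob {\<omega> \<in> space M. x \<in> W \<omega> \<and> at_least (2 * n) (cluster \<omega> x)} \<le> prob (\<Union>e\<in>?R. ?B e)"
    using ev finite_incident by (intro finite_measure_mono sets.finite_UN) simp_all
  also have "\<dots> \<le> (\<Sum>e\<in>?R. prob (?B e))"
    using ev finite_incident by (intro finite_measure_subadditive_finite) auto
  also have "\<dots> \<le> (\<Sum>e\<in>?R. 2 * exp (- h * n))" by (rule sum_mono) (rule h, simp)
  finally show ?thesis by (simp add: mult.commute mult.left_commute)
qed

lemma AE_finite_cluster:
  assumes h: "\<And>e n. e \<in> I \<Longrightarrow> prob {\<omega> \<in> space M. at_least n (index_cluster \<omega> e)} \<le> 2 * exp (- h * real n)"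
    and "0 < h" and x: "x \<in> G"
  shows "AE \<omega> in M. x \<in> W \<omega> \<longrightarrow> finite (cluster \<omega> x)"
proof -
  let ?A = "{\<omega> \<in> space M. x \<in> W \<omega> \<and> infinite (cluster \<omega> x)}"
  have ev: "?A \<in> events" "{\<omega> \<in> space M. x \<in> W \<omega> \<and> at_least n (cluster \<omega> x)} \<in> events" for n
    using measurable_W measurable_infinite_cluster[OF x] measurable_at_least_cluster[OF x]
    by (simp_all add: pred_def sets.sets_Collect_conj)
  have le: "prob ?A \<le> 2 * card {e \<in> I. x \<in> e} * exp (- h * n)" for n :: nat
  proof (rule order.trans[OF _ cluster_tail[OF h x]])
    show "prob ?A \<le> prob {\<omega> \<in> space M. x \<in> W \<omega> \<and> at_least (2 * n) (cluster \<omega> x)}"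
      by (rule finite_measure_mono[OF _ ev(2)]) (auto simp: at_least_def)
  qed
  define c where "c = 2 * real (card {e \<in> I. x \<in> e})"
  have "(\<lambda>n. c * exp (- h) ^ n) \<longlonglongrightarrow> c * 0"
    using \<open>0 < h\<close> by (intro tendsto_mult tendsto_const LIMSEQ_power_zero) simp
  moreover have "prob ?A \<le> c * exp (- h) ^ n" for n
    using le[of n] by (simp add: c_def exp_of_nat_mult[symmetric] mult.commute)
  ultimately have "prob ?A \<le> c * 0" by (intro LIMSEQ_le_const) auto
  then have "emeasure M ?A = 0" using measure_nonneg[of M ?A] by (simp add: emeasure_eq_measure)
  then show ?thesis using ev(1) by (intro AE_I[of _ _ ?A]) auto
qed

text \<open>On a finite cluster the shares sent out add up to the original value; off the vertex set
  both sides are 0.\<close>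

lemma nn_integral_share:
  assumes fin: "AE \<omega> in M. ll_one \<in> W \<omega> \<longrightarrow> finite (cluster \<omega> ll_one)"
  shows "(\<integral>\<^sup>+\<omega>. cdf_at lk E ll_one \<omega> \<partial>M) = (\<integral>\<^sup>+\<omega>. \<integral>\<^sup>+y. share lk E ll_one y \<omega> \<partial>count_space G \<partial>M)"
proof (rule nn_integral_cong_AE, use fin in eventually_elim)
  fix \<omega> assume fin: "ll_one \<in> W \<omega> \<longrightarrow> finite (cluster \<omega> ll_one)"
  let ?C = "cluster \<omega> ll_one"
  show "ennreal (cdf_at lk E ll_one \<omega>) = (\<integral>\<^sup>+y. share lk E ll_one y \<omega> \<partial>count_space G)"
  proof (cases "ll_one \<in> W \<omega>")
    case True
    then have C: "finite ?C" "0 < card ?C"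
      using fin cluster_self[of ll_one \<omega>] by (auto simp: card_gt_0_iff)
    have "(\<integral>\<^sup>+y. share lk E ll_one y \<omega> \<partial>count_space G)
        = ennreal (cdf_at lk E ll_one \<omega> / card ?C) * (\<integral>\<^sup>+y. indicator ?C y \<partial>count_space G)"
      unfolding share_def by (rule nn_integral_cmult) simp
    also have "(\<integral>\<^sup>+y. indicator ?C y \<partial>count_space G) = ennreal (card ?C)"
      using cluster_G[OF one_G, of \<omega>] C(1) by (subst nn_integral_indicator) (simp_all add: ennreal_of_nat_eq_real_of_nat)
    also have "ennreal (cdf_at lk E ll_one \<omega> / card ?C) * ennreal (card ?C) = ennreal (cdf_at lk E ll_one \<omega>)"
      using C cdf_at_bounds(1) by (subst ennreal_mult[symmetric]) auto
    finally show ?thesis by simp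
  next
    case False
    then have "cdf_at lk E ll_one \<omega> = 0" by (simp add: spec_cdf_def)
    then show ?thesis by (simp add: share_def)
  qed
qed

text \<open>The mass received by the identity is the average over its cluster, that is, a normalised
  trace. This is what makes \<open>cluster_trace_le\<close> applicable.\<close>

lemma nn_integral_share_received:
  assumes fin: "ll_one \<in> W \<omega> \<longrightarrow> finite (cluster \<omega> ll_one)"
  shows "(\<integral>\<^sup>+y. share lk E y ll_one \<omega> \<partial>count_space G)
    = ennreal (if ll_one \<in> W \<omega>
        then (\<Sum>y\<in>cluster \<omega> ll_one. cdf_at lk E y \<omega>) / card (cluster \<omega> ll_one) else 0)"
proof -
  let ?C = "cluster \<omega> ll_one"
  have mem: "ll_one \<in> cluster \<omega> y \<longleftrightarrow> y \<in> ?C" for y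
  proof
    show "ll_one \<in> cluster \<omega> y \<Longrightarrow> y \<in> ?C" using cluster_eq cluster_self by blast
    show "y \<in> ?C \<Longrightarrow> ll_one \<in> cluster \<omega> y" using cluster_eq cluster_self by blast
  qed
  show ?thesis
  proof (cases "ll_one \<in> W \<omega>")
    case True
    then have C: "finite ?C" "?C \<subseteq> G" using fin cluster_G[OF one_G] by blast+
    have "(\<integral>\<^sup>+y. share lk E y ll_one \<omega> \<partial>count_space G)
        = (\<integral>\<^sup>+y. ennreal (cdf_at lk E y \<omega> / card ?C) * indicator ?C y \<partial>count_space G)"
    proof (rule nn_integral_cong)
      fix y
      show "share lk E y ll_one \<omega> = ennreal (cdf_at lk E y \<omega> / card ?C) * indicator ?C y"
        using cluster_eq[of y \<omega> ll_one] by (simp add: share_def mem indicator_def)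
    qed
    also have "\<dots> = (\<integral>\<^sup>+y. ennreal (cdf_at lk E y \<omega> / card ?C) \<partial>count_space ?C)"
    proof -
      have ind: "(\<integral>\<^sup>+y. f y \<partial>count_space A) = (\<integral>\<^sup>+y. f y * indicator A y \<partial>count_space UNIV)"
        for f :: "ll \<Rightarrow> ennreal" and A
        by (rule nn_integral_count_space_indicator) (simp add: NO_MATCH_def)
      show ?thesis
        unfolding ind[of G] ind[of ?C]
        by (rule nn_integral_cong) (use C(2) in \<open>simp add: indicator_def subset_eq\<close>)
    qed
    also have "\<dots> = (\<Sum>y\<in>?C. ennreal (cdf_at lk E y \<omega> / card ?C))"
      by (rule nn_integral_count_space_finite[OF C(1)])
    also have "\<dots> = ennreal (\<Sum>y\<in>?C. cdf_at lk E y \<omega> / card ?C)"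
      using cdf_at_bounds(1) by (intro sum_ennreal) simp
    finally show ?thesis using True by (simp add: sum_divide_distrib)
  next
    case False
    have "share lk E y ll_one \<omega> = 0" for y
    proof (cases "y \<in> W \<omega> \<and> ll_one \<in> cluster \<omega> y")
      case True
      then have "ll_one \<in> W \<omega>" using cluster_W by blast
      then show ?thesis using False by simp
    qed (auto simp: share_def spec_cdf_def)
    then show ?thesis using False by simp
  qed
qed

lemma IDS_D_le_A:
  assumes fin: "AE \<omega> in M. ll_one \<in> W \<omega> \<longrightarrow> finite (cluster \<omega> ll_one)"
  shows "IDS LapD model m S p E \<le> IDS LapA model m S p E"
proof -
  have IDS: "ennreal (IDS lk model m S p E) = (\<integral>\<^sup>+\<omega>. \<integral>\<^sup>+y. share lk E y ll_one \<omega> \<partial>count_space G \<partial>M)" for lk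
    unfolding IDS_def ids_integrand_eq mass_transport[symmetric] nn_integral_share[OF fin, symmetric]
    by (rule nn_integral_eq_integral[symmetric, OF integrable_cdf_at]) (simp add: cdf_at_bounds)
  have "ennreal (IDS LapD model m S p E) \<le> ennreal (IDS LapA model m S p E)"
    unfolding IDS
  proof (rule nn_integral_mono_AE, use fin in eventually_elim)
    fix \<omega> assume f: "ll_one \<in> W \<omega> \<longrightarrow> finite (cluster \<omega> ll_one)"
    show "(\<integral>\<^sup>+y. share LapD E y ll_one \<omega> \<partial>count_space G) \<le> (\<integral>\<^sup>+y. share LapA E y ll_one \<omega> \<partial>count_space G)"
      unfolding nn_integral_share_received[OF f]
      using f cluster_trace_le[of ll_one \<omega> E] by (intro ennreal_leI) (simp add: divide_right_mono)
  qed
  moreover have "0 \<le> IDS LapA model m S p E"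
    unfolding IDS_def ids_integrand_eq by (rule Bochner_Integration.integral_nonneg) (rule cdf_at_bounds)
  ultimately show ?thesis by simp
qed

text \<open>The threshold is \<open>2 ^ (r - 1)\<close>: a smaller cluster satisfies the cardinality
  condition of \<open>faber_krahn\<close>, so all its eigenvalues exceed \<open>E\<close>. It is
  written as twice a power to match \<open>cluster_tail\<close>.\<close>

lemma IDS_A_le_tail:
  assumes L: "\<And>P. P \<subseteq> {0..<int r} \<Longrightarrow> has_length (walker P r) (r * L)"
    and E: "2 * (real r * L)\<^sup>2 * E < 1" and "2 \<le> r"
  shows "IDS LapA model m S p E \<le> prob {\<omega> \<in> space M. ll_one \<in> W \<omega> \<and> at_least (2 * 2 ^ (r - 2)) (cluster \<omega> ll_one)}"
proof -
  let ?A = "{\<omega> \<in> space M. ll_one \<in> W \<omega> \<and> at_least (2 * 2 ^ (r - 2)) (cluster \<omega> ll_one)}"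
  have ev: "?A \<in> events"
    using measurable_W measurable_at_least_cluster[OF one_G] by (simp add: pred_def sets.sets_Collect_conj)
  have pow: "(2::nat) ^ r = 4 * 2 ^ (r - 2)"
    using \<open>2 \<le> r\<close> by (metis le_add_diff_inverse power_add power2_eq_square numeral_Bit0 mult_2 mult_numeral_1)
  have "cdf_at LapA E ll_one \<omega> \<le> indicator ?A \<omega>" if "\<omega> \<in> space M" for \<omega>
  proof (cases "ll_one \<in> W \<omega> \<and> \<not> at_least (2 * 2 ^ (r - 2)) (cluster \<omega> ll_one)")
    case True
    let ?C = "cluster \<omega> ll_one"
    have C: "finite ?C" "card ?C < 2 * 2 ^ (r - 2)" using True by (simp_all add: at_least_def)
    interpret local_operator "hamiltonian LapA \<omega>" "W \<omega>" "adj \<omega>" "3 * card S"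
      by (rule local_operator_hamiltonian)
    obtain n e l where eb: "eigenbasis (hamiltonian LapA \<omega>) ?C n e l"
      by (rule eigenbasis_exists[OF C(1), of "hamiltonian LapA \<omega>"]) (rule H_sym)
    have "1 \<le> 2 * (real r * L)\<^sup>2 * l i" if "i < n" for i
    proof (rule eigenvalue_lower_bound[where a = "adj \<omega>" and W = "W \<omega>" and e = e and n = n])
      show "eigenbasis (lap_A (card S) (W \<omega>) (adj \<omega>)) ?C n e l" using eb by (simp add: hamiltonian_def)
    qed (use L C pow cluster_G[OF one_G] adj_cay that in simp_all)
    moreover have "2 * (real r * L)\<^sup>2 * l i < 1" if "l i \<le> E" for i
      using mult_left_mono[OF that, of "2 * (real r * L)\<^sup>2"] E by simp
    ultimately have "{i. i < n \<and> l i \<le> E} = {}" by fastforce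
    moreover have "cdf_at LapA E ll_one \<omega> = (\<Sum>i | i < n \<and> l i \<le> E. (e i ll_one)\<^sup>2)"
      by (rule spec_cdf_finite_cluster[OF cluster_def C(1) eb _ cluster_self]) (use True in simp)
    ultimately have "cdf_at LapA E ll_one \<omega> = 0" by (simp only: sum.empty)
    then show ?thesis by simp
  next
    case False
    then show ?thesis using that cdf_at_bounds(2)[of LapA \<omega> ll_one E] by (auto simp: indicator_def spec_cdf_def)
  qed
  then have "IDS LapA model m S p E \<le> (\<integral>\<omega>. indicator ?A \<omega> \<partial>M)"
    unfolding IDS_def ids_integrand_eq
    by (intro integral_mono integrable_cdf_at integrable_real_indicator) (use ev emeasure_finite in \<open>simp_all add: less_top[symmetric]\<close>)
  then show ?thesis using ev by simp
qed

end

theorem theorem3p8: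
  fixes m :: int and S :: "ll set" and model :: perc_model and p :: real
  assumes "m \<ge> 2"
    and "cayley_gen_set m S"
    and "0 \<le> p" and "p < p_crit model m S"
  shows "\<exists>b1 > 0. \<exists>b2 > 0. \<exists>E0 > 0. \<forall>E. 0 < E \<and> E < E0 \<longrightarrow>
           integrable (perc_space model m S p) (ids_integrand LapA model m S E)
         \<and> integrable (perc_space model m S p) (ids_integrand LapD model m S E)
         \<and> IDS LapD model m S p E \<le> IDS LapA model m S p E
         \<and> IDS LapA model m S p E \<le> exp (- b1 * exp (b2 * E powr (-1/2)))"
proof -
  interpret perc_graph m S model by unfold_locales (fact assms)+
  obtain P where P: "P \<le> 1" "p < P" "measure (perc_space model m S P)
      {\<omega> \<in> space (perc_space model m S P). percolates \<omega>} = 0"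
    using subcritical_witness[OF assms(4)] by blast
  interpret percolation m S model p by unfold_locales (use assms P in simp_all)
  obtain h where h: "0 < h" and decay: "\<And>e n. e \<in> I \<Longrightarrow>
      prob {\<omega> \<in> space M. at_least n (index_cluster \<omega> e)} \<le> 2 * exp (- h * real n)"
    using exponential_decay[OF P(2,1,3)] by blast
  have fin: "AE \<omega> in M. ll_one \<in> W \<omega> \<longrightarrow> finite (cluster \<omega> ll_one)"
    by (rule AE_finite_cluster[OF decay h one_G])
  obtain L where L: "0 < L" "\<And>P r. P \<subseteq> {0..<int r} \<Longrightarrow> has_length (walker P r) (r * L)"
    by (rule walker_length_linear) (rule that)
  \<comment> \<open>Prefactor of the tail bound, raised to at least 1 so that its logarithm is
    nonnegative.\<close>
  define K where "K = max 1 (2 * real (card {e \<in> I. ll_one \<in> e}))"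
  \<comment> \<open>With \<open>r\<close> about \<open>q / (2 * L)\<close>, the number of words
    \<open>2 ^ r\<close> is about \<open>exp (b * q)\<close>.\<close>
  define b where "b = ln 2 / (2 * real L)"
  have b: "0 < b" using L by (simp add: b_def)
  \<comment> \<open>The first bound makes \<open>q / (2 * L)\<close> at least 3, hence
    \<open>r\<close> too; the second lets half of the exponent absorb \<open>ln K\<close>.\<close>
  define E0 where "E0 = min ((1 / (6 * real L))\<^sup>2) ((b * h / (16 * (ln K + 1)))\<^sup>2)"
  have K: "1 \<le> K" "0 \<le> ln K" by (simp_all add: K_def)
  have lnK: "0 < ln K + 1" using K(2) by linarith
  have E0: "0 < E0"
    unfolding E0_def min_less_iff_conj
    by (intro conjI zero_less_power divide_pos_pos mult_pos_pos) (use L(1) b h lnK in simp_all)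
  have "IDS LapA model m S p E \<le> exp (- (h / 16) * exp (b * E powr (-1/2)))" if E: "0 < E" "E < E0" for E
  proof -
    define q where "q = E powr (-1/2)"
    have q: "q = 1 / sqrt E" using E by (simp add: q_def powr_minus_divide powr_half_sqrt)
    have sE: "0 < sqrt E" using E by simp
    have "sqrt E < 1 / (6 * real L)"
      using E L real_sqrt_less_mono[of E "(1 / (6 * real L))\<^sup>2"] by (simp add: E0_def)
    then have q6: "6 * real L \<le> q" using sE L by (simp add: q field_simps)
    have "sqrt E < b * h / (16 * (ln K + 1))"
      using E b h K real_sqrt_less_mono[of E "(b * h / (16 * (ln K + 1)))\<^sup>2"] by (simp add: E0_def)
    then have qK: "16 * (ln K + 1) \<le> b * h * q" using sE K by (simp add: q field_simps)
    \<comment> \<open>The scale balancing both requirements: \<open>r * L\<close> is at most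
      \<open>q / 2\<close>, so twice its square times \<open>E\<close> is at most one half, and
      \<open>r\<close> is maximal up to rounding.\<close>
    define r where "r = nat \<lfloor>q / (2 * L)\<rfloor>"
    have "3 \<le> q / (2 * L)" using q6 L by (simp add: field_simps)
    then have r: "3 \<le> r" "real r \<le> q / (2 * L)" "q / (2 * L) < real r + 1"
      unfolding r_def by linarith+
    have "2 * (real r * L)\<^sup>2 * E < 1"
    proof -
      have "real r * L \<le> q / 2" using r(2) L by (simp add: field_simps)
      then have "(real r * L)\<^sup>2 \<le> (q / 2)\<^sup>2" by (intro power_mono) simp_all
      then have "2 * (real r * L)\<^sup>2 * E \<le> 2 * (q / 2)\<^sup>2 * E" using E by (intro mult_right_mono) simp_all
      also have "\<dots> = 1 / 2" using E by (simp add: q power_divide)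
      finally show ?thesis by simp
    qed
    then have "IDS LapA model m S p E
        \<le> prob {\<omega> \<in> space M. ll_one \<in> W \<omega> \<and> at_least (2 * 2 ^ (r - 2)) (cluster \<omega> ll_one)}"
      using r by (intro IDS_A_le_tail[OF L(2)]) simp_all
    also have "\<dots> \<le> 2 * card {e \<in> I. ll_one \<in> e} * exp (- h * real (2 ^ (r - 2)))"
      by (rule cluster_tail[OF decay one_G])
    also have "\<dots> \<le> K * exp (- h * 2 ^ (r - 2))" by (intro mult_mono) (simp_all add: K_def)
    also have "\<dots> = exp (ln K - h * 2 ^ (r - 2))" using K by (simp add: exp_diff exp_minus field_simps)
    also have "\<dots> \<le> exp (- (h / 16) * exp (b * q))"
    proof -
      \<comment> \<open>Rounding costs one power of 2 and the shift in \<open>r - 2\<close> two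
        more, hence the factor 8.\<close>
      have "exp (b * q) / 8 \<le> 2 ^ (r - 2)"
      proof -
        have "b * q = ln 2 * (q / (2 * L))" by (simp add: b_def)
        also have "\<dots> \<le> ln 2 * (real (r - 2) + 3)" using r by (intro mult_left_mono) simp_all
        finally have "exp (b * q) \<le> exp (ln 2 * real (r - 2 + 3))" by simp
        also have "\<dots> = 2 ^ (r - 2 + 3)" by (simp only: exp_of_nat2_mult exp_ln zero_less_numeral)
        finally show ?thesis by (simp add: power_add)
      qed
      then have "h * (exp (b * q) / 8) \<le> h * 2 ^ (r - 2)" using h by (intro mult_left_mono) simp_all
      \<comment> \<open>Half of the gain \<open>h * exp (b * q) / 8\<close> pays for the prefactor,
        and the other half is the final exponent.\<close>
      moreover have "ln K \<le> (h / 16) * exp (b * q)"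
      proof -
        have "ln K \<le> (h / 16) * (b * q)" using qK by (simp add: field_simps)
        also have "\<dots> \<le> (h / 16) * exp (b * q)"
        proof (rule mult_left_mono)
          show "b * q \<le> exp (b * q)" using exp_ge_add_one_self[of "b * q"] by linarith
        qed (use h in simp)
        finally show ?thesis .
      qed
      ultimately show ?thesis by simp
    qed
    finally show ?thesis by (simp add: q_def)
  qed
  moreover have "integrable (perc_space model m S p) (ids_integrand lk model m S E)" for lk E
    unfolding ids_integrand_eq by (rule integrable_cdf_at)
  ultimately show ?thesis
    using IDS_D_le_A[OF fin] h b E0 by (intro exI[of _ "h / 16"] exI[of _ b] exI[of _ E0] conjI allI impI) auto
qed

end
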